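(* Let $\varepsilon<1$ be fixed. Let $\mathcal{E}$ be an ensemble of depth-$d$ circuits implementing $n$-qubit Clifford unitaries such that the state ensemble $\{U|0^n\rangle\}_{U\sim\mathcal{E}}$ (with fourth moment $\Phi_{\mathcal{E}}(|0^n\rangle\langle 0^n|^{\otimes 4})$) is a relative-error $\varepsilon$-approximate Clifford state $4$-design. Then: 1. If the architecture has diameter $\mathrm{dia}$ and $\mathcal{E}$ is locally independent, then $d=\Omega(\mathrm{dia})$. 2. If $\mathcal{E}$ is a generalized random brickwork over the Clifford group, then $d=\Omega(n)$ (for any architecture). The implied constants do not depend on $n$ (they may depend on $\varepsilon$ and on the constant gate-size $r$).
   Context: The $n$-qubit Clifford group $\mathrm{Cl}_n$ is the group of unitaries normalizing the $n$-qubit Pauli group (modulo phases a finite group, with uniform = Haar measure). For an ensemble (probability distribution) $\mathcal{E}$ of unitaries, $\Phi_{\mathcal{E}}(A)=\Phi^{(k)}_{\mathcal{E}}(A)=\mathbb{E}_{U\sim\mathcal{E}}U^{\otimes k}A\,U^{\dagger,\otimes k}$. For a group $G$, "$|\psi\rangle\sim G$" means $|\psi\rangle=U|0^n\rangle$ with $U$ Haar-random in $G$. An ensemble $\mathcal{E}'$ of pure states is a relative-error $\varepsilon$-approximate state $k$-design over $G$ (for $G=\mathrm{Cl}_n$: a Clifford state $k$-design) if $(1-\varepsilon)\,\mathbb{E}_{\psi\sim G}|\psi\rangle\langle\psi|^{\otimes k}\preceq\mathbb{E}_{\psi\sim\mathcal{E}'}|\psi\rangle\langle\psi|^{\otimes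 k}\preceq(1+\varepsilon)\,\mathbb{E}_{\psi\sim G}|\psi\rangle\langle\psi|^{\otimes k}$ in the positive-semidefinite order. An architecture is a graph whose vertices are the $n$ qubits. A depth-$d$ circuit is a product of $d$ layers; each layer is a product of gates with disjoint supports, each acting on at most a constant number $r$ of qubits that are connected in the graph. The depth of an ensemble is the maximal depth of its circuits. The diameter $\mathrm{dia}$ is the largest graph distance between two qubits. Locally independent ensemble: for a circuit $U$ let $S_x(U)$ be the set of local gates of $U$ that act on qubit $x$. $\mathcal{E}$ is locally independent if for every pair of qubits $x,y$ at graph distance at least $\mathrm{dia}/2$, $S_x(U)$ and $S_y(U)$ are independent random variables when $U\sim\mathcal{E}$. Generalized random brickwork: let $A_1,\dots,A_L$ be partitions of $[n]$ whose parts $a_{i,j}\in A_i$ have size at most a constant $r$ and consist of qubits connected in the architecture. For each $a_{i,j}$, either draw (independently) a uniformly random element of the group (here the Clifford group) on the qubits $a_{i,j}$, or apply the identity. The ensemble of circuits obtained by composing these in $L$ layers is a fixed brickwork (of depth $L$). A generalized random brickwork is a convex combination of fixed brickworks. *)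

theory Defs
  imports
    "HOL-Probability.Probability"
    "HOL-Library.Disjoint_Sets"
    "Jordan_Normal_Form.Schur_Decomposition"
begin

section \<open>Matrices and states\<close>

text \<open>
  An operator on \<open>n\<close> qubits is a complex \<open>2^n \<times> 2^n\<close> matrix. The qubits are \<open>0, \<dots>, n - 1\<close>, and
  the basis index \<open>i < 2^n\<close> stands for the basis state in which qubit \<open>q\<close> has the value \<open>bit i q\<close>.
\<close>

definition unitary_op :: "nat \<Rightarrow> complex mat \<Rightarrow> bool" where
  "unitary_op n U \<longleftrightarrow> U \<in> carrier_mat (2 ^ n) (2 ^ n) \<and>
     U * mat_adjoint U = 1\<^sub>m (2 ^ n) \<and> mat_adjoint U * U = 1\<^sub>m (2 ^ n)"

definition kron :: "complex mat \<Rightarrow> complex mat \<Rightarrow> complex mat" where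
  "kron A B = Matrix.mat (dim_row A * dim_row B) (dim_col A * dim_col B)
     (\<lambda>(i, j). A $$ (i div dim_row B, j div dim_col B) * B $$ (i mod dim_row B, j mod dim_col B))"

primrec kron_pow :: "complex mat \<Rightarrow> nat \<Rightarrow> complex mat" where
  "kron_pow A 0 = 1\<^sub>m 1"
| "kron_pow A (Suc k) = kron A (kron_pow A k)"

text \<open>The order on complex numbers: \<open>0 \<le> z\<close> says that \<open>z\<close> is real and nonnegative.\<close>

definition psd :: "complex mat \<Rightarrow> bool" where
  "psd A \<longleftrightarrow> dim_row A = dim_col A \<and> (\<forall>v \<in> carrier_vec (dim_col A). 0 \<le> (A *\<^sub>v v) \<bullet>c v)"

definition loewner_le :: "complex mat \<Rightarrow> complex mat \<Rightarrow> bool" where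
  "loewner_le A B \<longleftrightarrow> dim_row A = dim_row B \<and> dim_col A = dim_col B \<and> psd (B - A)"

definition ket0 :: "nat \<Rightarrow> complex Matrix.vec" where
  "ket0 n = unit_vec (2 ^ n) 0"

definition ket_bra :: "complex Matrix.vec \<Rightarrow> complex mat" where
  "ket_bra v = Matrix.mat (dim_vec v) (dim_vec v)
     (\<lambda>(i, j). vec_index v i * cnj (vec_index v j))"

section \<open>Pauli group and Clifford group\<close>

datatype pauli = PI | PX | PY | PZ

primrec pauli_mat :: "pauli \<Rightarrow> complex mat" where
  "pauli_mat PI = mat_of_rows_list 2 [[1, 0], [0, 1]]"
| "pauli_mat PX = mat_of_rows_list 2 [[0, 1], [1, 0]]"
| "pauli_mat PY = mat_of_rows_list 2 [[0, - \<i>], [\<i>, 0]]"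
| "pauli_mat PZ = mat_of_rows_list 2 [[1, 0], [0, - 1]]"

text \<open>The tensor product of \<open>pauli_mat (p q)\<close> over the qubits \<open>q < n\<close>, written entrywise.\<close>

definition pauli_string :: "nat \<Rightarrow> (nat \<Rightarrow> pauli) \<Rightarrow> complex mat" where
  "pauli_string n p = Matrix.mat (2 ^ n) (2 ^ n)
     (\<lambda>(i, j). \<Prod>q<n. pauli_mat (p q) $$ (of_bool (bit i q), of_bool (bit j q)))"

definition pauli_group :: "nat \<Rightarrow> complex mat set" where
  "pauli_group n = {c \<cdot>\<^sub>m pauli_string n p | c p. c ^ 4 = 1}"

definition clifford :: "nat \<Rightarrow> complex mat set" where
  "clifford n = {U. unitary_op n U \<and> (\<lambda>P. U * P * mat_adjoint U) ` pauli_group n = pauli_group n}"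

definition phase_rel :: "nat \<Rightarrow> (complex mat \<times> complex mat) set" where
  "phase_rel n = {(U, V). U \<in> clifford n \<and> V \<in> clifford n \<and> (\<exists>c. cmod c = 1 \<and> V = c \<cdot>\<^sub>m U)}"

text \<open>
  The uniform distribution on the finite quotient of the Clifford group by phases. The class that is
  drawn is replaced by one representative; which one does not affect the states below, which enter
  only through \<open>|\<psi>\<rangle>\<langle>\<psi>|\<close>.
\<close>

definition clifford_pmf :: "nat \<Rightarrow> complex mat pmf" where
  "clifford_pmf n = map_pmf (\<lambda>c. SOME U. U \<in> c) (pmf_of_set (clifford n // phase_rel n))"

section \<open>State designs\<close>

text \<open>
  The entrywise expectation of \<open>|\<psi>\<rangle>\<langle>\<psi>|\<^sup>\<otimes>\<^sup>k\<close>, for a random \<open>n\<close>-qubit state \<open>\<psi>\<close> on the probability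
  space \<open>M\<close>.
\<close>

definition state_moment :: "nat \<Rightarrow> nat \<Rightarrow> 'a measure \<Rightarrow> ('a \<Rightarrow> complex Matrix.vec) \<Rightarrow> complex mat" where
  "state_moment n k M \<psi> = Matrix.mat ((2 ^ n) ^ k) ((2 ^ n) ^ k)
     (\<lambda>(i, j). \<integral>\<omega>. kron_pow (ket_bra (\<psi> \<omega>)) k $$ (i, j) \<partial>M)"

definition clifford_state_moment :: "nat \<Rightarrow> nat \<Rightarrow> complex mat" where
  "clifford_state_moment n k = state_moment n k (measure_pmf (clifford_pmf n)) (\<lambda>U. U *\<^sub>v ket0 n)"

definition clifford_state_design ::
    "real \<Rightarrow> nat \<Rightarrow> nat \<Rightarrow> 'a measure \<Rightarrow> ('a \<Rightarrow> complex Matrix.vec) \<Rightarrow> bool" where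
  "clifford_state_design \<epsilon> k n M \<psi> \<longleftrightarrow>
     loewner_le (complex_of_real (1 - \<epsilon>) \<cdot>\<^sub>m clifford_state_moment n k) (state_moment n k M \<psi>) \<and>
     loewner_le (state_moment n k M \<psi>) (complex_of_real (1 + \<epsilon>) \<cdot>\<^sub>m clifford_state_moment n k)"

section \<open>Architectures\<close>

definition architecture :: "nat \<Rightarrow> (nat \<times> nat) set \<Rightarrow> bool" where
  "architecture n G \<longleftrightarrow> G \<subseteq> {..<n} \<times> {..<n} \<and> sym G \<and> irrefl G"

text \<open>The subgraph of \<open>G\<close> induced by the set \<open>a\<close> is connected.\<close>

definition connected_in :: "(nat \<times> nat) set \<Rightarrow> nat set \<Rightarrow> bool" where
  "connected_in G a \<longleftrightarrow> (\<forall>x\<in>a. \<forall>y\<in>a. (x, y) \<in> (G \<inter> a \<times> a)\<^sup>*)"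

text \<open>Meaningful if \<open>x\<close> and \<open>y\<close> are in the same component of \<open>G\<close>.\<close>

definition graph_dist :: "(nat \<times> nat) set \<Rightarrow> nat \<Rightarrow> nat \<Rightarrow> nat" where
  "graph_dist G x y = (LEAST k. (x, y) \<in> G ^^ k)"

definition graph_diam :: "nat \<Rightarrow> (nat \<times> nat) set \<Rightarrow> nat" where
  "graph_diam n G = Max {graph_dist G x y | x y. x < n \<and> y < n}"

section \<open>Circuits\<close>

text \<open>
  A gate is a set of qubits together with a unitary on these qubits; a layer is a list of gates with
  disjoint supports (so that its order is irrelevant), and a circuit is the list of its layers, the
  layer applied first coming first.
\<close>

type_synonym gate = "nat set \<times> complex mat"
type_synonym circuit = "gate list list"

text \<open>The basis index of the qubits in \<open>a\<close>, enumerated increasingly, within the \<open>n\<close>-qubit index \<open>i\<close>.\<close>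

definition sub_index :: "nat set \<Rightarrow> nat \<Rightarrow> nat" where
  "sub_index a i = (\<Sum>q\<in>a. of_bool (bit i q) * 2 ^ card {p \<in> a. p < q})"

text \<open>The tensor product of the gate with the identity on the qubits outside its support.\<close>

definition gate_op :: "nat \<Rightarrow> gate \<Rightarrow> complex mat" where
  "gate_op n g = Matrix.mat (2 ^ n) (2 ^ n)
     (\<lambda>(i, j). if \<forall>q<n. q \<notin> fst g \<longrightarrow> bit i q = bit j q
              then snd g $$ (sub_index (fst g) i, sub_index (fst g) j) else 0)"

primrec layer_op :: "nat \<Rightarrow> gate list \<Rightarrow> complex mat" where
  "layer_op n [] = 1\<^sub>m (2 ^ n)"
| "layer_op n (g # l) = layer_op n l * gate_op n g"

primrec circuit_op :: "nat \<Rightarrow> circuit \<Rightarrow> complex mat" where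
  "circuit_op n [] = 1\<^sub>m (2 ^ n)"
| "circuit_op n (l # C) = circuit_op n C * layer_op n l"

text \<open>A nonempty set of at most \<open>r\<close> qubits on which a local gate may act.\<close>

definition local_support :: "nat \<Rightarrow> (nat \<times> nat) set \<Rightarrow> nat \<Rightarrow> nat set \<Rightarrow> bool" where
  "local_support n G r a \<longleftrightarrow> a \<noteq> {} \<and> a \<subseteq> {..<n} \<and> card a \<le> r \<and> connected_in G a"

definition layer :: "nat \<Rightarrow> (nat \<times> nat) set \<Rightarrow> nat \<Rightarrow> gate list \<Rightarrow> bool" where
  "layer n G r l \<longleftrightarrow>
     (\<forall>(a, U) \<in> set l. local_support n G r a \<and> unitary_op (card a) U) \<and>
     sorted_wrt (\<lambda>g h. fst g \<inter> fst h = {}) l"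

definition circuit :: "nat \<Rightarrow> (nat \<times> nat) set \<Rightarrow> nat \<Rightarrow> circuit \<Rightarrow> bool" where
  "circuit n G r C \<longleftrightarrow> (\<forall>l \<in> set C. layer n G r l)"

section \<open>Ensembles of circuits\<close>

text \<open>A gate is located in its circuit: its position \<open>t\<close> is part of its identity.\<close>

definition gates_at :: "nat \<Rightarrow> circuit \<Rightarrow> (nat \<times> gate) set" where
  "gates_at x C = {(t, g). t < length C \<and> g \<in> set (C ! t) \<and> x \<in> fst g}"

text \<open>
  A probability measure on circuits, on any \<open>\<sigma>\<close>-algebra for which the gates and the implemented
  unitary are random. Since a layer contains at most one gate on a given support, the events in the
  second condition determine the position, support and matrix entries of the gates at \<open>x\<close>.
  Almost every circuit is built from gates admitted by the architecture, implements a Clifford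
  unitary, and has at most \<open>d\<close> layers (a shallower circuit may be padded with empty layers).
\<close>

definition clifford_circuit_ensemble ::
    "nat \<Rightarrow> (nat \<times> nat) set \<Rightarrow> nat \<Rightarrow> nat \<Rightarrow> circuit measure \<Rightarrow> bool" where
  "clifford_circuit_ensemble n G r d E \<longleftrightarrow> prob_space E \<and>
     (\<forall>x<n. \<forall>t a. \<forall>i < 2 ^ card a. \<forall>j < 2 ^ card a. \<forall>B \<in> sets borel.
        {C \<in> space E. \<exists>U. (t, (a, U)) \<in> gates_at x C \<and> U $$ (i, j) \<in> B} \<in> sets E) \<and>
     (\<forall>i < 2 ^ n. \<forall>j < 2 ^ n. (\<lambda>C. circuit_op n C $$ (i, j)) \<in> borel_measurable E) \<and>
     (AE C in E. circuit n G r C \<and> length C \<le> d \<and> circuit_op n C \<in> clifford n)"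

text \<open>
  The events determined by \<open>gates_at x\<close>, for the largest \<open>\<sigma>\<close>-algebra on its values that makes it a
  random variable.
\<close>

definition gate_events :: "circuit measure \<Rightarrow> nat \<Rightarrow> circuit set set" where
  "gate_events E x = {gates_at x -` A \<inter> space E | A. True} \<inter> sets E"

definition locally_independent :: "nat \<Rightarrow> (nat \<times> nat) set \<Rightarrow> circuit measure \<Rightarrow> bool" where
  "locally_independent n G E \<longleftrightarrow>
     (\<forall>x<n. \<forall>y<n. real (graph_dist G x y) \<ge> real (graph_diam n G) / 2 \<longrightarrow>
        prob_space.indep_set E (gate_events E x) (gate_events E y))"

section \<open>Generalized random brickworks\<close>

text \<open>
  The layout of a fixed brickwork: for each layer, a partition of the qubits, with each part marked
  \<open>True\<close> if it carries a random gate and \<open>False\<close> if it carries the identity.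
\<close>

definition brickwork_layout ::
    "nat \<Rightarrow> (nat \<times> nat) set \<Rightarrow> nat \<Rightarrow> (nat set \<times> bool) list list \<Rightarrow> bool" where
  "brickwork_layout n G r s \<longleftrightarrow> (\<forall>l \<in> set s. distinct (map fst l) \<and>
     partition_on {..<n} (fst ` set l) \<and> (\<forall>a \<in> fst ` set l. local_support n G r a))"

text \<open>Lists with independent entries of the given distributions.\<close>

primrec independent_list_pmf :: "'a pmf list \<Rightarrow> 'a list pmf" where
  "independent_list_pmf [] = return_pmf []"
| "independent_list_pmf (p # ps) =
     bind_pmf p (\<lambda>x. map_pmf ((#) x) (independent_list_pmf ps))"

definition brick_pmf :: "nat set \<times> bool \<Rightarrow> gate pmf" where
  "brick_pmf = (\<lambda>(a, random). map_pmf (Pair a)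
     (if random then clifford_pmf (card a) else return_pmf (1\<^sub>m (2 ^ card a))))"

definition fixed_brickwork_pmf :: "(nat set \<times> bool) list list \<Rightarrow> circuit pmf" where
  "fixed_brickwork_pmf s = independent_list_pmf (map (\<lambda>l. independent_list_pmf (map brick_pmf l)) s)"

definition generalized_random_brickwork ::
    "nat \<Rightarrow> (nat \<times> nat) set \<Rightarrow> nat \<Rightarrow> circuit measure \<Rightarrow> bool" where
  "generalized_random_brickwork n G r E \<longleftrightarrow>
     (\<exists>W. (\<forall>s \<in> set_pmf W. brickwork_layout n G r s) \<and>
          E = measure_pmf (bind_pmf W fixed_brickwork_pmf))"

end

theory Submission
  imports Defs
begin

text \<open>
  For a Pauli string \<open>P\<close>, the operator \<open>\<Sum>\<^sub>Q \<plusminus> Q\<^sup>\<otimes>\<^sup>4\<close>, with the sign telling whether \<open>Q\<close>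
  commutes with \<open>P\<close>, is positive semidefinite, and its expectation in \<open>\<psi>\<^sup>\<otimes>\<^sup>4\<close> for a stabilizer
  state \<open>\<psi>\<close> is \<open>2^n\<close> if \<open>P\<close> or \<open>- P\<close> stabilizes \<open>\<psi>\<close>, and \<open>0\<close> otherwise. Hence a relative-error design
  has to reproduce, up to the factors \<open>1 \<plusminus> \<epsilon>\<close>, the exponentially small probability
  \<open>1 / (2^n + 1)\<close> with which a given \<open>P \<noteq> I\<close> stabilizes a uniformly random stabilizer state.

  Suppose that the depth is small compared with the diameter, and let \<open>P\<close> act on a qubit \<open>x\<close> whose light cone is
  disjoint from that of a set of qubits carrying \<open>m\<close> pairwise anticommuting strings \<open>Q\<^sub>j\<close>. Then
  \<open>P Q\<^sub>j\<close> can stabilize the state only if both \<open>P\<close> and \<open>Q\<^sub>j\<close> do, and at most one \<open>Q\<^sub>j\<close> does. So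
  \<open>m (1 - \<epsilon>) \<le> 1 + \<epsilon>\<close>, which fails for large \<open>m\<close>.

  In a random brickwork of depth \<open>d\<close>, all gates on qubit \<open>0\<close> are trivial with probability at least \<open>q^d\<close>, for a
  constant \<open>q > 0\<close>, and then \<open>Z\<close> on qubit \<open>0\<close> stabilizes the state; so \<open>q^d \<le> (1 + \<epsilon>) / (2^n + 1)\<close>.
\<close>

section \<open>Complex matrices\<close>

text \<open>Four copies make the signed sum of fourth tensor powers a multiple of a projector: Pauli
  strings multiply up to fourth roots of unity, so their fourth tensor powers multiply without
  phases, and commutation with \<open>P\<close> is a character of the strings modulo phases. A
  stabilizer state then contributes the sum of this character over its 2^n stabilizing strings,
  which vanishes unless \<open>P\<close> is one of them. The value 1 / (2^n + 1) is a count: up to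
  sign, each state is stabilized by 2^n - 1 of the 4^n - 1 nonidentity strings, and the Clifford
  group permutes these transitively.

  A single pair \<open>P\<close>, \<open>Q\<close> with disjoint light cones gives no contradiction:
  it only shows Pr[\<open>P Q\<close>] <= Pr[\<open>P\<close>], and both have the same order.
  Mutually exclusive strings make the left sides add up; m >= 2 / (1 - \<open>\<epsilon>\<close>) of
  them suffice because 1 + \<open>\<epsilon>\<close> < 2. Since m depends on
  \<open>\<epsilon>\<close> alone, they occupy a constant number of sites at one end of a shortest
  path.

  For brickworks, q is one over a bound on the number of Clifford classes on at most r qubits: a
  gate is trivial when the identity class is drawn.\<close>

lemma mat_mult_entry:
  assumes "A \<in> carrier_mat a b" "B \<in> carrier_mat b c" "i < a" "j < c"
  shows "(A * B) $$ (i, j) = (\<Sum>k<b. A $$ (i, k) * B $$ (k, j))"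
  using assms by (auto simp: scalar_prod_def lessThan_atLeast0 intro!: sum.cong)

lemma smult_smult_mat: "a \<cdot>\<^sub>m (b \<cdot>\<^sub>m A) = (a * b) \<cdot>\<^sub>m (A :: 'a::semigroup_mult mat)"
  by (rule eq_matI) (auto simp: mult.assoc)

lemma one_smult_mat [simp]: "1 \<cdot>\<^sub>m A = (A :: 'a::monoid_mult mat)"
  by (rule eq_matI) auto

lemma mult_four_mat:
  assumes "A \<in> carrier_mat n n" "B \<in> carrier_mat n n" "C \<in> carrier_mat n n" "D \<in> carrier_mat n n"
  shows "(A * B) * (C * D) = A * (B * C) * (D :: 'a::semiring_0 mat)"
proof -
  have "(A * B) * (C * D) = ((A * B) * C) * D" 
    by (rule assoc_mult_mat[symmetric, OF mult_carrier_mat[OF assms(1,2)] assms(3,4)])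
  also have "(A * B) * C = A * (B * C)" by (rule assoc_mult_mat[OF assms(1-3)])
  finally show ?thesis .
qed

lemma mat_adjoint_dim [simp]:
  "dim_row (mat_adjoint A) = dim_col A" "dim_col (mat_adjoint A) = dim_row A"
  unfolding mat_adjoint_def by simp_all

lemma mat_adjoint_carrier [simp, intro]: "A \<in> carrier_mat a b \<Longrightarrow> mat_adjoint A \<in> carrier_mat b a"
  by (rule carrier_matI) (simp_all only: mat_adjoint_dim carrier_matD)

lemma mat_adjoint_entry:
  assumes "A \<in> carrier_mat a b" "i < b" "j < a"
  shows "mat_adjoint A $$ (i, j) = cnj (A $$ (j, i))"
proof -
  have "dim_row A = a" "dim_col A = b" using assms(1) by (simp_all only: carrier_matD)
  then show ?thesis using assms(2,3) by (simp add: mat_adjoint_def mat_of_rows_index)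
qed

lemma sum_lessThan_double:
  fixes f :: "nat \<Rightarrow> 'a::comm_monoid_add"
  shows "(\<Sum>k<2*m. f k) = (\<Sum>k<m. f (2 * k) + f (Suc (2 * k)))"
proof (induction m)
  case (Suc m)
  have e: "2 * Suc m = Suc (Suc (2 * m))" by simp
  show ?case unfolding e by (simp add: Suc.IH add.assoc)
qed simp

text \<open>The distributive law behind the entrywise tensor product: the sum over the intermediate
  index of a matrix product becomes one two-term sum per qubit. The induction splits off the lowest
  bit, hence the grouping into even and odd indices.\<close>

lemma sum_prod_bits:
  fixes f :: "nat \<Rightarrow> bool \<Rightarrow> 'a::comm_semiring_1"
  shows "(\<Sum>k<(2::nat)^n. \<Prod>q<n. f q (bit k q)) = (\<Prod>q<n. f q False + f q True)"
proof (induction n arbitrary: f)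
  case (Suc n)
  have b: "bit (2 * k) (Suc q) = bit k q" "bit (Suc (2 * k)) (Suc q) = bit k q"
    "\<not> bit (2 * k) 0" "bit (Suc (2 * k)) 0" for k q :: nat
    by (simp_all add: bit_Suc bit_0)
  have "(\<Sum>k<(2::nat)^Suc n. \<Prod>q<Suc n. f q (bit k q)) =
        (\<Sum>k<(2::nat)^n. (f 0 False + f 0 True) * (\<Prod>q<n. f (Suc q) (bit k q)))"
    unfolding power_Suc sum_lessThan_double prod.lessThan_Suc_shift
    by (rule sum.cong) (simp_all only: b distrib_right)
  also have "\<dots> = (f 0 False + f 0 True) * (\<Prod>q<n. f (Suc q) False + f (Suc q) True)"
    unfolding sum_distrib_left[symmetric] using Suc.IH[of "\<lambda>q. f (Suc q)"] by simp
  finally show ?case unfolding prod.lessThan_Suc_shift .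
qed simp

section \<open>Pauli strings\<close>

definition pauli_entry :: "pauli \<Rightarrow> bool \<Rightarrow> bool \<Rightarrow> complex" where
  "pauli_entry a x y = pauli_mat a $$ (of_bool x, of_bool y)"

lemma pauli_entry_simps [simp]:
  "pauli_entry PI x y = of_bool (x = y)"
  "pauli_entry PX x y = of_bool (x \<noteq> y)"
  "pauli_entry PY x y = (if x = y then 0 else if x then \<i> else - \<i>)"
  "pauli_entry PZ x y = (if x \<noteq> y then 0 else if x then - 1 else 1)"
  by (auto simp: pauli_entry_def mat_of_rows_list_def)

text \<open>Multiplication modulo phases, a Klein four-group. \<open>pauli_phase\<close> records the
  phase that is lost, and \<open>pauli_sign\<close> is the sign picked up when the two factors are
  exchanged.\<close>

definition pauli_prod :: "pauli \<Rightarrow> pauli \<Rightarrow> pauli" where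
  "pauli_prod a b = (if a = PI then b else if b = PI then a else if a = b then PI
     else if {a, b} = {PX, PY} then PZ else if {a, b} = {PX, PZ} then PY else PX)"

definition pauli_phase :: "pauli \<Rightarrow> pauli \<Rightarrow> complex" where
  "pauli_phase a b = (if a = PI \<or> b = PI \<or> a = b then 1
     else if (a, b) \<in> {(PX, PY), (PY, PZ), (PZ, PX)} then \<i> else - \<i>)"

definition pauli_sign :: "pauli \<Rightarrow> pauli \<Rightarrow> complex" where
  "pauli_sign a b = (if a = PI \<or> b = PI \<or> a = b then 1 else - 1)"

lemma pauli_entry_mult:
  "pauli_entry a x False * pauli_entry b False y + pauli_entry a x True * pauli_entry b True y =
   pauli_phase a b * pauli_entry (pauli_prod a b) x y"
  by (cases a; cases b; cases x; cases y) (simp_all add: pauli_phase_def pauli_prod_def doubleton_eq_iff)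

lemma pauli_phase_pow4: "pauli_phase a b ^ 4 = 1"
  by (auto simp: pauli_phase_def)

lemma pauli_phase_swap: "pauli_phase a b = pauli_sign a b * pauli_phase b a"
  by (cases a; cases b) (simp_all add: pauli_phase_def pauli_sign_def)

lemma pauli_prod_commute: "pauli_prod a b = pauli_prod b a"
  by (cases a; cases b) (simp_all add: pauli_prod_def doubleton_eq_iff)

lemma pauli_prod_cancel [simp]: "pauli_prod a (pauli_prod a b) = b"
  by (cases a; cases b) (simp_all add: pauli_prod_def doubleton_eq_iff)

lemma pauli_prod_PI [simp]: "pauli_prod a PI = a" "pauli_prod PI a = a" "pauli_prod a a = PI"
  by (simp_all add: pauli_prod_def)

lemma pauli_sign_commute: "pauli_sign a b = pauli_sign b a"
  by (auto simp: pauli_sign_def)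

lemma pauli_sign_prod: "pauli_sign a (pauli_prod b c) = pauli_sign a b * pauli_sign a c"
  by (cases a; cases b; cases c) (simp_all add: pauli_sign_def pauli_prod_def doubleton_eq_iff)

lemma pauli_sign_PI [simp]: "pauli_sign a PI = 1" "pauli_sign PI a = 1" "pauli_sign a a = 1"
  by (simp_all add: pauli_sign_def)

lemma pauli_sign_values: "pauli_sign a b = 1 \<or> pauli_sign a b = -1"
  by (auto simp: pauli_sign_def)

lemma pauli_sign_separates: "a \<noteq> b \<Longrightarrow> \<exists>t. pauli_sign a t \<noteq> pauli_sign b t"
proof -
  assume "a \<noteq> b"
  then have "\<exists>t\<in>{PX, PY, PZ}. pauli_sign a t \<noteq> pauli_sign b t"
    by (cases a; cases b) (simp_all add: pauli_sign_def)
  then show ?thesis by blast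
qed

text \<open>If \<open>a\<close> and \<open>b\<close> differ, the third nontrivial Pauli serves; if
  they agree, either of the other two does.\<close>

lemma pauli_common_anticommuting:
  "a \<noteq> PI \<Longrightarrow> b \<noteq> PI \<Longrightarrow> \<exists>t. pauli_sign a t = -1 \<and> pauli_sign b t = -1"
proof -
  assume "a \<noteq> PI" "b \<noteq> PI"
  then have "\<exists>t\<in>{PX, PY, PZ}. pauli_sign a t = -1 \<and> pauli_sign b t = -1"
    by (cases a; cases b) (simp_all add: pauli_sign_def)
  then show ?thesis by blast
qed

lemma pauli_string_carrier [simp, intro]: "pauli_string n p \<in> carrier_mat (2 ^ n) (2 ^ n)"
  by (simp add: pauli_string_def)

lemma pauli_string_dim [simp]:
  "dim_row (pauli_string n p) = 2 ^ n" "dim_col (pauli_string n p) = 2 ^ n"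
  by (simp_all add: pauli_string_def)

lemma pauli_string_entry:
  "i < 2 ^ n \<Longrightarrow> j < 2 ^ n \<Longrightarrow>
   pauli_string n p $$ (i, j) = (\<Prod>q<n. pauli_entry (p q) (bit i q) (bit j q))"
  by (simp add: pauli_string_def pauli_entry_def)

lemma pauli_string_cong: "(\<And>q. q < n \<Longrightarrow> p q = p' q) \<Longrightarrow> pauli_string n p = pauli_string n p'"
  unfolding pauli_string_def by (intro eq_matI) (auto intro!: prod.cong)

definition string_prod :: "nat \<Rightarrow> (nat \<Rightarrow> pauli) \<Rightarrow> (nat \<Rightarrow> pauli) \<Rightarrow> nat \<Rightarrow> pauli" where
  "string_prod n p p' = (\<lambda>q\<in>{..<n}. pauli_prod (p q) (p' q))"

definition string_phase :: "nat \<Rightarrow> (nat \<Rightarrow> pauli) \<Rightarrow> (nat \<Rightarrow> pauli) \<Rightarrow> complex" where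
  "string_phase n p p' = (\<Prod>q<n. pauli_phase (p q) (p' q))"

definition string_sign :: "nat \<Rightarrow> (nat \<Rightarrow> pauli) \<Rightarrow> (nat \<Rightarrow> pauli) \<Rightarrow> complex" where
  "string_sign n p p' = (\<Prod>q<n. pauli_sign (p q) (p' q))"

text \<open>Extensional functions, so that every Pauli string is represented exactly once.\<close>

definition strings :: "nat \<Rightarrow> (nat \<Rightarrow> pauli) set" where
  "strings n = {..<n} \<rightarrow>\<^sub>E UNIV"

lemma pauli_string_mult:
  "pauli_string n p * pauli_string n p' = string_phase n p p' \<cdot>\<^sub>m pauli_string n (string_prod n p p')"
proof (rule eq_matI)
  fix i j assume "i < dim_row (string_phase n p p' \<cdot>\<^sub>m pauli_string n (string_prod n p p'))"
    "j < dim_col (string_phase n p p' \<cdot>\<^sub>m pauli_string n (string_prod n p p'))"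
  hence ij: "i < 2 ^ n" "j < 2 ^ n" by simp_all
  have "(pauli_string n p * pauli_string n p') $$ (i, j) =
     (\<Sum>k<(2::nat)^n. \<Prod>q<n. pauli_entry (p q) (bit i q) (bit k q) * pauli_entry (p' q) (bit k q) (bit j q))"
    by (subst mat_mult_entry[of _ "2^n" "2^n" _ "2^n"])
       (auto simp: ij pauli_string_entry prod.distrib intro!: sum.cong)
  also have "\<dots> = (\<Prod>q<n. pauli_phase (p q) (p' q) * pauli_entry (pauli_prod (p q) (p' q)) (bit i q) (bit j q))"
    by (subst sum_prod_bits[of "\<lambda>q b. pauli_entry (p q) (bit i q) b * pauli_entry (p' q) b (bit j q)"])
       (simp add: pauli_entry_mult)
  finally show "(pauli_string n p * pauli_string n p') $$ (i, j) =
      (string_phase n p p' \<cdot>\<^sub>m pauli_string n (string_prod n p p')) $$ (i, j)"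
    using ij by (simp add: pauli_string_entry string_phase_def string_prod_def prod.distrib)
qed simp_all

lemma string_phase_pow4: "string_phase n p p' ^ 4 = 1"
  by (simp add: string_phase_def pauli_phase_pow4 prod_power_distrib)

lemma string_prod_commute: "string_prod n p p' = string_prod n p' p"
  by (simp add: string_prod_def pauli_prod_commute)

lemma string_sign_commute: "string_sign n p p' = string_sign n p' p"
  by (simp add: string_sign_def pauli_sign_commute)

lemma string_sign_prod: "string_sign n p (string_prod n p' p'') = string_sign n p p' * string_sign n p p''"
  by (simp add: string_sign_def string_prod_def pauli_sign_prod prod.distrib)

lemma string_sign_values: "string_sign n p p' = 1 \<or> string_sign n p p' = -1"
proof (induction n)
  case (Suc n)
  then show ?case using pauli_sign_values[of "p n" "p' n"] by (auto simp: string_sign_def)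
qed (simp add: string_sign_def)

lemma pauli_string_commute:
  "pauli_string n p * pauli_string n p' = string_sign n p p' \<cdot>\<^sub>m (pauli_string n p' * pauli_string n p)"
proof -
  have "string_phase n p p' = string_sign n p p' * string_phase n p' p"
    unfolding string_phase_def string_sign_def prod.distrib[symmetric]
    by (rule prod.cong[OF refl pauli_phase_swap])
  then show ?thesis unfolding pauli_string_mult smult_smult_mat by (metis string_prod_commute)
qed

lemma bits_eq_iff:
  assumes "i < 2 ^ n" "j < 2 ^ n"
  shows "(\<forall>q<n. bit i q = bit j q) \<longleftrightarrow> i = (j::nat)"
proof
  assume h: "\<forall>q<n. bit i q = bit j q"
  have "take_bit n i = take_bit n j" by (rule bit_eqI) (auto simp: bit_take_bit_iff h)
  then show "i = j" using assms by (metis take_bit_nat_eq_self)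
qed simp

lemma prod_of_bool: "(\<Prod>q<n. of_bool (P q)) = (of_bool (\<forall>q<(n::nat). P q) :: 'a::comm_semiring_1)"
  by (induction n) (auto simp: less_Suc_eq)

lemma pauli_string_PI: 
  assumes "\<And>q. q < n \<Longrightarrow> p q = PI" shows "pauli_string n p = 1\<^sub>m (2 ^ n)"
proof (rule eq_matI)
  fix i j assume "i < dim_row (1\<^sub>m (2 ^ n))" "j < dim_col (1\<^sub>m (2 ^ n))"
  hence ij: "i < 2 ^ n" "j < 2 ^ n" by simp_all
  have "pauli_string n p $$ (i, j) = (\<Prod>q<n. of_bool (bit i q = bit j q))"
    using ij assms by (simp add: pauli_string_entry)
  also have "\<dots> = of_bool (\<forall>q<n. bit i q = bit j q)" by (rule prod_of_bool)
  also have "(\<forall>q<n. bit i q = bit j q) \<longleftrightarrow> i = j" by (rule bits_eq_iff[OF ij])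
  finally show "pauli_string n p $$ (i, j) = 1\<^sub>m (2 ^ n) $$ (i, j)" using ij by simp
qed simp_all

lemma pauli_string_square [simp]: "pauli_string n p * pauli_string n p = 1\<^sub>m (2 ^ n)"
proof -
  have "string_phase n p p = 1" by (simp add: string_phase_def pauli_phase_def)
  then show ?thesis
    by (simp add: pauli_string_mult pauli_string_PI string_prod_def)
qed

lemma pauli_string_adjoint [simp]: "mat_adjoint (pauli_string n p) = pauli_string n p"
proof (rule eq_matI)
  have e: "cnj (pauli_entry a x y) = pauli_entry a y x" for a x y by (cases a) auto
  fix i j assume "i < dim_row (pauli_string n p)" "j < dim_col (pauli_string n p)"
  then show "mat_adjoint (pauli_string n p) $$ (i, j) = pauli_string n p $$ (i, j)"
    by (simp add: mat_adjoint_entry[of _ "2^n" "2^n"] pauli_string_entry e)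
qed simp_all

text \<open>After multiplication by the inverse, the scalars can be read off entry (0, 0), which
  exists since \<open>N > 0\<close>.\<close>

lemma smult_cancel_invertible:
  assumes "c \<cdot>\<^sub>m (A::complex mat) = d \<cdot>\<^sub>m A" "A * B = 1\<^sub>m N" "A \<in> carrier_mat N N" "N > 0" "B \<in> carrier_mat N N"
  shows "c = d"
proof -
  have "c \<cdot>\<^sub>m (A * B) = (c \<cdot>\<^sub>m A) * B" "d \<cdot>\<^sub>m (A * B) = (d \<cdot>\<^sub>m A) * B"
    by (rule mult_smult_assoc_mat[symmetric, OF assms(3,5)])+
  hence "c \<cdot>\<^sub>m (A * B) = d \<cdot>\<^sub>m (A * B)" by (simp only: assms(1))
  hence "(c \<cdot>\<^sub>m (1\<^sub>m N)) $$ (0,0) = (d \<cdot>\<^sub>m (1\<^sub>m N :: complex mat)) $$ (0,0)" using assms by simp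
  then show ?thesis using assms by simp
qed

definition single_string :: "nat \<Rightarrow> nat \<Rightarrow> pauli \<Rightarrow> nat \<Rightarrow> pauli" where
  "single_string n x a = (\<lambda>q\<in>{..<n}. if q = x then a else PI)"

lemma single_string_in_strings [simp]: "single_string n x a \<in> strings n"
  by (simp add: single_string_def strings_def)

lemma string_sign_single: "x < n \<Longrightarrow> string_sign n p (single_string n x a) = pauli_sign (p x) a"
proof -
  assume x: "x < n"
  have "string_sign n p (single_string n x a) = (\<Prod>q<n. if q = x then pauli_sign (p x) a else 1)"
    unfolding string_sign_def single_string_def by (rule prod.cong) auto
  then show ?thesis using x by simp
qed

text \<open>A scalar factor does not affect how a matrix commutes with \<open>t\<close>. Commutation
  signs are therefore invariants of a string up to scalars, and those against single-qubit strings
  determine every letter.\<close>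

lemma pauli_string_sign_eq:
  assumes "pauli_string n p = c \<cdot>\<^sub>m pauli_string n p'"
  shows "string_sign n p t = string_sign n p' t"
proof -
  let ?P = "pauli_string n p" and ?Q = "pauli_string n p'" and ?T = "pauli_string n t"
  have "?P * ?T = c \<cdot>\<^sub>m (?Q * ?T)" unfolding assms
    by (rule mult_smult_assoc_mat) auto
  also have "?Q * ?T = string_sign n p' t \<cdot>\<^sub>m (?T * ?Q)" by (rule pauli_string_commute)
  also have "c \<cdot>\<^sub>m (string_sign n p' t \<cdot>\<^sub>m (?T * ?Q)) = string_sign n p' t \<cdot>\<^sub>m (?T * ?P)"
    unfolding assms by (subst mult_smult_distrib[of _ "2^n" "2^n" _ "2^n"]) (auto simp: smult_smult_mat mult.commute)
  finally have e: "string_sign n p t \<cdot>\<^sub>m (?T * ?P) = string_sign n p' t \<cdot>\<^sub>m (?T * ?P)"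
    by (simp add: pauli_string_commute[of n p t])
  have "(?T * ?P) * (?P * ?T) = ?T * (?P * ?P) * ?T"
    by (rule mult_four_mat) auto
  also have "\<dots> = 1\<^sub>m (2^n)" by simp
  finally have inv: "(?T * ?P) * (?P * ?T) = 1\<^sub>m (2^n)" .
  show ?thesis by (rule smult_cancel_invertible[OF e inv]) auto
qed

lemma pauli_string_independent:
  assumes "pauli_string n p = c \<cdot>\<^sub>m pauli_string n p'" "q < n"
  shows "p q = p' q"
proof (rule ccontr)
  assume "p q \<noteq> p' q"
  then obtain t where "pauli_sign (p q) t \<noteq> pauli_sign (p' q) t" using pauli_sign_separates by blast
  then show False using pauli_string_sign_eq[OF assms(1), of "single_string n q t"] assms(2)
    by (simp add: string_sign_single)
qed

lemma strings_eqI: "p \<in> strings n \<Longrightarrow> p' \<in> strings n \<Longrightarrow> (\<And>q. q < n \<Longrightarrow> p q = p' q) \<Longrightarrow> p = p'"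
  unfolding strings_def by (rule PiE_ext) auto

lemma finite_UNIV_pauli: "finite (UNIV :: pauli set)" and UNIV_pauli: "(UNIV :: pauli set) = {PI, PX, PY, PZ}"
proof -
  show "(UNIV :: pauli set) = {PI, PX, PY, PZ}" using pauli.exhaust by auto
  then show "finite (UNIV :: pauli set)" by (metis finite.simps)
qed

lemma finite_strings [simp]: "finite (strings n)"
  unfolding strings_def by (rule finite_PiE) (auto simp: finite_UNIV_pauli)

lemma card_strings: "card (strings n) = 4 ^ n"
  by (simp add: strings_def card_PiE UNIV_pauli numeral_eq_Suc)

lemma string_prod_in_strings [simp]: "string_prod n p p' \<in> strings n"
  by (simp add: string_prod_def strings_def)

lemma string_prod_cancel: "p' \<in> strings n \<Longrightarrow> string_prod n p (string_prod n p p') = p'"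
  by (rule strings_eqI[OF string_prod_in_strings]) (auto simp: string_prod_def)

lemma strings_normalise: "restrict p {..<n} \<in> strings n" "pauli_string n (restrict p {..<n}) = pauli_string n p"
  by (auto simp: strings_def intro: pauli_string_cong)

text \<open>The diagonal strings, which form the stabilizer group of the all-zero state. Strings
  pulled back through a Clifford circuit are compared with this group.\<close>

definition z_type :: "nat \<Rightarrow> (nat \<Rightarrow> pauli) \<Rightarrow> bool" where
  "z_type n p \<longleftrightarrow> (\<forall>q<n. p q \<in> {PI, PZ})"

lemma pauli_string_entry_0: "pauli_string n p $$ (0, 0) = of_bool (z_type n p)"
proof -
  have z0: "pauli_entry a False False = of_bool (a \<in> {PI, PZ})" for a by (cases a) auto
  have "pauli_string n p $$ (0, 0) = (\<Prod>q<n. of_bool (p q \<in> {PI, PZ}))"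
    by (simp only: pauli_string_entry zero_less_power zero_less_numeral bit_0_eq bot_apply bot_bool_def z0)
  also have "\<dots> = of_bool (z_type n p)" unfolding z_type_def by (rule prod_of_bool)
  finally show ?thesis .
qed

lemma z_strings: "{p \<in> strings n. z_type n p} = {..<n} \<rightarrow>\<^sub>E {PI, PZ}"
  unfolding strings_def z_type_def set_eq_iff mem_Collect_eq PiE_iff by blast

lemma card_z_strings: "card {p \<in> strings n. z_type n p} = 2 ^ n"
  by (simp add: z_strings card_PiE numeral_eq_Suc)

text \<open>A character sum over a maximal commuting group: the commutation character of
  \<open>p\<close> is trivial on the diagonal strings only if \<open>p\<close> is diagonal itself.
  The sum factorises over the qubits.\<close>

lemma sum_string_sign_z:
  "(\<Sum>t | t \<in> strings n \<and> z_type n t. string_sign n p t) = 2 ^ n * of_bool (z_type n p)"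
proof -
  have zs: "pauli_sign a PI + pauli_sign a PZ = 2 * of_bool (a \<in> {PI, PZ})" for a
    by (cases a) (simp_all add: pauli_sign_def)
  have sum_z: "sum f {PI, PZ} = f PI + f PZ" for f :: "pauli \<Rightarrow> complex" by simp
  have "(\<Sum>t | t \<in> strings n \<and> z_type n t. string_sign n p t) = (\<Prod>q<n. \<Sum>a\<in>{PI, PZ}. pauli_sign (p q) a)"
    unfolding z_strings string_sign_def by (subst prod_sum_PiE) auto
  also have "\<dots> = (\<Prod>q<n. 2 * of_bool (p q \<in> {PI, PZ}))"
    by (rule prod.cong[OF refl]) (simp only: sum_z zs)
  also have "\<dots> = 2 ^ n * of_bool (z_type n p)" unfolding z_type_def
    by (induction n) (auto simp: less_Suc_eq)
  finally show ?thesis .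
qed

lemma smult_mult_smult:
  assumes "A \<in> carrier_mat n n" "B \<in> carrier_mat n n"
  shows "(c \<cdot>\<^sub>m A) * (d \<cdot>\<^sub>m B) = (c * d) \<cdot>\<^sub>m (A * B :: complex mat)"
proof -
  have "(c \<cdot>\<^sub>m A) * (d \<cdot>\<^sub>m B) = c \<cdot>\<^sub>m (A * (d \<cdot>\<^sub>m B))"
    by (rule mult_smult_assoc_mat[OF assms(1)]) (rule smult_carrier_mat[OF assms(2)])
  also have "A * (d \<cdot>\<^sub>m B) = d \<cdot>\<^sub>m (A * B)" by (rule mult_smult_distrib[OF assms])
  finally show ?thesis by (simp only: smult_smult_mat)
qed

lemma mat_adjoint_mult:
  assumes "A \<in> carrier_mat n n" "B \<in> carrier_mat n n"
  shows "mat_adjoint (A * B) = mat_adjoint B * mat_adjoint (A :: complex mat)"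
proof (rule eq_matI)
  have d: "dim_row A = n" "dim_col A = n" "dim_row B = n" "dim_col B = n"
    using assms by (simp_all only: carrier_matD)
  fix i j assume "i < dim_row (mat_adjoint B * mat_adjoint A)" "j < dim_col (mat_adjoint B * mat_adjoint A)"
  then have ij: "i < n" "j < n" by (simp_all add: d)
  show "mat_adjoint (A * B) $$ (i, j) = (mat_adjoint B * mat_adjoint A) $$ (i, j)"
    unfolding mat_adjoint_entry[OF mult_carrier_mat[OF assms] ij]
      mat_mult_entry[OF assms ij(2,1)]
      mat_mult_entry[OF mat_adjoint_carrier[OF assms(2)] mat_adjoint_carrier[OF assms(1)] ij]
    by (simp add: mat_adjoint_entry[OF assms(1) _ ij(2)] mat_adjoint_entry[OF assms(2) ij(1)] mult.commute)
qed (use assms in simp_all)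

lemma mat_adjoint_smult: "mat_adjoint (c \<cdot>\<^sub>m A) = cnj c \<cdot>\<^sub>m mat_adjoint (A :: complex mat)"
proof (rule eq_matI)
  fix i j assume "i < dim_row (cnj c \<cdot>\<^sub>m mat_adjoint A)" "j < dim_col (cnj c \<cdot>\<^sub>m mat_adjoint A)"
  then have ij: "i < dim_col A" "j < dim_row A" by simp_all
  have A: "A \<in> carrier_mat (dim_row A) (dim_col A)" by simp
  show "mat_adjoint (c \<cdot>\<^sub>m A) $$ (i, j) = (cnj c \<cdot>\<^sub>m mat_adjoint A) $$ (i, j)"
    using ij by (simp add: mat_adjoint_entry[OF smult_carrier_mat[OF A] ij] mat_adjoint_entry[OF A ij])
qed simp_all

lemma unitary_opD:
  assumes "unitary_op n U"
  shows "U \<in> carrier_mat (2 ^ n) (2 ^ n)" "mat_adjoint U \<in> carrier_mat (2 ^ n) (2 ^ n)"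
    "U * mat_adjoint U = 1\<^sub>m (2 ^ n)" "mat_adjoint U * U = 1\<^sub>m (2 ^ n)"
  using assms mat_adjoint_carrier unfolding unitary_op_def by blast+

lemma unitary_op_mult:
  assumes "unitary_op n U" "unitary_op n V" shows "unitary_op n (U * V)"
proof -
  note u = unitary_opD[OF assms(1)] and v = unitary_opD[OF assms(2)]
  show ?thesis unfolding unitary_op_def mat_adjoint_mult[OF u(1) v(1)]
    mult_four_mat[OF u(1) v(1) v(2) u(2)] mult_four_mat[OF v(2) u(2) u(1) v(1)]
    u(3,4) v(3,4) right_mult_one_mat[OF u(1)] right_mult_one_mat[OF v(2)] 
    using mult_carrier_mat[OF u(1) v(1)] by simp
qed

section \<open>Clifford unitaries\<close>

text \<open>The Heisenberg picture: the expectation of \<open>A\<close> in the state prepared by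
  \<open>U\<close> from the all-zero state is entry (0, 0) of this matrix.\<close>

definition conjugate_by :: "complex mat \<Rightarrow> complex mat \<Rightarrow> complex mat" where
  "conjugate_by U A = mat_adjoint U * A * U"

lemma conjugate_by_carrier:
  "unitary_op n U \<Longrightarrow> A \<in> carrier_mat (2 ^ n) (2 ^ n) \<Longrightarrow> conjugate_by U A \<in> carrier_mat (2 ^ n) (2 ^ n)"
  unfolding conjugate_by_def by (intro mult_carrier_mat) (auto dest: unitary_opD)

lemma conjugate_by_mult:
  assumes "unitary_op n U" "A \<in> carrier_mat (2 ^ n) (2 ^ n)" "B \<in> carrier_mat (2 ^ n) (2 ^ n)"
  shows "conjugate_by U (A * B) = conjugate_by U A * conjugate_by U B"
proof -
  note u = unitary_opD[OF assms(1)]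
  have "conjugate_by U A * conjugate_by U B = (mat_adjoint U * A) * U * (mat_adjoint U * (B * U))"
    unfolding conjugate_by_def assoc_mult_mat[OF u(2) assms(3) u(1)] ..
  also have "\<dots> = (mat_adjoint U * A) * (U * mat_adjoint U) * (B * U)"
    by (rule mult_four_mat[OF mult_carrier_mat[OF u(2) assms(2)] u(1,2) mult_carrier_mat[OF assms(3) u(1)]])
  also have "\<dots> = (mat_adjoint U * A) * (B * U)"
    unfolding u(3) right_mult_one_mat[OF mult_carrier_mat[OF u(2) assms(2)]] ..
  also have "\<dots> = mat_adjoint U * (A * B) * U" by (rule mult_four_mat[OF u(2) assms(2,3) u(1)])
  finally show ?thesis unfolding conjugate_by_def ..
qed

lemma conjugate_by_smult:
  assumes "unitary_op n U" "A \<in> carrier_mat (2 ^ n) (2 ^ n)"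
  shows "conjugate_by U (c \<cdot>\<^sub>m A) = c \<cdot>\<^sub>m conjugate_by U A"
  unfolding conjugate_by_def
    mult_smult_distrib[OF unitary_opD(2)[OF assms(1)] assms(2)]
  by (rule mult_smult_assoc_mat[OF mult_carrier_mat[OF unitary_opD(2)[OF assms(1)] assms(2)] unitary_opD(1)[OF assms(1)]])

lemma conjugate_by_inverse:
  assumes "unitary_op n U" "A \<in> carrier_mat (2 ^ n) (2 ^ n)"
  shows "conjugate_by U (U * A * mat_adjoint U) = A" "U * conjugate_by U A * mat_adjoint U = A"
proof -
  note u = unitary_opD[OF assms(1)]
  have "conjugate_by U (U * A * mat_adjoint U) = mat_adjoint U * (U * A) * (mat_adjoint U * U)"
    unfolding conjugate_by_def
    by (subst mult_four_mat[OF u(2) mult_carrier_mat[OF u(1) assms(2)] u(2) u(1)]) simp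
  also have "\<dots> = (mat_adjoint U * U) * A"
    by (simp only: u(4) right_mult_one_mat[OF mult_carrier_mat[OF u(2) mult_carrier_mat[OF u(1) assms(2)]]]
        assoc_mult_mat[OF u(2,1) assms(2), symmetric] left_mult_one_mat[OF assms(2)] right_mult_one_mat[OF assms(2)])
  finally show "conjugate_by U (U * A * mat_adjoint U) = A" using u(4) assms(2) by simp
  have "U * conjugate_by U A * mat_adjoint U = U * (mat_adjoint U * A) * (U * mat_adjoint U)"
    unfolding conjugate_by_def
    by (subst mult_four_mat[OF u(1) mult_carrier_mat[OF u(2) assms(2)] u(1) u(2)]) simp
  also have "\<dots> = (U * mat_adjoint U) * A"
    by (simp only: u(3) right_mult_one_mat[OF mult_carrier_mat[OF u(1) mult_carrier_mat[OF u(2) assms(2)]]]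
        assoc_mult_mat[OF u(1,2) assms(2), symmetric] left_mult_one_mat[OF assms(2)] right_mult_one_mat[OF assms(2)])
  finally show "U * conjugate_by U A * mat_adjoint U = A" using u(3) assms(2) by simp
qed

lemma conjugate_by_compose:
  assumes "unitary_op n U" "unitary_op n V" "A \<in> carrier_mat (2 ^ n) (2 ^ n)"
  shows "conjugate_by (V * U) A = conjugate_by U (conjugate_by V A)"
proof -
  note u = unitary_opD[OF assms(1)] and v = unitary_opD[OF assms(2)]
  have va: "mat_adjoint V * A \<in> carrier_mat (2^n) (2^n)" using v(2) assms(3) by (rule mult_carrier_mat)
  have "conjugate_by (V * U) A = (mat_adjoint U * (mat_adjoint V * A)) * (V * U)"
    unfolding conjugate_by_def mat_adjoint_mult[OF v(1) u(1)]
    by (subst assoc_mult_mat[OF u(2) v(2) assms(3)]) simp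
  also have "\<dots> = mat_adjoint U * ((mat_adjoint V * A) * V) * U"
    by (rule mult_four_mat[OF u(2) va v(1) u(1)])
  finally show ?thesis unfolding conjugate_by_def .
qed

lemma cliffordD: "U \<in> clifford n \<Longrightarrow> unitary_op n U"
  by (simp add: clifford_def)

lemma pauli_string_mem: "pauli_string n p \<in> pauli_group n"
  unfolding pauli_group_def by (auto intro!: exI[of _ 1] exI[of _ p])

lemma pauli_group_carrier: "P \<in> pauli_group n \<Longrightarrow> P \<in> carrier_mat (2 ^ n) (2 ^ n)"
  unfolding pauli_group_def by auto

text \<open>\<open>clifford\<close> speaks of conjugation in the other direction; it demands
  equality of the image with the Pauli group, so every \<open>P\<close> has a preimage there, and
  this preimage is the conjugate.\<close>

lemma clifford_conjugate_mem:
  assumes "U \<in> clifford n" "P \<in> pauli_group n" shows "conjugate_by U P \<in> pauli_group n"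
proof -
  obtain P' where P': "P' \<in> pauli_group n" "P = U * P' * mat_adjoint U"
    using assms unfolding clifford_def by blast
  show ?thesis unfolding P'(2) conjugate_by_inverse(1)[OF cliffordD[OF assms(1)] pauli_group_carrier[OF P'(1)]]
    by (rule P'(1))
qed

definition pullback :: "nat \<Rightarrow> complex mat \<Rightarrow> (nat \<Rightarrow> pauli) \<Rightarrow> nat \<Rightarrow> pauli" where
  "pullback n U p = (SOME p'. p' \<in> strings n \<and>
     (\<exists>c. c ^ 4 = 1 \<and> conjugate_by U (pauli_string n p) = c \<cdot>\<^sub>m pauli_string n p'))"

lemma pullback:
  assumes "U \<in> clifford n"
  obtains c where "c ^ 4 = 1" "conjugate_by U (pauli_string n p) = c \<cdot>\<^sub>m pauli_string n (pullback n U p)"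
    "pullback n U p \<in> strings n"
proof -
  obtain c p' where c: "c ^ 4 = 1" "conjugate_by U (pauli_string n p) = c \<cdot>\<^sub>m pauli_string n p'"
    using clifford_conjugate_mem[OF assms pauli_string_mem[of n p]] unfolding pauli_group_def by blast
  then have "\<exists>p'. p' \<in> strings n \<and>
     (\<exists>c. c ^ 4 = 1 \<and> conjugate_by U (pauli_string n p) = c \<cdot>\<^sub>m pauli_string n p')"
    \<comment> \<open>Restriction selects the extensional representative of the same matrix, which
      makes \<open>pullback\<close> unique.\<close>
    by (intro exI[of _ "restrict p' {..<n}"]) (auto simp: strings_normalise)
  from someI_ex[OF this] show thesis using that unfolding pullback_def by blast
qed

lemma pullback_in_strings: "U \<in> clifford n \<Longrightarrow> pullback n U p \<in> strings n"
  using pullback by blast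

lemma power4_nonzero: "c ^ 4 = (1::complex) \<Longrightarrow> c \<noteq> 0"
  by auto

lemma pullback_unique:
  assumes "U \<in> clifford n" "p' \<in> strings n" "conjugate_by U (pauli_string n p) = c \<cdot>\<^sub>m pauli_string n p'"
  shows "pullback n U p = p'"
proof -
  obtain d where d: "d ^ 4 = 1" "conjugate_by U (pauli_string n p) = d \<cdot>\<^sub>m pauli_string n (pullback n U p)"
    using pullback[OF assms(1)] by blast
  have "(1/d) \<cdot>\<^sub>m (d \<cdot>\<^sub>m pauli_string n (pullback n U p)) = (1/d) \<cdot>\<^sub>m (c \<cdot>\<^sub>m pauli_string n p')"
    using d(2) assms(3) by simp
  hence "pauli_string n (pullback n U p) = (c/d) \<cdot>\<^sub>m pauli_string n p'"
    using power4_nonzero[OF d(1)] by (simp add: smult_smult_mat)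
  from pauli_string_independent[OF this] show ?thesis
    by (intro strings_eqI[OF pullback_in_strings[OF assms(1)] assms(2)])
qed

lemma pullback_inj:
  assumes "U \<in> clifford n" shows "inj_on (pullback n U) (strings n)"
proof (rule inj_onI)
  fix p p' assume p: "p \<in> strings n" "p' \<in> strings n" "pullback n U p = pullback n U p'"
  note u = cliffordD[OF assms]
  let ?r = "pauli_string n (pullback n U p')"
  obtain c where c: "c ^ 4 = 1" "conjugate_by U (pauli_string n p) = c \<cdot>\<^sub>m ?r"
    using pullback[OF assms] p(3) by metis
  obtain d where d: "d ^ 4 = 1" "conjugate_by U (pauli_string n p') = d \<cdot>\<^sub>m ?r"
    using pullback[OF assms] by blast
  have "conjugate_by U (pauli_string n p) = (c/d) \<cdot>\<^sub>m conjugate_by U (pauli_string n p')"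
    unfolding c(2) d(2) smult_smult_mat using power4_nonzero[OF d(1)] by simp
  also have "\<dots> = conjugate_by U ((c/d) \<cdot>\<^sub>m pauli_string n p')"
    by (rule conjugate_by_smult[symmetric, OF u pauli_string_carrier])
  finally have "U * conjugate_by U (pauli_string n p) * mat_adjoint U =
      U * conjugate_by U ((c/d) \<cdot>\<^sub>m pauli_string n p') * mat_adjoint U" by (rule arg_cong)
  then have "pauli_string n p = (c/d) \<cdot>\<^sub>m pauli_string n p'"
    by (simp only: conjugate_by_inverse(2)[OF u] pauli_string_carrier smult_carrier_mat)
  from pauli_string_independent[OF this] show "p = p'" by (intro strings_eqI[OF p(1,2)])
qed

lemma pullback_bij:
  assumes "U \<in> clifford n" shows "bij_betw (pullback n U) (strings n) (strings n)"
  unfolding bij_betw_def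
  by (intro conjI endo_inj_surj pullback_inj[OF assms] finite_strings image_subsetI pullback_in_strings[OF assms])

lemma pauli_string_pair_inverse:
  "(pauli_string n p * pauli_string n p') * (pauli_string n p' * pauli_string n p) = 1\<^sub>m (2 ^ n)"
  by (subst mult_four_mat[of _ "2^n"]) auto

text \<open>Conjugation is multiplicative; the phases of the two sides differ, but
  \<open>pullback_unique\<close> disregards them.\<close>

lemma pullback_string_prod:
  assumes "U \<in> clifford n"
  shows "pullback n U (string_prod n p p') = string_prod n (pullback n U p) (pullback n U p')"
proof -
  note u = cliffordD[OF assms]
  obtain c where c: "conjugate_by U (pauli_string n p) = c \<cdot>\<^sub>m pauli_string n (pullback n U p)"
    using pullback[OF assms] by blast
  obtain d where d: "conjugate_by U (pauli_string n p') = d \<cdot>\<^sub>m pauli_string n (pullback n U p')"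
    using pullback[OF assms] by blast
  define f where "f = string_phase n p p'"
  have f: "f \<noteq> 0" unfolding f_def by (rule power4_nonzero[OF string_phase_pow4])
  have "f \<cdot>\<^sub>m conjugate_by U (pauli_string n (string_prod n p p')) = conjugate_by U (pauli_string n p * pauli_string n p')"
    unfolding pauli_string_mult f_def by (rule conjugate_by_smult[symmetric, OF u pauli_string_carrier])
  also have "\<dots> = (c * d) \<cdot>\<^sub>m (pauli_string n (pullback n U p) * pauli_string n (pullback n U p'))"
    unfolding conjugate_by_mult[OF u pauli_string_carrier pauli_string_carrier] c d
    by (rule smult_mult_smult) auto
  finally have "(1/f) \<cdot>\<^sub>m (f \<cdot>\<^sub>m conjugate_by U (pauli_string n (string_prod n p p'))) = (1/f) \<cdot>\<^sub>m ((c * d) \<cdot>\<^sub>m (string_phase n (pullback n U p) (pullback n U p') \<cdot>\<^sub>m pauli_string n (string_prod n (pullback n U p) (pullback n U p'))))"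
    unfolding pauli_string_mult by simp
  then have "conjugate_by U (pauli_string n (string_prod n p p')) = (1/f * (c * d) * string_phase n (pullback n U p) (pullback n U p')) \<cdot>\<^sub>m pauli_string n (string_prod n (pullback n U p) (pullback n U p'))"
    using f by (simp add: smult_smult_mat mult.assoc)
  from pullback_unique[OF assms string_prod_in_strings this] show ?thesis .
qed

text \<open>Conjugating both orders of the product gives the same two scalars \<open>c\<close> and
  \<open>d\<close>, so the exchange sign before and after conjugation must agree.\<close>

lemma pullback_string_sign:
  assumes "U \<in> clifford n"
  shows "string_sign n (pullback n U p) (pullback n U p') = string_sign n p p'"
proof -
  note u = cliffordD[OF assms]
  let ?P = "pauli_string n p" and ?Q = "pauli_string n p'"
  let ?P' = "pauli_string n (pullback n U p)" and ?Q' = "pauli_string n (pullback n U p')"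
  obtain c where c: "c ^ 4 = 1" "conjugate_by U ?P = c \<cdot>\<^sub>m ?P'" using pullback[OF assms] by blast
  obtain d where d: "d ^ 4 = 1" "conjugate_by U ?Q = d \<cdot>\<^sub>m ?Q'" using pullback[OF assms] by blast
  have pq: "conjugate_by U (?P * ?Q) = (c * d) \<cdot>\<^sub>m (?P' * ?Q')"
    unfolding conjugate_by_mult[OF u pauli_string_carrier pauli_string_carrier] c(2) d(2)
    by (rule smult_mult_smult) auto
  have qp: "conjugate_by U (?Q * ?P) = (d * c) \<cdot>\<^sub>m (?Q' * ?P')"
    unfolding conjugate_by_mult[OF u pauli_string_carrier pauli_string_carrier] c(2) d(2)
    by (rule smult_mult_smult) auto
  have "(c * d * string_sign n (pullback n U p) (pullback n U p')) \<cdot>\<^sub>m (?Q' * ?P') = conjugate_by U (?P * ?Q)"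
    unfolding pq pauli_string_commute[of n "pullback n U p"] smult_smult_mat ..
  also have "\<dots> = (string_sign n p p' * (d * c)) \<cdot>\<^sub>m (?Q' * ?P')"
    unfolding pauli_string_commute[of n p]
    by (subst conjugate_by_smult[OF u]) (auto simp: qp smult_smult_mat)
  finally have "c * d * string_sign n (pullback n U p) (pullback n U p') = string_sign n p p' * (d * c)"
    by (rule smult_cancel_invertible[OF _ pauli_string_pair_inverse]) (auto intro: mult_carrier_mat)
  then show ?thesis using power4_nonzero[OF c(1)] power4_nonzero[OF d(1)] by simp
qed

section \<open>Expectations of Pauli strings in stabilizer states\<close>

definition pauli_expectation :: "nat \<Rightarrow> complex mat \<Rightarrow> (nat \<Rightarrow> pauli) \<Rightarrow> complex" where
  "pauli_expectation n U p = (\<Sum>i<2^n. \<Sum>j<2^n. cnj (U $$ (i, 0)) * pauli_string n p $$ (i, j) * U $$ (j, 0))"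

lemma pauli_expectation_eq:
  assumes "unitary_op n U"
  shows "pauli_expectation n U p = conjugate_by U (pauli_string n p) $$ (0, 0)"
proof -
  note u = unitary_opD[OF assms]
  have 0: "0 < (2::nat)^n" by simp
  have "conjugate_by U (pauli_string n p) $$ (0, 0) = (\<Sum>j<2^n. (\<Sum>i<2^n. cnj (U $$ (i, 0)) * pauli_string n p $$ (i, j)) * U $$ (j, 0))"
    unfolding conjugate_by_def mat_mult_entry[OF mult_carrier_mat[OF u(2) pauli_string_carrier] u(1) 0 0]
    by (rule sum.cong[OF refl], subst mat_mult_entry[OF u(2) pauli_string_carrier])
       (auto simp: mat_adjoint_entry[OF u(1)])
  also have "\<dots> = (\<Sum>j<2^n. \<Sum>i<2^n. cnj (U $$ (i, 0)) * pauli_string n p $$ (i, j) * U $$ (j, 0))"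
    by (simp add: sum_distrib_right)
  also have "\<dots> = pauli_expectation n U p" unfolding pauli_expectation_def by (rule sum.swap)
  finally show ?thesis ..
qed

text \<open>For a Clifford unitary the expectation is 0 or a fourth root of unity, so nonvanishing
  means that the string stabilizes the state up to a phase. In this form the event is measurable,
  the expectation being a polynomial in matrix entries and their conjugates.\<close>

definition stabilized :: "nat \<Rightarrow> complex mat \<Rightarrow> (nat \<Rightarrow> pauli) \<Rightarrow> bool" where
  "stabilized n U p \<longleftrightarrow> pauli_expectation n U p \<noteq> 0"

lemma stabilized_clifford:
  assumes "U \<in> clifford n"
  shows "stabilized n U p \<longleftrightarrow> z_type n (pullback n U p)"
    "pauli_expectation n U p ^ 4 = of_bool (stabilized n U p)"
proof -
  obtain c where c: "c ^ 4 = 1" "conjugate_by U (pauli_string n p) = c \<cdot>\<^sub>m pauli_string n (pullback n U p)"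
    using pullback[OF assms] by blast
  have e: "pauli_expectation n U p = c * of_bool (z_type n (pullback n U p))"
    unfolding pauli_expectation_eq[OF cliffordD[OF assms]] c(2) by (simp add: pauli_string_entry_0)
  show 1: "stabilized n U p \<longleftrightarrow> z_type n (pullback n U p)"
    unfolding stabilized_def e using power4_nonzero[OF c(1)] by simp
  show "pauli_expectation n U p ^ 4 = of_bool (stabilized n U p)"
    unfolding 1 unfolding e by (simp add: power_mult_distrib c(1))
qed

text \<open>The fourth powers are the indicator of the stabilizing strings. Pulling back permutes
  all strings and preserves signs, which reduces the claim to the character sum for the all-zero
  state.\<close>

lemma sum_sign_expectation:
  assumes "U \<in> clifford n"
  shows "(\<Sum>t\<in>strings n. string_sign n p t * pauli_expectation n U t ^ 4) = 2 ^ n * of_bool (stabilized n U p)"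
proof -
  have "(\<Sum>t\<in>strings n. string_sign n p t * pauli_expectation n U t ^ 4) =
     (\<Sum>t\<in>strings n. string_sign n (pullback n U p) (pullback n U t) * of_bool (z_type n (pullback n U t)))"
    by (simp only: stabilized_clifford[OF assms] pullback_string_sign[OF assms])
  also have "\<dots> = (\<Sum>t\<in>strings n. string_sign n (pullback n U p) t * of_bool (z_type n t))"
    by (rule sum.reindex_bij_betw[OF pullback_bij[OF assms]])
  also have "\<dots> = (\<Sum>t | t \<in> strings n \<and> z_type n t. string_sign n (pullback n U p) t)"
    by (rule sum.mono_neutral_cong_right) auto
  finally show ?thesis unfolding sum_string_sign_z stabilized_clifford(1)[OF assms] .
qed

lemma card_filter_eq_sum: "finite A \<Longrightarrow> card {x \<in> A. P x} = (\<Sum>x\<in>A. of_bool (P x))"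
  by (simp add: Int_def)

lemma card_stabilized:
  assumes "U \<in> clifford n"
  shows "card {p \<in> strings n. stabilized n U p} = 2 ^ n"
proof -
  have "card {p \<in> strings n. stabilized n U p} = (\<Sum>p\<in>strings n. of_bool (z_type n (pullback n U p)))"
    unfolding stabilized_clifford(1)[OF assms] by (rule card_filter_eq_sum) simp
  also have "\<dots> = (\<Sum>p\<in>strings n. of_bool (z_type n p))"
    by (rule sum.reindex_bij_betw[OF pullback_bij[OF assms]])
  also have "\<dots> = card {p \<in> strings n. z_type n p}" by (rule card_filter_eq_sum[symmetric]) simp
  finally show ?thesis unfolding card_z_strings .
qed

section \<open>Transitivity of the Clifford group on nonidentity strings\<close>

lemma string_sign_prod_over: 
  assumes "q < n" "q' < n" "q \<noteq> q'"
  shows "string_sign n p (\<lambda>k\<in>{..<n}. if k = q then a else if k = q' then b else PI) =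
    pauli_sign (p q) a * pauli_sign (p q') b"
proof -
  have "string_sign n p (\<lambda>k\<in>{..<n}. if k = q then a else if k = q' then b else PI) =
    (\<Prod>k<n. (if k = q then pauli_sign (p q) a else 1) * (if k = q' then pauli_sign (p q') b else 1))"
    unfolding string_sign_def by (rule prod.cong) (use assms(3) in auto)
  then show ?thesis using assms by (simp add: prod.distrib)
qed

text \<open>If the supports meet, one letter at a common qubit anticommutes with both. Otherwise one
  letter on each support is needed, and each is seen by only one of the two strings.\<close>

lemma common_anticommuting_string:
  assumes "\<exists>q<n. p q \<noteq> PI" "\<exists>q<n. p' q \<noteq> PI"
  obtains t where "string_sign n p t = -1" "string_sign n p' t = -1"
proof (cases "\<exists>q<n. p q \<noteq> PI \<and> p' q \<noteq> PI")
  case True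
  then obtain q where q: "q < n" "p q \<noteq> PI" "p' q \<noteq> PI" by blast
  obtain a where "pauli_sign (p q) a = -1" "pauli_sign (p' q) a = -1"
    using pauli_common_anticommuting[OF q(2,3)] by blast
  then show thesis using that[of "single_string n q a"] q(1) by (simp add: string_sign_single)
next
  case False
  obtain q q' where q: "q < n" "p q \<noteq> PI" "q' < n" "p' q' \<noteq> PI" using assms by blast
  with False have f: "p' q = PI" "p q' = PI" "q \<noteq> q'" by auto
  obtain a where a: "pauli_sign (p q) a = -1" using pauli_common_anticommuting[OF q(2,2)] by blast
  obtain b where b: "pauli_sign (p' q') b = -1" using pauli_common_anticommuting[OF q(4,4)] by blast
  show thesis using string_sign_prod_over[OF q(1,3) f(3), of p a b] string_sign_prod_over[OF q(1,3) f(3), of p' a b] a b f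
    by (intro that) simp_all
qed

lemma finite_pauli_group: "finite (pauli_group n)"
proof -
  have "pauli_group n \<subseteq> (\<lambda>(c, p). c \<cdot>\<^sub>m pauli_string n p) ` ({c. c ^ 4 = 1} \<times> strings n)"
  proof
    fix P assume "P \<in> pauli_group n"
    then obtain c p where c: "P = c \<cdot>\<^sub>m pauli_string n p" "c ^ 4 = 1" unfolding pauli_group_def by blast
    then have "P = (\<lambda>(c, p). c \<cdot>\<^sub>m pauli_string n p) (c, restrict p {..<n})" by (simp add: strings_normalise)
    then show "P \<in> (\<lambda>(c, p). c \<cdot>\<^sub>m pauli_string n p) ` ({c. c ^ 4 = 1} \<times> strings n)"
      using c(2) strings_normalise(1)[where n = n and p = p] by blast
  qed
  moreover have "finite {c::complex. c ^ 4 = 1}" using finite_roots_unity[of 4] by simp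
  ultimately show ?thesis by (meson finite_SigmaI finite_imageI finite_strings finite_subset)
qed

text \<open>An injective self-map of a finite set is onto, so inclusion is enough for the equality
  in the definition.\<close>

lemma cliffordI:
  assumes "unitary_op n U" "\<And>P. P \<in> pauli_group n \<Longrightarrow> U * P * mat_adjoint U \<in> pauli_group n"
  shows "U \<in> clifford n"
proof -
  have "inj_on (\<lambda>P. U * P * mat_adjoint U) (pauli_group n)"
    by (rule inj_on_inverseI[of _ "conjugate_by U"])
       (rule conjugate_by_inverse(1)[OF assms(1) pauli_group_carrier])
  then have "(\<lambda>P. U * P * mat_adjoint U) ` pauli_group n = pauli_group n"
    using assms(2) by (intro endo_inj_surj finite_pauli_group) auto
  then show ?thesis using assms(1) unfolding clifford_def by blast
qed

lemma clifford_mult: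
  assumes "V \<in> clifford n" "U \<in> clifford n" shows "V * U \<in> clifford n"
proof (rule cliffordI)
  note v = unitary_opD[OF cliffordD[OF assms(1)]] and u = unitary_opD[OF cliffordD[OF assms(2)]]
  show "unitary_op n (V * U)" by (intro unitary_op_mult cliffordD assms)
  fix P assume P: "P \<in> pauli_group n"
  note pc = pauli_group_carrier[OF P]
  have "V * U * P * mat_adjoint (V * U) = (V * (U * P)) * (mat_adjoint U * mat_adjoint V)"
    unfolding mat_adjoint_mult[OF v(1) u(1)] assoc_mult_mat[OF v(1) u(1) pc] ..
  also have "\<dots> = V * (U * P * mat_adjoint U) * mat_adjoint V"
    by (rule mult_four_mat[OF v(1) mult_carrier_mat[OF u(1) pc] u(2) v(2)])
  finally show "V * U * P * mat_adjoint (V * U) \<in> pauli_group n"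
    using P assms unfolding clifford_def by auto
qed

lemma smult_add_same: "c \<cdot>\<^sub>m A + c \<cdot>\<^sub>m B = c \<cdot>\<^sub>m (A + B)" if "A \<in> carrier_mat n n" "B \<in> carrier_mat n n"
  for A B :: "complex mat"
  using that by (simp add: add_smult_distrib_left_mat)

context
  fixes N :: nat and A B :: "complex mat"
  assumes A: "A \<in> carrier_mat N N" and B: "B \<in> carrier_mat N N"
    and AA: "A * A = 1\<^sub>m N" and BB: "B * B = 1\<^sub>m N" and BA: "B * A = (-1) \<cdot>\<^sub>m (A * B)"
begin

lemma anticommuting_sum_square: "(A + B) * (A + B) = 2 \<cdot>\<^sub>m 1\<^sub>m N"
proof -
  have AB: "A * B \<in> carrier_mat N N" using A B by (rule mult_carrier_mat)
  have "(A + B) * (A + B) = (A * A + A * B) + (B * A + B * B)"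
    unfolding add_mult_distrib_mat[OF A B add_carrier_mat[OF B]]
      mult_add_distrib_mat[OF A A B] mult_add_distrib_mat[OF B A B] ..
  also have "\<dots> = 2 \<cdot>\<^sub>m 1\<^sub>m N" unfolding AA BB BA using carrier_matD[OF AB]
    by (intro eq_matI) auto
  finally show ?thesis .
qed

lemma anticommuting_diff_sum: "(A + (-1) \<cdot>\<^sub>m B) * (A + B) = 2 \<cdot>\<^sub>m (A * B)"
proof -
  have AB: "A * B \<in> carrier_mat N N" using A B by (rule mult_carrier_mat)
  have "(A + (-1) \<cdot>\<^sub>m B) * (A + B) = (A * A + A * B) + (-1) \<cdot>\<^sub>m (B * A + B * B)"
    unfolding add_mult_distrib_mat[OF A smult_carrier_mat[OF B] add_carrier_mat[OF B]]
      mult_smult_assoc_mat[OF B add_carrier_mat[OF B]]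
      mult_add_distrib_mat[OF A A B] mult_add_distrib_mat[OF B A B] ..
  also have "\<dots> = 2 \<cdot>\<^sub>m (A * B)" unfolding AA BB BA using carrier_matD[OF AB]
    by (intro eq_matI) auto
  finally show ?thesis .
qed

text \<open>Moving \<open>A + B\<close> past \<open>T\<close> leaves \<open>A + B\<close> up to sign
  if the two signs agree, and turns it into \<open>A - B\<close> if they are opposite; it remains to
  multiply by \<open>A + B\<close>.\<close>

lemma anticommuting_sum_conjugate:
  assumes T: "T \<in> carrier_mat N N" and s: "A * T = s \<cdot>\<^sub>m (T * A)" "B * T = s' \<cdot>\<^sub>m (T * B)"
  shows "s' = s \<Longrightarrow> (A + B) * T * (A + B) = (2 * s) \<cdot>\<^sub>m T"
    "s' = - s \<Longrightarrow> (A + B) * T * (A + B) = (2 * s) \<cdot>\<^sub>m (T * (A * B))"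
proof -
  have AB: "A + B \<in> carrier_mat N N" using B by (rule add_carrier_mat)
  have TA: "T * A \<in> carrier_mat N N" and TB: "T * B \<in> carrier_mat N N" using T A B by (auto intro: mult_carrier_mat)
  have 1: "(A + B) * T = s \<cdot>\<^sub>m (T * A) + s' \<cdot>\<^sub>m (T * B)"
    unfolding add_mult_distrib_mat[OF A B T] s ..
  { assume "s' = s"
    have "(A + B) * T = s \<cdot>\<^sub>m (T * (A + B))"
      unfolding 1 \<open>s' = s\<close> smult_add_same[OF TA TB] mult_add_distrib_mat[OF T A B] ..
    then have "(A + B) * T * (A + B) = s \<cdot>\<^sub>m (T * ((A + B) * (A + B)))"
      using mult_smult_assoc_mat[OF mult_carrier_mat[OF T AB] AB, of s] assoc_mult_mat[OF T AB AB] by simp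
    also have "\<dots> = (2 * s) \<cdot>\<^sub>m T"
      unfolding anticommuting_sum_square mult_smult_distrib[OF T one_carrier_mat] right_mult_one_mat[OF T] smult_smult_mat
      by (simp add: mult.commute)
    finally show "(A + B) * T * (A + B) = (2 * s) \<cdot>\<^sub>m T" . }
  { assume "s' = - s"
    have "(A + B) * T = s \<cdot>\<^sub>m (T * (A + (-1) \<cdot>\<^sub>m B))"
      unfolding 1 \<open>s' = - s\<close> mult_add_distrib_mat[OF T A smult_carrier_mat[OF B]] mult_smult_distrib[OF T B]
        smult_add_same[OF TA smult_carrier_mat[OF TB], symmetric] smult_smult_mat by simp
    then have "(A + B) * T * (A + B) = s \<cdot>\<^sub>m (T * ((A + (-1) \<cdot>\<^sub>m B) * (A + B)))"
      using mult_smult_assoc_mat[OF mult_carrier_mat[OF T add_carrier_mat[OF smult_carrier_mat[OF B]]] AB, of s A "-1"]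
        assoc_mult_mat[OF T add_carrier_mat[OF smult_carrier_mat[OF B]] AB, of A "-1"] by simp
    also have "\<dots> = (2 * s) \<cdot>\<^sub>m (T * (A * B))"
      unfolding anticommuting_diff_sum mult_smult_distrib[OF T mult_carrier_mat[OF A B]] smult_smult_mat
      by (simp add: mult.commute)
    finally show "(A + B) * T * (A + B) = (2 * s) \<cdot>\<^sub>m (T * (A * B))" . }
qed

end

lemma conjugate_smult:
  assumes "A \<in> carrier_mat n n" "T \<in> carrier_mat n n"
  shows "(c \<cdot>\<^sub>m A) * T * (c \<cdot>\<^sub>m A) = (c * c) \<cdot>\<^sub>m (A * T * (A :: complex mat))"
  unfolding mult_smult_assoc_mat[OF assms]
  by (rule smult_mult_smult[OF mult_carrier_mat[OF assms] assms(1)])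

text \<open>For anticommuting \<open>P\<close> and \<open>P'\<close>, the hermitian unitary \<open>(P + P') / sqrt 2\<close> exchanges them.\<close>

lemma clifford_swap:
  assumes sign: "string_sign n p p' = -1"
  obtains V where "V \<in> clifford n" "conjugate_by V (pauli_string n p) = pauli_string n p'"
proof -
  let ?A = "pauli_string n p" and ?B = "pauli_string n p'" and ?N = "(2::nat) ^ n"
  define S where "S = ?A + ?B"
  define V where "V = complex_of_real (1 / sqrt 2) \<cdot>\<^sub>m S"
  have S: "S \<in> carrier_mat ?N ?N" unfolding S_def by simp
  have V: "V \<in> carrier_mat ?N ?N" unfolding V_def by (rule smult_carrier_mat[OF S])
  have half: "complex_of_real (1 / sqrt 2) * complex_of_real (1 / sqrt 2) = 1 / 2"
    by (simp flip: of_real_mult)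
  have BA: "?B * ?A = (-1) \<cdot>\<^sub>m (?A * ?B)"
    by (subst pauli_string_commute) (simp add: string_sign_commute[of n p' p] sign)
  note facts = pauli_string_carrier pauli_string_carrier pauli_string_square pauli_string_square BA
  have "mat_adjoint S = S"
  proof (rule eq_matI)
    fix i j assume "i < dim_row S" "j < dim_col S"
    then have ij: "i < ?N" "j < ?N" using S by simp_all
    have e: "cnj (pauli_string n r $$ (j, i)) = pauli_string n r $$ (i, j)" for r
      using mat_adjoint_entry[OF pauli_string_carrier ij, of r] by simp
    show "mat_adjoint S $$ (i, j) = S $$ (i, j)"
      unfolding mat_adjoint_entry[OF S ij] using ij by (simp add: S_def e)
  qed (use S in simp_all)
  then have adj: "mat_adjoint V = V" unfolding V_def mat_adjoint_smult by simp
  have "V * V = (1/2) \<cdot>\<^sub>m (S * S)" unfolding V_def smult_mult_smult[OF S S] half ..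
  also have "\<dots> = 1\<^sub>m ?N" unfolding S_def anticommuting_sum_square[OF facts] smult_smult_mat by simp
  finally have "V * V = 1\<^sub>m ?N" .
  then have u: "unitary_op n V" unfolding unitary_op_def adj using V by simp
  have conj: "V * T * V = (1/2) \<cdot>\<^sub>m (S * T * S)" if "T \<in> carrier_mat ?N ?N" for T
    unfolding V_def conjugate_smult[OF S that] half ..
  have "V \<in> clifford n"
  proof (rule cliffordI[OF u])
    fix P assume "P \<in> pauli_group n"
    then obtain c t where c: "P = c \<cdot>\<^sub>m pauli_string n t" "c ^ 4 = 1" unfolding pauli_group_def by blast
    let ?T = "pauli_string n t"
    have st: "?A * ?T = string_sign n p t \<cdot>\<^sub>m (?T * ?A)" "?B * ?T = string_sign n p' t \<cdot>\<^sub>m (?T * ?B)"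
      by (rule pauli_string_commute)+
    \<comment> \<open>Conjugation by \<open>V\<close> sends \<open>?T\<close> to itself up to sign,
      or to \<open>?T * ?A * ?B\<close> up to sign; both are Pauli strings up to a fourth root of
      unity.\<close>
    have "\<exists>d r. d ^ 4 = 1 \<and> V * ?T * V = d \<cdot>\<^sub>m pauli_string n r"
    proof (cases "string_sign n p' t = string_sign n p t")
      case True
      have "V * ?T * V = string_sign n p t \<cdot>\<^sub>m ?T"
        unfolding conj[OF pauli_string_carrier] S_def
          anticommuting_sum_conjugate(1)[OF facts pauli_string_carrier st True] smult_smult_mat by simp
      moreover have "string_sign n p t ^ 4 = 1" using string_sign_values[of n p t] by auto
      ultimately show ?thesis by blast
    next
      case False
      then have f: "string_sign n p' t = - string_sign n p t"
        using string_sign_values[of n p t] string_sign_values[of n p' t] by auto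
      have "V * ?T * V = string_sign n p t \<cdot>\<^sub>m (?T * (?A * ?B))"
        unfolding conj[OF pauli_string_carrier] S_def
          anticommuting_sum_conjugate(2)[OF facts pauli_string_carrier st f] smult_smult_mat by simp
      also have "?T * (?A * ?B) = (string_phase n p p' * string_phase n t (string_prod n p p')) \<cdot>\<^sub>m
          pauli_string n (string_prod n t (string_prod n p p'))"
        unfolding pauli_string_mult mult_smult_distrib[OF pauli_string_carrier pauli_string_carrier] smult_smult_mat ..
      finally have "V * ?T * V = (string_sign n p t * (string_phase n p p' * string_phase n t (string_prod n p p'))) \<cdot>\<^sub>m
          pauli_string n (string_prod n t (string_prod n p p'))" unfolding smult_smult_mat .
      moreover have "(string_sign n p t * (string_phase n p p' * string_phase n t (string_prod n p p'))) ^ 4 = 1"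
        using string_sign_values[of n p t] by (auto simp: power_mult_distrib string_phase_pow4)
      ultimately show ?thesis by blast
    qed
    then obtain d r where d: "d ^ 4 = 1" "V * ?T * V = d \<cdot>\<^sub>m pauli_string n r" by blast
    have "V * P * mat_adjoint V = (c * d) \<cdot>\<^sub>m pauli_string n r"
      unfolding adj c(1) mult_smult_distrib[OF V pauli_string_carrier]
        mult_smult_assoc_mat[OF mult_carrier_mat[OF V pauli_string_carrier] V] d(2) smult_smult_mat ..
    moreover have "(c * d) ^ 4 = 1" by (simp add: power_mult_distrib c(2) d(1))
    ultimately show "V * P * mat_adjoint V \<in> pauli_group n" unfolding pauli_group_def by blast
  qed
  moreover have "conjugate_by V ?A = ?B"
  proof -
    \<comment> \<open>The case of opposite signs with \<open>?A\<close> as the conjugated matrix: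
      the result \<open>?A * (?A * ?B)\<close> is \<open>?B\<close>.\<close>
    have st: "?A * ?A = 1 \<cdot>\<^sub>m (?A * ?A)" "?B * ?A = (-1) \<cdot>\<^sub>m (?A * ?B)" using BA by simp_all
    have "V * ?A * V = ?A * (?A * ?B)"
      unfolding conj[OF pauli_string_carrier] S_def
        anticommuting_sum_conjugate(2)[OF facts pauli_string_carrier st refl] smult_smult_mat by simp
    also have "\<dots> = (?A * ?A) * ?B"
      by (rule assoc_mult_mat[symmetric, OF pauli_string_carrier pauli_string_carrier pauli_string_carrier])
    finally show ?thesis unfolding conjugate_by_def adj by simp
  qed
  ultimately show thesis using that by blast
qed

text \<open>The two strings may commute, so they are not exchanged directly but in two swaps,
  through a string that anticommutes with both.\<close>

lemma clifford_transitive: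
  assumes "\<exists>q<n. p q \<noteq> PI" "\<exists>q<n. p' q \<noteq> PI"
  obtains V where "V \<in> clifford n" "conjugate_by V (pauli_string n p) = pauli_string n p'"
proof -
  obtain t where t: "string_sign n p t = -1" "string_sign n p' t = -1"
    by (rule common_anticommuting_string[OF assms])
  obtain V where V: "V \<in> clifford n" "conjugate_by V (pauli_string n p) = pauli_string n t"
    by (rule clifford_swap[OF t(1)])
  have "string_sign n t p' = -1" using t(2) by (simp add: string_sign_commute)
  then obtain W where W: "W \<in> clifford n" "conjugate_by W (pauli_string n t) = pauli_string n p'"
    by (rule clifford_swap)
  have "conjugate_by (V * W) (pauli_string n p) = pauli_string n p'"
    unfolding conjugate_by_compose[OF cliffordD[OF W(1)] cliffordD[OF V(1)] pauli_string_carrier] V(2) W(2) ..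
  then show thesis using that clifford_mult[OF V(1) W(1)] by blast
qed

section \<open>Clifford unitaries modulo phases\<close>

lemma mat_adjoint_one: "mat_adjoint (1\<^sub>m N :: complex mat) = 1\<^sub>m N"
  by (rule eq_matI) (auto simp: mat_adjoint_entry[of _ N N])

lemma one_clifford: "1\<^sub>m (2 ^ n) \<in> clifford n"
  by (rule cliffordI)
    (auto simp: unitary_op_def mat_adjoint_one left_mult_one_mat[OF pauli_group_carrier] right_mult_one_mat[OF pauli_group_carrier])

lemma single_Z_entry:
  assumes "i < 2 ^ n" "j < 2 ^ n" "x < n"
  shows "pauli_string n (single_string n x PZ) $$ (i, j) = (if i = j then if bit i x then -1 else 1 else 0)"
proof -
  have "pauli_string n (single_string n x PZ) $$ (i, j) =
      (\<Prod>q<n. of_bool (bit i q = bit j q) * (if q = x then if bit i q then -1 else 1 else 1))"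
    unfolding pauli_string_entry[OF assms(1,2)] by (rule prod.cong) (auto simp: single_string_def)
  also have "\<dots> = of_bool (i = j) * (if bit i x then -1 else 1)"
    using assms(3) by (simp add: prod.distrib prod_of_bool bits_eq_iff[OF assms(1,2)])
  finally show ?thesis by simp
qed

text \<open>This string maps the all-zero basis vector to the basis vector with index
  \<open>a\<close>.\<close>

lemma X_string_entry:
  assumes "i < 2 ^ n" "a < 2 ^ n"
  shows "pauli_string n (\<lambda>q. if bit a q then PX else PI) $$ (i, 0) = of_bool (i = a)"
    "pauli_string n (\<lambda>q. if bit a q then PX else PI) $$ (a, i) = of_bool (i = 0)"
proof -
  have "pauli_string n (\<lambda>q. if bit a q then PX else PI) $$ (i, 0) = (\<Prod>q<n. of_bool (bit i q = bit a q))"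
    by (subst pauli_string_entry[OF assms(1)]) (auto intro!: prod.cong)
  then show "pauli_string n (\<lambda>q. if bit a q then PX else PI) $$ (i, 0) = of_bool (i = a)"
    by (simp only: prod_of_bool bits_eq_iff[OF assms])
  have 0: "0 < (2::nat) ^ n" by simp
  have "pauli_string n (\<lambda>q. if bit a q then PX else PI) $$ (a, i) = (\<Prod>q<n. of_bool (bit i q = bit (0::nat) q))"
    by (subst pauli_string_entry[OF assms(2,1)]) (auto intro!: prod.cong)
  then show "pauli_string n (\<lambda>q. if bit a q then PX else PI) $$ (a, i) = of_bool (i = 0)"
    by (simp only: prod_of_bool bits_eq_iff[OF assms(1) 0])
qed

text \<open>Schur's lemma by hand: commuting with Z on a qubit where \<open>i\<close> and
  \<open>j\<close> differ kills the entry (\<open>i\<close>, \<open>j\<close>), and commuting with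
  the X string of \<open>i\<close> identifies the diagonal entry at \<open>i\<close> with the one at
  0.\<close>

lemma commutes_with_paulis_imp_scalar:
  assumes W: "W \<in> carrier_mat (2 ^ n) (2 ^ n)"
    and comm: "\<And>p. W * pauli_string n p = pauli_string n p * W"
  shows "W = W $$ (0, 0) \<cdot>\<^sub>m 1\<^sub>m (2 ^ n)"
proof (rule eq_matI)
  let ?N = "(2::nat) ^ n"
  have 0: "0 < ?N" by simp
  fix i j assume "i < dim_row (W $$ (0, 0) \<cdot>\<^sub>m 1\<^sub>m (2 ^ n))" "j < dim_col (W $$ (0, 0) \<cdot>\<^sub>m 1\<^sub>m (2 ^ n))"
  then have ij: "i < ?N" "j < ?N" by simp_all
  show "W $$ (i, j) = (W $$ (0, 0) \<cdot>\<^sub>m 1\<^sub>m (2 ^ n)) $$ (i, j)"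
  proof (cases "i = j")
    case True
    let ?p = "\<lambda>q. if bit i q then PX else PI"
    have "(W * pauli_string n ?p) $$ (i, 0) = (\<Sum>k<?N. W $$ (i, k) * of_bool (k = i))"
      unfolding mat_mult_entry[OF W pauli_string_carrier ij(1) 0]
      by (rule sum.cong) (auto simp: X_string_entry(1)[OF _ ij(1)])
    also have "\<dots> = W $$ (i, i)" using ij by simp
    finally have 1: "(W * pauli_string n ?p) $$ (i, 0) = W $$ (i, i)" .
    have "(pauli_string n ?p * W) $$ (i, 0) = (\<Sum>k<?N. if k = 0 then W $$ (k, 0) else 0)"
      unfolding mat_mult_entry[OF pauli_string_carrier W ij(1) 0]
      by (rule sum.cong) (auto simp: X_string_entry(2)[OF _ ij(1)])
    also have "\<dots> = W $$ (0, 0)" using 0 by simp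
    finally show ?thesis using True 1 comm[of ?p] ij by simp
  next
    case False
    then obtain x where x: "x < n" "bit i x \<noteq> bit j x" using bits_eq_iff[OF ij] by blast
    let ?p = "single_string n x PZ"
    have "(W * pauli_string n ?p) $$ (i, j) = (\<Sum>k<?N. if k = j then W $$ (i, j) * (if bit j x then -1 else 1) else 0)"
      unfolding mat_mult_entry[OF W pauli_string_carrier ij]
      by (rule sum.cong) (auto simp: single_Z_entry[OF _ ij(2) x(1)])
    then have 1: "(W * pauli_string n ?p) $$ (i, j) = W $$ (i, j) * (if bit j x then -1 else 1)" using ij by simp
    have "(pauli_string n ?p * W) $$ (i, j) = (\<Sum>k<?N. if k = i then (if bit i x then -1 else 1) * W $$ (i, j) else 0)"
      unfolding mat_mult_entry[OF pauli_string_carrier W ij]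
      by (rule sum.cong) (auto simp: single_Z_entry[OF ij(1) _ x(1)])
    then have "(pauli_string n ?p * W) $$ (i, j) = (if bit i x then -1 else 1) * W $$ (i, j)" using ij by simp
    with 1 comm[of ?p] x(2) have "W $$ (i, j) = 0" by (auto split: if_splits)
    then show ?thesis using ij False by simp
  qed
qed (use W in simp_all)

text \<open>\<open>V\<close> times the adjoint of \<open>U\<close> commutes with every Pauli string,
  hence is a scalar, and unitarity makes the scalar a phase.\<close>

lemma same_conjugation_imp_phase:
  assumes U: "U \<in> clifford n" and V: "V \<in> clifford n"
    and eq: "\<And>p. conjugate_by U (pauli_string n p) = conjugate_by V (pauli_string n p)"
  shows "(U, V) \<in> phase_rel n"
proof -
  note u = unitary_opD[OF cliffordD[OF U]] and v = unitary_opD[OF cliffordD[OF V]]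
  let ?N = "(2::nat) ^ n"
  define W where "W = V * mat_adjoint U"
  have W: "W \<in> carrier_mat ?N ?N" unfolding W_def by (rule mult_carrier_mat[OF v(1) u(2)])
  have Wu: "W * U = V" unfolding W_def assoc_mult_mat[OF v(1) u(2,1)] u(4) by (rule right_mult_one_mat[OF v(1)])
  have comm: "W * pauli_string n p = pauli_string n p * W" for p
  proof -
    let ?P = "pauli_string n p"
    note P = pauli_string_carrier[of n p]
    have "W * ?P = W * (U * conjugate_by U ?P * mat_adjoint U)"
      by (simp only: conjugate_by_inverse(2)[OF cliffordD[OF U] P])
    also have "\<dots> = W * (U * conjugate_by V ?P) * mat_adjoint U"
      unfolding eq by (rule assoc_mult_mat[symmetric, OF W mult_carrier_mat[OF u(1) conjugate_by_carrier[OF cliffordD[OF V] P]] u(2)])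
    also have "W * (U * conjugate_by V ?P) = V * conjugate_by V ?P"
      unfolding assoc_mult_mat[OF W u(1) conjugate_by_carrier[OF cliffordD[OF V] P], symmetric] Wu ..
    also have "\<dots> = V * (mat_adjoint V * (?P * V))"
      unfolding conjugate_by_def assoc_mult_mat[OF v(2) P v(1)] ..
    also have "\<dots> = ?P * V"
      unfolding assoc_mult_mat[OF v(1,2) mult_carrier_mat[OF P v(1)], symmetric] v(3)
      by (rule left_mult_one_mat[OF mult_carrier_mat[OF P v(1)]])
    also have "?P * V * mat_adjoint U = ?P * W" unfolding W_def by (rule assoc_mult_mat[OF P v(1) u(2)])
    finally show ?thesis .
  qed
  define c where "c = W $$ (0, 0)"
  have Wc: "W = c \<cdot>\<^sub>m 1\<^sub>m ?N" unfolding c_def by (rule commutes_with_paulis_imp_scalar[OF W comm])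
  have Vc: "V = c \<cdot>\<^sub>m U"
    using Wu unfolding Wc mult_smult_assoc_mat[OF one_carrier_mat u(1)] left_mult_one_mat[OF u(1)] ..
  have "1\<^sub>m ?N = (c * cnj c) \<cdot>\<^sub>m (1\<^sub>m ?N :: complex mat)"
    using v(3) unfolding Vc mat_adjoint_smult smult_mult_smult[OF u(1,2)] u(3) ..
  then have "(1\<^sub>m ?N :: complex mat) $$ (0, 0) = ((c * cnj c) \<cdot>\<^sub>m (1\<^sub>m ?N)) $$ (0, 0)" by simp
  then have "c * cnj c = 1" by simp
  then have "cmod c = 1" by (metis complex_mod_mult_cnj norm_one power2_eq_1_iff norm_ge_zero zero_le_square order.trans neg_0_le_iff_le not_one_le_zero)
  then show ?thesis unfolding phase_rel_def using U V Vc by blast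
qed

lemma equiv_phase_rel: "equiv (clifford n) (phase_rel n)"
proof (rule equivI)
  show "phase_rel n \<subseteq> clifford n \<times> clifford n" unfolding phase_rel_def by blast
  show "refl_on (clifford n) (phase_rel n)"
    unfolding refl_on_def phase_rel_def by (auto intro!: exI[of _ 1])
  show "sym (phase_rel n)"
  proof (rule symI)
    fix U V assume "(U, V) \<in> phase_rel n"
    then obtain c where c: "U \<in> clifford n" "V \<in> clifford n" "cmod c = 1" "V = c \<cdot>\<^sub>m U" unfolding phase_rel_def by blast
    have "inverse c * c = 1" using c(3) by (intro left_inverse) auto
    then have "U = inverse c \<cdot>\<^sub>m V" unfolding c(4) smult_smult_mat by simp
    moreover have "cmod (inverse c) = 1" using c(3) by (simp add: norm_inverse)
    ultimately show "(V, U) \<in> phase_rel n" unfolding phase_rel_def using c(1,2) by blast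
  qed
  show "trans (phase_rel n)"
  proof (rule transI)
    fix U V W assume "(U, V) \<in> phase_rel n" "(V, W) \<in> phase_rel n"
    then obtain c d where c: "U \<in> clifford n" "V \<in> clifford n" "W \<in> clifford n" "cmod c = 1" "V = c \<cdot>\<^sub>m U" "cmod d = 1" "W = d \<cdot>\<^sub>m V"
      unfolding phase_rel_def by blast
    have "W = (d * c) \<cdot>\<^sub>m U" "cmod (d * c) = 1" using c by (auto simp: smult_smult_mat norm_mult)
    then show "(U, W) \<in> phase_rel n" unfolding phase_rel_def using c(1,3) by blast
  qed
qed

text \<open>A class is determined by the conjugation action of its members on the finitely many Pauli strings.\<close>

lemma finite_clifford_classes: "finite (clifford n // phase_rel n)"
proof -
  define act where "act U = (\<lambda>p\<in>strings n. conjugate_by U (pauli_string n p))" for U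
  have "clifford n // phase_rel n \<subseteq>
      (\<lambda>f. phase_rel n `` {SOME U. U \<in> clifford n \<and> act U = f}) ` (strings n \<rightarrow>\<^sub>E pauli_group n)"
  proof
    fix c assume "c \<in> clifford n // phase_rel n"
    then obtain U where U: "U \<in> clifford n" "c = phase_rel n `` {U}" by (rule quotientE)
    define V where "V = (SOME V. V \<in> clifford n \<and> act V = act U)"
    have V: "V \<in> clifford n \<and> act V = act U" unfolding V_def
      by (rule someI[where P = "\<lambda>V. V \<in> clifford n \<and> act V = act U" and x = U]) (simp add: U(1))
    have "conjugate_by V (pauli_string n p) = conjugate_by U (pauli_string n p)" for p
    proof -
      have "act V (restrict p {..<n}) = act U (restrict p {..<n})" using V by simp
      then show ?thesis unfolding act_def by (simp add: strings_normalise)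
    qed
    then have "(V, U) \<in> phase_rel n" using V U(1) by (intro same_conjugation_imp_phase) auto
    then have "c = phase_rel n `` {V}" unfolding U(2) by (rule equiv_class_eq[OF equiv_phase_rel, symmetric])
    then have "c = phase_rel n `` {SOME V. V \<in> clifford n \<and> act V = act U}" unfolding V_def .
    moreover have "act U \<in> strings n \<rightarrow>\<^sub>E pauli_group n"
      unfolding act_def by (rule PiE_I) (simp_all add: clifford_conjugate_mem[OF U(1) pauli_string_mem])
    ultimately show "c \<in> (\<lambda>f. phase_rel n `` {SOME U. U \<in> clifford n \<and> act U = f}) ` (strings n \<rightarrow>\<^sub>E pauli_group n)"
      by (rule image_eqI)
  qed
  moreover have "finite (strings n \<rightarrow>\<^sub>E pauli_group n)"
    by (intro finite_PiE finite_strings finite_pauli_group)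
  ultimately show ?thesis by (rule finite_subset[OF _ finite_imageI])
qed

lemma clifford_classes_nonempty: "clifford n // phase_rel n \<noteq> {}"
  by (rule ex_in_conv[THEN iffD1]) (rule exI, rule quotientI[OF one_clifford])

section \<open>Counting under the uniform distribution on Clifford classes\<close>

definition representative :: "complex mat set \<Rightarrow> complex mat" where
  "representative c = (SOME U. U \<in> c)"

lemma representative:
  assumes "c \<in> clifford n // phase_rel n"
  shows "representative c \<in> c" "representative c \<in> clifford n" "phase_rel n `` {representative c} = c"
proof -
  obtain U where U: "U \<in> clifford n" "c = phase_rel n `` {U}" using assms by (rule quotientE)
  have "U \<in> c" unfolding U(2) using equiv_class_self[OF equiv_phase_rel U(1)] .
  then show 1: "representative c \<in> c" unfolding representative_def by (rule someI)
  then have r: "(U, representative c) \<in> phase_rel n" using U(2) by blast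
  then show "representative c \<in> clifford n" unfolding phase_rel_def by auto
  show "phase_rel n `` {representative c} = c"
    using equiv_class_eq[OF equiv_phase_rel r] U(2) by (rule trans[OF sym sym])
qed

lemma set_clifford_pmf: "set_pmf (clifford_pmf n) = representative ` (clifford n // phase_rel n)"
  unfolding clifford_pmf_def representative_def
  by (simp add: set_pmf_of_set[OF clifford_classes_nonempty finite_clifford_classes])

lemma set_clifford_pmf_subset: "set_pmf (clifford_pmf n) \<subseteq> clifford n"
  unfolding set_clifford_pmf using representative(2) by blast

lemma measure_clifford_pmf:
  "measure (measure_pmf (clifford_pmf n)) A =
   card {c \<in> clifford n // phase_rel n. representative c \<in> A} / card (clifford n // phase_rel n)"
proof -
  have "measure (measure_pmf (clifford_pmf n)) A =
      measure (measure_pmf (pmf_of_set (clifford n // phase_rel n))) (representative -` A)"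
    unfolding clifford_pmf_def measure_map_pmf representative_def ..
  also have "\<dots> = card ((clifford n // phase_rel n) \<inter> representative -` A) / card (clifford n // phase_rel n)"
    by (rule measure_pmf_of_set[OF clifford_classes_nonempty finite_clifford_classes])
  also have "(clifford n // phase_rel n) \<inter> representative -` A = {c \<in> clifford n // phase_rel n. representative c \<in> A}"
    by blast
  finally show ?thesis .
qed

text \<open>The expectation is multiplied by the squared modulus of the phase. This makes
  stabilization a property of the class, whichever representative is drawn.\<close>

lemma stabilized_phase:
  assumes "(U, V) \<in> phase_rel n" shows "stabilized n V p \<longleftrightarrow> stabilized n U p"
proof -
  obtain c where c: "U \<in> clifford n" "cmod c = 1" "V = c \<cdot>\<^sub>m U" using assms unfolding phase_rel_def by blast
  have d: "dim_row U = 2 ^ n" "dim_col U = 2 ^ n" using unitary_opD(1)[OF cliffordD[OF c(1)]] by simp_all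
  have cc: "cnj c * c = 1" using c(2) by (metis complex_norm_square mult.commute of_real_1 one_power2)
  have "pauli_expectation n V p = (\<Sum>i<2^n. \<Sum>j<2^n. (cnj c * c) * (cnj (U $$ (i, 0)) * pauli_string n p $$ (i, j) * U $$ (j, 0)))"
    unfolding pauli_expectation_def c(3) by (intro sum.cong refl) (simp add: d)
  also have "\<dots> = pauli_expectation n U p" unfolding cc pauli_expectation_def by simp
  finally show ?thesis unfolding stabilized_def by simp
qed

lemma stabilized_mult:
  assumes "V \<in> clifford n" "U \<in> clifford n" "conjugate_by V (pauli_string n p') = pauli_string n p"
  shows "stabilized n (V * U) p' \<longleftrightarrow> stabilized n U p"
  unfolding stabilized_def pauli_expectation_eq[OF cliffordD[OF clifford_mult[OF assms(1,2)]]]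
    pauli_expectation_eq[OF cliffordD[OF assms(2)]]
    conjugate_by_compose[OF cliffordD[OF assms(2)] cliffordD[OF assms(1)] pauli_string_carrier] assms(3) ..

text \<open>Left multiplication by a Clifford unitary that pulls \<open>p'\<close> back to
  \<open>p\<close> is injective on classes, and takes those stabilized by \<open>p\<close> to those
  stabilized by \<open>p'\<close>. Used in both directions, it shows that all nonidentity strings
  are equally likely.\<close>

lemma card_stabilized_classes_le:
  assumes "\<exists>q<n. p q \<noteq> PI" "\<exists>q<n. p' q \<noteq> PI"
  shows "card {c \<in> clifford n // phase_rel n. stabilized n (representative c) p} \<le>
    card {c \<in> clifford n // phase_rel n. stabilized n (representative c) p'}"
proof -
  obtain V where V: "V \<in> clifford n" "conjugate_by V (pauli_string n p') = pauli_string n p"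
    by (rule clifford_transitive[OF assms(2,1)])
  note v = unitary_opD[OF cliffordD[OF V(1)]]
  define h where "h c = phase_rel n `` {V * representative c}" for c
  have mem: "V * representative c \<in> clifford n" if "c \<in> clifford n // phase_rel n" for c
    by (rule clifford_mult[OF V(1) representative(2)[OF that]])
  have h: "h c \<in> clifford n // phase_rel n" if "c \<in> clifford n // phase_rel n" for c
    unfolding h_def by (rule quotientI[OF mem[OF that]])
  have rel: "(V * representative c, representative (h c)) \<in> phase_rel n" if "c \<in> clifford n // phase_rel n" for c
    using representative(1)[OF h[OF that]] unfolding h_def by blast
  show ?thesis
  proof (rule card_inj_on_le)
    show "inj_on h {c \<in> clifford n // phase_rel n. stabilized n (representative c) p}"
    proof (rule inj_onI, elim CollectE conjE)
      fix c d assume cd: "c \<in> clifford n // phase_rel n" "d \<in> clifford n // phase_rel n" "h c = h d"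
      have "(V * representative c, V * representative d) \<in> phase_rel n"
        using cd(3) unfolding h_def by (rule eq_equiv_class[OF _ equiv_phase_rel mem[OF cd(2)]])
      then obtain z where z: "cmod z = 1" "V * representative d = z \<cdot>\<^sub>m (V * representative c)"
        unfolding phase_rel_def by blast
      note rc = unitary_opD(1)[OF cliffordD[OF representative(2)[OF cd(1)]]]
        and rd = unitary_opD(1)[OF cliffordD[OF representative(2)[OF cd(2)]]]
      have "mat_adjoint V * (V * representative d) = mat_adjoint V * (V * (z \<cdot>\<^sub>m representative c))"
        unfolding z(2) mult_smult_distrib[OF v(1) rc] ..
      then have "representative d = z \<cdot>\<^sub>m representative c"
        unfolding assoc_mult_mat[OF v(2,1) rd, symmetric] assoc_mult_mat[OF v(2,1) smult_carrier_mat[OF rc], symmetric] v(4)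
          left_mult_one_mat[OF rd] left_mult_one_mat[OF smult_carrier_mat[OF rc]] .
      then have "(representative c, representative d) \<in> phase_rel n"
        unfolding phase_rel_def using z(1) representative(2)[OF cd(1)] representative(2)[OF cd(2)] by blast
      then show "c = d"
        using equiv_class_eq[OF equiv_phase_rel] representative(3)[OF cd(1)] representative(3)[OF cd(2)] by blast
    qed
    show "h ` {c \<in> clifford n // phase_rel n. stabilized n (representative c) p} \<subseteq>
        {c \<in> clifford n // phase_rel n. stabilized n (representative c) p'}"
    proof (rule image_subsetI, elim CollectE conjE)
      fix c assume c: "c \<in> clifford n // phase_rel n" "stabilized n (representative c) p"
      have "stabilized n (representative (h c)) p'"
        unfolding stabilized_phase[OF rel[OF c(1)]] stabilized_mult[OF V(1) representative(2)[OF c(1)] V(2)] by (rule c(2))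
      then show "h c \<in> {c \<in> clifford n // phase_rel n. stabilized n (representative c) p'}" using h[OF c(1)] by blast
    qed
  qed (use finite_clifford_classes in simp)
qed

lemma stabilized_identity:
  assumes "U \<in> clifford n" "\<And>q. q < n \<Longrightarrow> p q = PI"
  shows "stabilized n U p"
proof -
  note u = unitary_opD[OF cliffordD[OF assms(1)]]
  have p: "pauli_string n p = 1\<^sub>m (2 ^ n)" by (rule pauli_string_PI[OF assms(2)])
  have "conjugate_by U (pauli_string n p) = 1\<^sub>m (2 ^ n)"
    unfolding p conjugate_by_def right_mult_one_mat[OF u(2)] by (rule u(4))
  then show ?thesis unfolding stabilized_def pauli_expectation_eq[OF cliffordD[OF assms(1)]] by simp
qed

text \<open>Double counting of pairs of a class and a string stabilizing it: every class has 2^n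
  such strings, the identity is always among them, and the other 4^n - 1 strings share the rest
  equally.\<close>

lemma clifford_pmf_stabilized:
  assumes "\<exists>q<n. p q \<noteq> PI"
  shows "measure (measure_pmf (clifford_pmf n)) {U. stabilized n U p} = 1 / (2 ^ n + 1)"
proof -
  let ?Q = "clifford n // phase_rel n"
  define K where "K p = card {c \<in> ?Q. stabilized n (representative c) p}" for p
  define e where "e = (\<lambda>q\<in>{..<n}. PI)"
  have e: "e \<in> strings n" unfolding e_def strings_def by simp
  have "{c \<in> ?Q. stabilized n (representative c) e} = ?Q"
    using stabilized_identity[OF representative(2), of _ n e] unfolding e_def by auto
  then have Ke: "K e = card ?Q" unfolding K_def by simp
  have K: "K p' = K p" if p': "p' \<in> strings n - {e}" for p'
  proof -
    have "\<exists>q<n. p' q \<noteq> PI" using p' strings_eqI[OF _ e, of p'] unfolding e_def by auto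
    then show ?thesis unfolding K_def using assms by (intro antisym card_stabilized_classes_le)
  qed
  have "(\<Sum>p\<in>strings n. K p) = (\<Sum>p\<in>strings n. \<Sum>c\<in>?Q. of_bool (stabilized n (representative c) p))"
    unfolding K_def by (intro sum.cong refl card_filter_eq_sum finite_clifford_classes)
  also have "\<dots> = (\<Sum>c\<in>?Q. \<Sum>p\<in>strings n. of_bool (stabilized n (representative c) p))" by (rule sum.swap)
  also have "\<dots> = (\<Sum>c\<in>?Q. 2 ^ n)"
    by (intro sum.cong refl) (simp only: card_filter_eq_sum[OF finite_strings, symmetric] card_stabilized[OF representative(2)])
  finally have total: "(\<Sum>p\<in>strings n. K p) = card ?Q * 2 ^ n" by simp
  have "(\<Sum>p\<in>strings n. K p) = K e + (\<Sum>p\<in>strings n - {e}. K p)" by (rule sum.remove[OF finite_strings e])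
  also have "(\<Sum>p\<in>strings n - {e}. K p) = (\<Sum>p'\<in>strings n - {e}. K p)" using K by (rule sum.cong[OF refl])
  also have "\<dots> = (4 ^ n - 1) * K p" using e by (simp add: card_Diff_singleton card_strings)
  finally have "card ?Q * 2 ^ n = card ?Q + (4 ^ n - 1) * K p" unfolding total Ke .
  then have "real (card ?Q * 2 ^ n) = real (card ?Q + (4 ^ n - 1) * K p)" by (rule arg_cong)
  also have "\<dots> = real (card ?Q) + (4 ^ n - 1) * real (K p)"
    unfolding of_nat_add of_nat_mult by (subst of_nat_diff) simp_all
  also have "(4::real) ^ n = 2 ^ n * 2 ^ n" by (subst power_mult_distrib[symmetric]) simp
  finally have "real (card ?Q) * 2 ^ n = real (card ?Q) + (2 ^ n * 2 ^ n - 1) * real (K p)" by simp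
  then have "(2 ^ n - 1) * real (card ?Q) = (2 ^ n - 1) * ((2 ^ n + 1) * real (K p))"
    by (simp only: algebra_simps)
  \<comment> \<open>The qubit supplied by the assumption forces \<open>n > 0\<close>, which allows
    cancelling the common factor 2^n - 1.\<close>
  moreover have "(2::real) ^ n > 1" using assms by (intro one_less_power) auto
  ultimately have card: "real (card ?Q) = (2 ^ n + 1) * real (K p)"
    by (metis mult_cancel_left diff_gt_0_iff_gt less_irrefl)
  have "card ?Q > 0" using finite_clifford_classes clifford_classes_nonempty by (simp add: card_gt_0_iff)
  then have "real (card ?Q) \<noteq> 0" by simp
  then have "real (K p) \<noteq> 0" unfolding card by (metis mult_zero_right)
  moreover have "0 < (2::real) ^ n + 1" by (simp add: add_pos_pos)
  ultimately have "real (K p) / ((2 ^ n + 1) * real (K p)) = 1 / (2 ^ n + 1)"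
    by (metis mult.commute nonzero_divide_mult_cancel_left)
  then show ?thesis unfolding measure_clifford_pmf mem_Collect_eq K_def[symmetric] card .
qed

section \<open>Tensor powers\<close>

text \<open>An index of a Kronecker product is \<open>x * b + y\<close>; this splits a sum over it
  into the sums over the two factors.\<close>

lemma sum_div_mod:
  fixes f :: "nat \<Rightarrow> nat \<Rightarrow> 'a::comm_monoid_add"
  shows "(\<Sum>k<a*b. f (k div b) (k mod b)) = (\<Sum>x<a. \<Sum>y<b. f x y)"
proof (cases "b = 0")
  case False
  have "(\<Sum>k<a*b. f (k div b) (k mod b)) = (\<Sum>x<a. \<Sum>k\<in>{x*b..<x*b+b}. f (k div b) (k mod b))"
    by (rule sum.nat_group[symmetric])
  also have "\<dots> = (\<Sum>x<a. \<Sum>y<b. f x y)"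
  proof (rule sum.cong[OF refl])
    fix x
    have "(\<Sum>k\<in>{x*b..<x*b+b}. f (k div b) (k mod b)) = (\<Sum>y\<in>{0..<b}. f ((y + x*b) div b) ((y + x*b) mod b))"
      using sum.shift_bounds_nat_ivl[of "\<lambda>k. f (k div b) (k mod b)" 0 "x*b" b] by (simp add: add.commute)
    also have "\<dots> = (\<Sum>y\<in>{0..<b}. f x y)" by (rule sum.cong) (use False in auto)
    finally show "(\<Sum>k\<in>{x*b..<x*b+b}. f (k div b) (k mod b)) = (\<Sum>y<b. f x y)" by (simp add: lessThan_atLeast0)
  qed
  finally show ?thesis .
qed simp

lemma kron_carrier: "A \<in> carrier_mat a a' \<Longrightarrow> B \<in> carrier_mat b b' \<Longrightarrow> kron A B \<in> carrier_mat (a * b) (a' * b')"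
  unfolding kron_def by (simp only: carrier_matD mat_carrier)

lemma kron_entry:
  assumes "A \<in> carrier_mat a a'" "B \<in> carrier_mat b b'" "i < a * b" "j < a' * b'"
  shows "kron A B $$ (i, j) = A $$ (i div b, j div b') * B $$ (i mod b, j mod b')"
  using assms unfolding kron_def by (simp add: carrier_matD[OF assms(1)] carrier_matD[OF assms(2)])

lemma div_mod_bounds: 
  assumes "i < a * (b::nat)" shows "i div b < a" "i mod b < b"
proof -
  have "b > 0" using assms by (cases b) auto
  then show "i div b < a" "i mod b < b" using assms by (auto simp: less_mult_imp_div_less)
qed

lemma kron_mult:
  assumes A: "A \<in> carrier_mat a a" and B: "B \<in> carrier_mat b b" and C: "C \<in> carrier_mat a a" and D: "D \<in> carrier_mat b b"
  shows "kron A B * kron C D = kron (A * C) (B * D)"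
proof (rule eq_matI)
  note AB = kron_carrier[OF A B] and CD = kron_carrier[OF C D]
  note AC = mult_carrier_mat[OF A C] and BD = mult_carrier_mat[OF B D]
  fix i j assume "i < dim_row (kron (A * C) (B * D))" "j < dim_col (kron (A * C) (B * D))"
  then have ij: "i < a * b" "j < a * b" using carrier_matD[OF kron_carrier[OF AC BD]] by simp_all
  note i = div_mod_bounds[OF ij(1)] and j = div_mod_bounds[OF ij(2)]
  have "(kron A B * kron C D) $$ (i, j) = (\<Sum>k<a*b. (A $$ (i div b, k div b) * C $$ (k div b, j div b)) * (B $$ (i mod b, k mod b) * D $$ (k mod b, j mod b)))"
    unfolding mat_mult_entry[OF AB CD ij]
    by (rule sum.cong) (simp_all add: kron_entry[OF A B ij(1)] kron_entry[OF C D _ ij(2)])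
  also have "\<dots> = (\<Sum>x<a. \<Sum>y<b. (A $$ (i div b, x) * C $$ (x, j div b)) * (B $$ (i mod b, y) * D $$ (y, j mod b)))"
    by (rule sum_div_mod)
  also have "\<dots> = (A * C) $$ (i div b, j div b) * (B * D) $$ (i mod b, j mod b)"
    unfolding mat_mult_entry[OF A C i(1) j(1)] mat_mult_entry[OF B D i(2) j(2)] sum_product ..
  also have "\<dots> = kron (A * C) (B * D) $$ (i, j)" by (rule kron_entry[OF AC BD ij, symmetric])
  finally show "(kron A B * kron C D) $$ (i, j) = kron (A * C) (B * D) $$ (i, j)" .
qed (use carrier_matD[OF kron_carrier[OF A B]] carrier_matD[OF kron_carrier[OF C D]]
    carrier_matD[OF kron_carrier[OF mult_carrier_mat[OF A C] mult_carrier_mat[OF B D]]] in simp_all)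

lemma kron_pow_carrier: "A \<in> carrier_mat d d \<Longrightarrow> kron_pow A k \<in> carrier_mat (d ^ k) (d ^ k)"
  by (induction k) (simp_all add: kron_carrier)

lemma kron_pow_entry_Suc:
  assumes "A \<in> carrier_mat d d" "i < d ^ Suc k" "j < d ^ Suc k"
  shows "kron_pow A (Suc k) $$ (i, j) =
    A $$ (i div d ^ k, j div d ^ k) * kron_pow A k $$ (i mod d ^ k, j mod d ^ k)"
  using assms(2,3) by (simp add: kron_entry[OF assms(1) kron_pow_carrier[OF assms(1)]])

lemma kron_pow_mult:
  assumes "A \<in> carrier_mat d d" "B \<in> carrier_mat d d"
  shows "kron_pow A k * kron_pow B k = kron_pow (A * B) k"
  by (induction k) (simp_all add: kron_mult[OF assms(1) kron_pow_carrier[OF assms(1)] assms(2) kron_pow_carrier[OF assms(2)]])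

lemma kron_pow_smult:
  assumes A: "A \<in> carrier_mat d d" and "i < d ^ k" "j < d ^ k"
  shows "kron_pow (c \<cdot>\<^sub>m A) k $$ (i, j) = c ^ k * kron_pow A k $$ (i, j)"
  using assms(2,3)
proof (induction k arbitrary: i j)
  case (Suc k)
  have ij: "i < d * d ^ k" "j < d * d ^ k" using Suc.prems by simp_all
  note i = div_mod_bounds[OF ij(1)] and j = div_mod_bounds[OF ij(2)]
  have "(c \<cdot>\<^sub>m A) $$ (i div d ^ k, j div d ^ k) = c * A $$ (i div d ^ k, j div d ^ k)"
    using i(1) j(1) carrier_matD[OF A] by simp
  then show ?case
    unfolding kron_pow_entry_Suc[OF A Suc.prems] kron_pow_entry_Suc[OF smult_carrier_mat[OF A] Suc.prems] Suc.IH[OF i(2) j(2)]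
    by simp
qed simp

lemma kron_pow_hermitian:
  assumes A: "A \<in> carrier_mat d d" and h: "\<And>i j. i < d \<Longrightarrow> j < d \<Longrightarrow> cnj (A $$ (i, j)) = A $$ (j, i)"
    and "i < d ^ k" "j < d ^ k"
  shows "cnj (kron_pow A k $$ (i, j)) = kron_pow A k $$ (j, i)"
  using assms(3,4)
proof (induction k arbitrary: i j)
  case (Suc k)
  have ij: "i < d * d ^ k" "j < d * d ^ k" using Suc.prems by simp_all
  note i = div_mod_bounds[OF ij(1)] and j = div_mod_bounds[OF ij(2)]
  show ?case
    unfolding kron_pow_entry_Suc[OF A Suc.prems] kron_pow_entry_Suc[OF A Suc.prems(2,1)] complex_cnj_mult
      h[OF i(1) j(1)] Suc.IH[OF i(2) j(2)] ..
qed simp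

lemma kron_pow_bounded:
  assumes A: "A \<in> carrier_mat d d" and h: "\<And>i j. i < d \<Longrightarrow> j < d \<Longrightarrow> cmod (A $$ (i, j)) \<le> 1"
    and "i < d ^ k" "j < d ^ k"
  shows "cmod (kron_pow A k $$ (i, j)) \<le> 1"
  using assms(3,4)
proof (induction k arbitrary: i j)
  case (Suc k)
  have ij: "i < d * d ^ k" "j < d * d ^ k" using Suc.prems by simp_all
  note i = div_mod_bounds[OF ij(1)] and j = div_mod_bounds[OF ij(2)]
  show ?case unfolding kron_pow_entry_Suc[OF A Suc.prems] norm_mult
    by (intro mult_le_one norm_ge_zero h Suc.IH i j)
qed simp

lemma kron_pow_measurable:
  assumes A: "\<And>\<omega>. A \<omega> \<in> carrier_mat d d"
    and h: "\<And>i j. i < d \<Longrightarrow> j < d \<Longrightarrow> (\<lambda>\<omega>. A \<omega> $$ (i, j)) \<in> borel_measurable M"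
    and "i < d ^ k" "j < d ^ k"
  shows "(\<lambda>\<omega>. kron_pow (A \<omega>) k $$ (i, j)) \<in> borel_measurable M"
  using assms(3,4)
proof (induction k arbitrary: i j)
  case (Suc k)
  have ij: "i < d * d ^ k" "j < d * d ^ k" using Suc.prems by simp_all
  note i = div_mod_bounds[OF ij(1)] and j = div_mod_bounds[OF ij(2)]
  show ?case unfolding kron_pow_entry_Suc[OF A Suc.prems]
    by (intro borel_measurable_times h Suc.IH i j)
qed simp

text \<open>Through this identity the fourth tensor power of a string, tested on four copies of a
  state, yields the fourth power of the expectation.\<close>

lemma kron_pow_trace:
  assumes A: "A \<in> carrier_mat d d"
  shows "(\<Sum>i<d^k. kron_pow A k $$ (i, i)) = (\<Sum>i<d. A $$ (i, i)) ^ k"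
proof (induction k)
  case (Suc k)
  have "(\<Sum>i<d^Suc k. kron_pow A (Suc k) $$ (i, i)) =
      (\<Sum>i<d*d^k. A $$ (i div d ^ k, i div d ^ k) * kron_pow A k $$ (i mod d ^ k, i mod d ^ k))"
    by (rule sum.cong) (simp_all only: lessThan_iff kron_pow_entry_Suc[OF A] power_Suc)
  also have "\<dots> = (\<Sum>x<d. \<Sum>y<d^k. A $$ (x, x) * kron_pow A k $$ (y, y))" by (rule sum_div_mod)
  also have "\<dots> = (\<Sum>x<d. A $$ (x, x)) * (\<Sum>y<d^k. kron_pow A k $$ (y, y))" by (rule sum_product[symmetric])
  finally show ?case unfolding Suc.IH by simp
qed simp

section \<open>The test operator\<close>

text \<open>
  Up to the factor \<open>4^n\<close>, the projector onto the stabilizer code defined by the signed fourth powers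
  \<open>string_sign n p t * P\<^sub>t\<^sup>\<otimes>\<^sup>4\<close>, whose expectation in a stabilizer state tells whether the
  string \<open>p\<close> belongs to the stabilizer group up to sign.
\<close>

definition test_entry :: "nat \<Rightarrow> (nat \<Rightarrow> pauli) \<Rightarrow> nat \<Rightarrow> nat \<Rightarrow> complex" where
  "test_entry n p i j = (\<Sum>t\<in>strings n. string_sign n p t * kron_pow (pauli_string n t) 4 $$ (i, j))"

lemma test_entry_hermitian:
  assumes "i < (2 ^ n) ^ 4" "j < (2 ^ n) ^ 4"
  shows "cnj (test_entry n p i j) = test_entry n p j i"
proof -
  have s: "cnj (string_sign n p t) = string_sign n p t" for t using string_sign_values[of n p t] by auto
  have h: "cnj (pauli_string n t $$ (a, b)) = pauli_string n t $$ (b, a)" if "a < 2 ^ n" "b < 2 ^ n" for a b t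
    using mat_adjoint_entry[OF pauli_string_carrier that(2,1), of t] by simp
  show ?thesis unfolding test_entry_def cnj_sum complex_cnj_mult s
    by (intro sum.cong refl) (simp only: kron_pow_hermitian[OF pauli_string_carrier h assms])
qed

lemma string_prod_bij: "bij_betw (string_prod n p) (strings n) (strings n)"
  by (rule bij_betw_byWitness[where f' = "string_prod n p"]) (auto simp: string_prod_cancel)

text \<open>The place where four copies matter: the phase of a product of two strings disappears in
  the fourth power. The signed tensor powers thus represent the group of strings modulo phases, and
  the square of a sum over a group is the group order times that sum.\<close>

lemma test_entry_square:
  assumes "l < (2 ^ n) ^ 4" "k < (2 ^ n) ^ 4"
  shows "(\<Sum>i<(2^n)^4. test_entry n p l i * test_entry n p i k) = 4 ^ n * test_entry n p l k"
proof -
  let ?K = "\<lambda>t. kron_pow (pauli_string n t) 4"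
  have K: "(\<Sum>i<(2^n)^4. ?K t $$ (l, i) * ?K t' $$ (i, k)) = ?K (string_prod n t t') $$ (l, k)" for t t'
  proof -
    have "(\<Sum>i<(2^n)^4. ?K t $$ (l, i) * ?K t' $$ (i, k)) = (?K t * ?K t') $$ (l, k)"
      by (rule mat_mult_entry[symmetric, OF kron_pow_carrier[OF pauli_string_carrier] kron_pow_carrier[OF pauli_string_carrier] assms])
    also have "\<dots> = string_phase n t t' ^ 4 * ?K (string_prod n t t') $$ (l, k)"
      unfolding kron_pow_mult[OF pauli_string_carrier pauli_string_carrier] pauli_string_mult
      by (rule kron_pow_smult[OF pauli_string_carrier assms])
    finally show ?thesis unfolding string_phase_pow4 by simp
  qed
  have "(\<Sum>i<(2^n)^4. test_entry n p l i * test_entry n p i k) =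
      (\<Sum>i<(2^n)^4. \<Sum>t\<in>strings n. \<Sum>t'\<in>strings n. string_sign n p (string_prod n t t') * (?K t $$ (l, i) * ?K t' $$ (i, k)))"
    unfolding test_entry_def sum_product string_sign_prod by (intro sum.cong refl) (simp only: mult_ac)
  also have "\<dots> = (\<Sum>t\<in>strings n. \<Sum>i<(2^n)^4. \<Sum>t'\<in>strings n. string_sign n p (string_prod n t t') * (?K t $$ (l, i) * ?K t' $$ (i, k)))"
    by (rule sum.swap)
  also have "\<dots> = (\<Sum>t\<in>strings n. \<Sum>t'\<in>strings n. \<Sum>i<(2^n)^4. string_sign n p (string_prod n t t') * (?K t $$ (l, i) * ?K t' $$ (i, k)))"
    by (intro sum.cong refl sum.swap)
  also have "\<dots> = (\<Sum>t\<in>strings n. \<Sum>t'\<in>strings n. string_sign n p (string_prod n t t') * ?K (string_prod n t t') $$ (l, k))"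
    unfolding sum_distrib_left[symmetric] K ..
  also have "\<dots> = (\<Sum>t\<in>strings n. test_entry n p l k)"
    unfolding test_entry_def by (intro sum.cong refl sum.reindex_bij_betw[OF string_prod_bij])
  also have "\<dots> = 4 ^ n * test_entry n p l k" by (simp add: card_strings)
  finally show ?thesis .
qed

text \<open>The trace of \<open>A\<close> times the test operator.\<close>

definition test_value :: "nat \<Rightarrow> (nat \<Rightarrow> pauli) \<Rightarrow> complex mat \<Rightarrow> complex" where
  "test_value n p A = (\<Sum>k<(2^n)^4. \<Sum>l<(2^n)^4. A $$ (k, l) * test_entry n p l k)"

text \<open>For the hermitian test operator T with T T = 4^n T, cyclicity of the trace gives 4^n
  tr(A T) = tr(T A T), a sum of values of the quadratic form of \<open>A\<close>. This replaces any
  spectral argument.\<close>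

lemma test_value_nonneg:
  assumes A: "A \<in> carrier_mat ((2 ^ n) ^ 4) ((2 ^ n) ^ 4)" and "psd A"
  shows "0 \<le> Re (test_value n p A)"
proof -
  let ?D = "((2::nat) ^ n) ^ 4"
  note d = carrier_matD[OF A]
  \<comment> \<open>The columns of the test operator.\<close>
  define v where "v i = Matrix.vec ?D (\<lambda>l. test_entry n p l i)" for i
  have v: "(A *\<^sub>v v i) \<bullet>c v i = (\<Sum>k<?D. \<Sum>l<?D. A $$ (k, l) * (test_entry n p l i * test_entry n p i k))"
    if i: "i < ?D" for i
  proof -
    have "(A *\<^sub>v v i) \<bullet>c v i = (\<Sum>k<?D. (\<Sum>l<?D. A $$ (k, l) * test_entry n p l i) * cnj (test_entry n p k i))"
      unfolding scalar_prod_def v_def by (simp add: d scalar_prod_def lessThan_atLeast0)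
    also have "\<dots> = (\<Sum>k<?D. \<Sum>l<?D. A $$ (k, l) * (test_entry n p l i * test_entry n p i k))"
      unfolding sum_distrib_right
      by (intro sum.cong refl) (simp add: test_entry_hermitian[OF _ i] mult.assoc)
    finally show ?thesis .
  qed
  have nonneg: "0 \<le> Re ((A *\<^sub>v v i) \<bullet>c v i)" for i
  proof -
    have "v i \<in> carrier_vec (dim_col A)" unfolding v_def d by simp
    then show ?thesis using \<open>psd A\<close> unfolding psd_def by (auto simp: less_eq_complex_def)
  qed
  have "(\<Sum>i<?D. (A *\<^sub>v v i) \<bullet>c v i) = (\<Sum>i<?D. \<Sum>k<?D. \<Sum>l<?D. A $$ (k, l) * (test_entry n p l i * test_entry n p i k))"
    by (intro sum.cong refl v) simp
  also have "\<dots> = (\<Sum>k<?D. \<Sum>i<?D. \<Sum>l<?D. A $$ (k, l) * (test_entry n p l i * test_entry n p i k))"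
    by (rule sum.swap)
  also have "\<dots> = (\<Sum>k<?D. \<Sum>l<?D. \<Sum>i<?D. A $$ (k, l) * (test_entry n p l i * test_entry n p i k))"
    by (intro sum.cong refl sum.swap)
  also have "\<dots> = (\<Sum>k<?D. \<Sum>l<?D. 4 ^ n * (A $$ (k, l) * test_entry n p l k))"
    by (intro sum.cong refl) (simp only: sum_distrib_left[symmetric] test_entry_square lessThan_iff mult_ac)
  also have "\<dots> = 4 ^ n * test_value n p A" unfolding test_value_def sum_distrib_left ..
  finally have "Re (\<Sum>i<?D. (A *\<^sub>v v i) \<bullet>c v i) = Re (of_real (4 ^ n) * test_value n p A)" by simp
  then have "4 ^ n * Re (test_value n p A) = (\<Sum>i<?D. Re ((A *\<^sub>v v i) \<bullet>c v i))"
    unfolding Re_sum Re_complex_of_real times_complex.simps by simp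
  also have "\<dots> \<ge> 4 ^ n * 0" unfolding mult_zero_right by (intro sum_nonneg nonneg)
  finally show ?thesis by (rule mult_left_le_imp_le) simp
qed

lemma ket_bra_state:
  assumes "U \<in> carrier_mat (2 ^ n) (2 ^ n)"
  shows "ket_bra (U *\<^sub>v ket0 n) \<in> carrier_mat (2 ^ n) (2 ^ n)"
    "\<And>i j. i < 2 ^ n \<Longrightarrow> j < 2 ^ n \<Longrightarrow> ket_bra (U *\<^sub>v ket0 n) $$ (i, j) = U $$ (i, 0) * cnj (U $$ (j, 0))"
proof -
  note d = carrier_matD[OF assms]
  have v: "vec_index (U *\<^sub>v ket0 n) i = U $$ (i, 0)" if "i < 2 ^ n" for i
    using that by (simp add: ket0_def d)
  show "ket_bra (U *\<^sub>v ket0 n) \<in> carrier_mat (2 ^ n) (2 ^ n)" unfolding ket_bra_def by (simp add: d)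
  show "ket_bra (U *\<^sub>v ket0 n) $$ (i, j) = U $$ (i, 0) * cnj (U $$ (j, 0))" if "i < 2 ^ n" "j < 2 ^ n" for i j
    unfolding ket_bra_def using that by (simp add: d v del: index_mult_mat_vec)
qed

text \<open>The trace of a product of tensor powers is the fourth power of a trace, here of a Pauli
  expectation; \<open>sum_sign_expectation\<close> evaluates the resulting signed sum.\<close>

lemma test_value_state:
  assumes "U \<in> clifford n"
  shows "test_value n p (kron_pow (ket_bra (U *\<^sub>v ket0 n)) 4) = 2 ^ n * of_bool (stabilized n U p)"
proof -
  let ?D = "((2::nat) ^ n) ^ 4" and ?S = "ket_bra (U *\<^sub>v ket0 n)"
  note u = unitary_opD(1)[OF cliffordD[OF assms]]
  note S = ket_bra_state[OF u]
  note P = pauli_string_carrier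
  have e: "(\<Sum>k<?D. \<Sum>l<?D. kron_pow ?S 4 $$ (k, l) * kron_pow (pauli_string n t) 4 $$ (l, k)) = pauli_expectation n U t ^ 4" for t
  proof -
    have "(\<Sum>k<?D. \<Sum>l<?D. kron_pow ?S 4 $$ (k, l) * kron_pow (pauli_string n t) 4 $$ (l, k)) =
        (\<Sum>k<?D. kron_pow (?S * pauli_string n t) 4 $$ (k, k))"
      unfolding kron_pow_mult[OF S(1) P, symmetric]
      by (intro sum.cong refl mat_mult_entry[symmetric, OF kron_pow_carrier[OF S(1)] kron_pow_carrier[OF P]]) simp_all
    also have "\<dots> = (\<Sum>i<2^n. (?S * pauli_string n t) $$ (i, i)) ^ 4"
      by (rule kron_pow_trace[OF mult_carrier_mat[OF S(1) P]])
    also have "(\<Sum>i<2^n. (?S * pauli_string n t) $$ (i, i)) =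
        (\<Sum>i<2^n. \<Sum>j<2^n. cnj (U $$ (j, 0)) * pauli_string n t $$ (j, i) * U $$ (i, 0))"
      by (intro sum.cong refl, subst mat_mult_entry[OF S(1) P]) (auto simp: S(2) mult_ac intro!: sum.cong)
    also have "\<dots> = pauli_expectation n U t" unfolding pauli_expectation_def by (rule sum.swap)
    finally show ?thesis .
  qed
  have "test_value n p (kron_pow ?S 4) =
      (\<Sum>k<?D. \<Sum>l<?D. \<Sum>t\<in>strings n. string_sign n p t * (kron_pow ?S 4 $$ (k, l) * kron_pow (pauli_string n t) 4 $$ (l, k)))"
    unfolding test_value_def test_entry_def sum_distrib_left by (intro sum.cong refl) (simp only: mult_ac)
  also have "\<dots> = (\<Sum>k<?D. \<Sum>t\<in>strings n. \<Sum>l<?D. string_sign n p t * (kron_pow ?S 4 $$ (k, l) * kron_pow (pauli_string n t) 4 $$ (l, k)))"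
    by (intro sum.cong refl sum.swap)
  also have "\<dots> = (\<Sum>t\<in>strings n. \<Sum>k<?D. \<Sum>l<?D. string_sign n p t * (kron_pow ?S 4 $$ (k, l) * kron_pow (pauli_string n t) 4 $$ (l, k)))"
    by (rule sum.swap)
  also have "\<dots> = (\<Sum>t\<in>strings n. string_sign n p t * pauli_expectation n U t ^ 4)"
    unfolding sum_distrib_left[symmetric] e ..
  finally show ?thesis unfolding sum_sign_expectation[OF assms] .
qed

section \<open>Expected test values and the design inequalities\<close>

lemma state_entry_bounded:
  assumes "U \<in> clifford n" "k < (2 ^ n) ^ 4" "l < (2 ^ n) ^ 4"
  shows "cmod (kron_pow (ket_bra (U *\<^sub>v ket0 n)) 4 $$ (k, l)) \<le> 1"
proof -
  note u = unitary_opD[OF cliffordD[OF assms(1)]]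
  have 0: "0 < (2::nat) ^ n" by simp
  have "(\<Sum>i<2^n. cnj (U $$ (i, 0)) * U $$ (i, 0)) = (mat_adjoint U * U) $$ (0, 0)"
    unfolding mat_mult_entry[OF u(2,1) 0 0]
    by (rule sum.cong[OF refl]) (simp only: lessThan_iff mat_adjoint_entry[OF u(1) 0])
  also have "\<dots> = 1" unfolding u(4) by simp
  finally have "of_real (\<Sum>i<2^n. (cmod (U $$ (i, 0)))\<^sup>2) = (1 :: complex)"
    unfolding of_real_sum complex_norm_square by (simp only: mult.commute)
  then have s: "(\<Sum>i<2^n. (cmod (U $$ (i, 0)))\<^sup>2) = 1" by (simp only: of_real_eq_1_iff)
  have "cmod (U $$ (i, 0)) \<le> 1" if "i < 2 ^ n" for i
  proof -
    have "(cmod (U $$ (i, 0)))\<^sup>2 \<le> (\<Sum>i<2^n. (cmod (U $$ (i, 0)))\<^sup>2)"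
      using that by (intro member_le_sum) auto
    then show ?thesis unfolding s by (simp add: abs_square_le_1)
  qed
  then show ?thesis
    by (intro kron_pow_bounded[OF ket_bra_state(1)[OF u(1)] _ assms(2,3)])
       (simp add: ket_bra_state(2)[OF u(1)] norm_mult mult_le_one)
qed

text \<open>The test value is linear, so it passes under the integral once the entries are
  integrable; they are bounded by 1 almost surely. Measurability is assumed in a form that fits both
  the Clifford distribution and an ensemble of circuits.\<close>

lemma test_value_moment:
  fixes X :: "'a \<Rightarrow> complex mat"
  assumes "prob_space M"
    and meas: "\<And>k l. k < (2 ^ n) ^ 4 \<Longrightarrow> l < (2 ^ n) ^ 4 \<Longrightarrow>
      (\<lambda>\<omega>. kron_pow (ket_bra (X \<omega> *\<^sub>v ket0 n)) 4 $$ (k, l)) \<in> borel_measurable M"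
    and sets: "{\<omega> \<in> space M. stabilized n (X \<omega>) p} \<in> sets M"
    and AE: "AE \<omega> in M. X \<omega> \<in> clifford n"
  shows "test_value n p (state_moment n 4 M (\<lambda>\<omega>. X \<omega> *\<^sub>v ket0 n)) =
    of_real (2 ^ n * measure M {\<omega> \<in> space M. stabilized n (X \<omega>) p})"
proof -
  interpret prob_space M by fact
  let ?D = "((2::nat) ^ n) ^ 4" and ?S = "{\<omega> \<in> space M. stabilized n (X \<omega>) p}"
  let ?K = "\<lambda>\<omega>. kron_pow (ket_bra (X \<omega> *\<^sub>v ket0 n)) 4"
  have int: "integrable M (\<lambda>\<omega>. ?K \<omega> $$ (k, l))" if "k < ?D" "l < ?D" for k l
  proof (rule integrable_const_bound[where B = 1])
    show "AE \<omega> in M. norm (?K \<omega> $$ (k, l)) \<le> 1"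
      using AE by eventually_elim (rule state_entry_bounded[OF _ that])
  qed (rule meas[OF that])
  have "test_value n p (state_moment n 4 M (\<lambda>\<omega>. X \<omega> *\<^sub>v ket0 n)) =
      (\<Sum>k<?D. \<Sum>l<?D. (\<integral>\<omega>. ?K \<omega> $$ (k, l) * test_entry n p l k \<partial>M))"
    unfolding test_value_def state_moment_def by (intro sum.cong refl) simp
  also have "\<dots> = (\<Sum>k<?D. (\<integral>\<omega>. (\<Sum>l<?D. ?K \<omega> $$ (k, l) * test_entry n p l k) \<partial>M))"
    by (intro sum.cong refl Bochner_Integration.integral_sum[symmetric] integrable_mult_left int) simp_all
  also have "\<dots> = (\<integral>\<omega>. test_value n p (?K \<omega>) \<partial>M)" unfolding test_value_def
    by (intro Bochner_Integration.integral_sum[symmetric] Bochner_Integration.integrable_sum integrable_mult_left int) simp_all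
  also have "\<dots> = (\<integral>\<omega>. complex_of_real (2 ^ n * indicator ?S \<omega>) \<partial>M)"
  proof (rule integral_cong_AE)
    show "(\<lambda>\<omega>. test_value n p (?K \<omega>)) \<in> borel_measurable M" unfolding test_value_def
      by (intro borel_measurable_sum borel_measurable_times borel_measurable_const meas) simp_all
    show "(\<lambda>\<omega>. complex_of_real (2 ^ n * indicator ?S \<omega>)) \<in> borel_measurable M"
      using sets by measurable
    show "AE \<omega> in M. test_value n p (?K \<omega>) = complex_of_real (2 ^ n * indicator ?S \<omega>)"
      using AE AE_space by eventually_elim (simp add: test_value_state indicator_def)
  qed
  also have "\<dots> = complex_of_real (\<integral>\<omega>. 2 ^ n * indicator ?S \<omega> \<partial>M)" by (rule integral_complex_of_real)
  also have "(\<integral>\<omega>. 2 ^ n * indicator ?S \<omega> \<partial>M) = 2 ^ n * measure M ?S"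
    using sets by (simp add: Int_absorb2 sets.sets_into_space)
  finally show ?thesis .
qed

lemma state_moment_carrier: "state_moment n 4 M \<psi> \<in> carrier_mat ((2 ^ n) ^ 4) ((2 ^ n) ^ 4)"
  unfolding state_moment_def by simp

lemma test_value_diff:
  assumes "A \<in> carrier_mat ((2 ^ n) ^ 4) ((2 ^ n) ^ 4)" "B \<in> carrier_mat ((2 ^ n) ^ 4) ((2 ^ n) ^ 4)"
  shows "test_value n p (a \<cdot>\<^sub>m A - b \<cdot>\<^sub>m B) = a * test_value n p A - b * test_value n p B"
proof -
  note d = carrier_matD[OF assms(1)] carrier_matD[OF assms(2)]
  have "test_value n p (a \<cdot>\<^sub>m A - b \<cdot>\<^sub>m B) = (\<Sum>k<(2^n)^4. \<Sum>l<(2^n)^4.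
      a * (A $$ (k, l) * test_entry n p l k) - b * (B $$ (k, l) * test_entry n p l k))"
    unfolding test_value_def by (intro sum.cong refl) (simp add: d algebra_simps)
  then show ?thesis unfolding test_value_def by (simp only: sum_subtractf sum_distrib_left)
qed

lemma clifford_state_moment_test:
  assumes "\<exists>q<n. p q \<noteq> PI"
  shows "test_value n p (clifford_state_moment n 4) = of_real (2 ^ n / (2 ^ n + 1))"
proof -
  have "test_value n p (clifford_state_moment n 4) = of_real (2 ^ n * measure (measure_pmf (clifford_pmf n))
      {U \<in> space (measure_pmf (clifford_pmf n)). stabilized n U p})"
    unfolding clifford_state_moment_def
    by (rule test_value_moment) (use set_clifford_pmf_subset in \<open>auto simp: AE_measure_pmf_iff prob_space_measure_pmf\<close>)
  then show ?thesis using clifford_pmf_stabilized[OF assms] by simp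
qed

text \<open>The two positive semidefinite differences in the design property have nonnegative test
  values, and each test value is 2^n times a probability.\<close>

lemma design_stabilized_bounds:
  assumes "prob_space M"
    and "\<And>k l. k < (2 ^ n) ^ 4 \<Longrightarrow> l < (2 ^ n) ^ 4 \<Longrightarrow>
      (\<lambda>\<omega>. kron_pow (ket_bra (X \<omega> *\<^sub>v ket0 n)) 4 $$ (k, l)) \<in> borel_measurable M"
    and "{\<omega> \<in> space M. stabilized n (X \<omega>) p} \<in> sets M"
    and "AE \<omega> in M. X \<omega> \<in> clifford n"
    and design: "clifford_state_design \<epsilon> 4 n M (\<lambda>\<omega>. X \<omega> *\<^sub>v ket0 n)"
    and p: "\<exists>q<n. p q \<noteq> PI"
  shows "(1 - \<epsilon>) / (2 ^ n + 1) \<le> measure M {\<omega> \<in> space M. stabilized n (X \<omega>) p}"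
    "measure M {\<omega> \<in> space M. stabilized n (X \<omega>) p} \<le> (1 + \<epsilon>) / (2 ^ n + 1)"
proof -
  let ?E = "state_moment n 4 M (\<lambda>\<omega>. X \<omega> *\<^sub>v ket0 n)" and ?C = "clifford_state_moment n 4"
  let ?m = "measure M {\<omega> \<in> space M. stabilized n (X \<omega>) p}"
  have E: "?E \<in> carrier_mat ((2 ^ n) ^ 4) ((2 ^ n) ^ 4)" by (rule state_moment_carrier)
  have C: "?C \<in> carrier_mat ((2 ^ n) ^ 4) ((2 ^ n) ^ 4)" unfolding clifford_state_moment_def by (rule state_moment_carrier)
  have tE: "test_value n p ?E = of_real (2 ^ n * ?m)" by (rule test_value_moment) fact+
  have tC: "test_value n p ?C = of_real (2 ^ n / (2 ^ n + 1))" by (rule clifford_state_moment_test[OF p])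
  \<comment> \<open>The factor 1 brings both differences into the shape of
    \<open>test_value_diff\<close>.\<close>
  have "psd (1 \<cdot>\<^sub>m ?E - complex_of_real (1 - \<epsilon>) \<cdot>\<^sub>m ?C)" "psd (complex_of_real (1 + \<epsilon>) \<cdot>\<^sub>m ?C - 1 \<cdot>\<^sub>m ?E)"
    using design unfolding clifford_state_design_def loewner_le_def by simp_all
  then have "0 \<le> Re (test_value n p (1 \<cdot>\<^sub>m ?E - complex_of_real (1 - \<epsilon>) \<cdot>\<^sub>m ?C))"
    "0 \<le> Re (test_value n p (complex_of_real (1 + \<epsilon>) \<cdot>\<^sub>m ?C - 1 \<cdot>\<^sub>m ?E))"
    using E C by (auto intro!: test_value_nonneg)
  then have "0 \<le> 2 ^ n * ?m - (1 - \<epsilon>) * (2 ^ n / (2 ^ n + 1))" "0 \<le> (1 + \<epsilon>) * (2 ^ n / (2 ^ n + 1)) - 2 ^ n * ?m"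
    unfolding test_value_diff[OF E C] test_value_diff[OF C E] tE tC by simp_all
  then have b: "2 ^ n * ((1 - \<epsilon>) / (2 ^ n + 1)) \<le> 2 ^ n * ?m" "2 ^ n * ?m \<le> 2 ^ n * ((1 + \<epsilon>) / (2 ^ n + 1))"
    by (simp_all add: mult_ac)
  show "(1 - \<epsilon>) / (2 ^ n + 1) \<le> ?m" by (rule mult_left_le_imp_le[OF b(1)]) simp
  show "?m \<le> (1 + \<epsilon>) / (2 ^ n + 1)" by (rule mult_left_le_imp_le[OF b(2)]) simp
qed

section \<open>Light cones\<close>

definition agree :: "nat \<Rightarrow> nat set \<Rightarrow> nat \<Rightarrow> nat \<Rightarrow> bool" where
  "agree n S i j \<longleftrightarrow> (\<forall>q<n. q \<in> S \<longrightarrow> bit i q = bit j q)"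

lemma agreeI: "(\<And>q. q < n \<Longrightarrow> q \<in> S \<Longrightarrow> bit i q = bit j q) \<Longrightarrow> agree n S i j"
  unfolding agree_def by blast

lemma agreeD: "agree n S i j \<Longrightarrow> q < n \<Longrightarrow> q \<in> S \<Longrightarrow> bit i q = bit j q"
  unfolding agree_def by blast

text \<open>The operators that are a tensor product of some operator on \<open>S\<close> with the
  identity elsewhere, expressed by entries to avoid reordering tensor factors: off \<open>S\<close>
  the entries act as a Kronecker delta, and otherwise only the bits in \<open>S\<close>
  count.\<close>

definition local_on :: "nat \<Rightarrow> nat set \<Rightarrow> complex mat \<Rightarrow> bool" where
  "local_on n S A \<longleftrightarrow> A \<in> carrier_mat (2 ^ n) (2 ^ n) \<and>
     (\<forall>i<2^n. \<forall>j<2^n. \<not> agree n (- S) i j \<longrightarrow> A $$ (i, j) = 0) \<and>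
     (\<forall>i<2^n. \<forall>j<2^n. \<forall>i'<2^n. \<forall>j'<2^n. agree n (- S) i j \<longrightarrow> agree n (- S) i' j' \<longrightarrow>
        agree n S i i' \<longrightarrow> agree n S j j' \<longrightarrow> A $$ (i, j) = A $$ (i', j'))"

lemma local_onD:
  assumes "local_on n S A"
  shows "A \<in> carrier_mat (2 ^ n) (2 ^ n)"
    "\<And>i j. i < 2^n \<Longrightarrow> j < 2^n \<Longrightarrow> \<not> agree n (- S) i j \<Longrightarrow> A $$ (i, j) = 0"
    "\<And>i j i' j'. i < 2^n \<Longrightarrow> j < 2^n \<Longrightarrow> i' < 2^n \<Longrightarrow> j' < 2^n \<Longrightarrow> agree n (- S) i j \<Longrightarrow>
      agree n (- S) i' j' \<Longrightarrow> agree n S i i' \<Longrightarrow> agree n S j j' \<Longrightarrow> A $$ (i, j) = A $$ (i', j')"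
  using assms unfolding local_on_def by blast+

lemma local_onI:
  assumes "A \<in> carrier_mat (2 ^ n) (2 ^ n)"
    "\<And>i j. i < 2^n \<Longrightarrow> j < 2^n \<Longrightarrow> \<not> agree n (- S) i j \<Longrightarrow> A $$ (i, j) = 0"
    "\<And>i j i' j'. i < 2^n \<Longrightarrow> j < 2^n \<Longrightarrow> i' < 2^n \<Longrightarrow> j' < 2^n \<Longrightarrow> agree n (- S) i j \<Longrightarrow>
      agree n (- S) i' j' \<Longrightarrow> agree n S i i' \<Longrightarrow> agree n S j j' \<Longrightarrow> A $$ (i, j) = A $$ (i', j')"
  shows "local_on n S A"
  unfolding local_on_def by (intro conjI allI impI assms)

lemma obtain_bits:
  obtains k :: nat where "k < 2 ^ n" "\<And>q. q < n \<Longrightarrow> bit k q = P q"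
proof
  let ?k = "horner_sum of_bool 2 (map P [0..<n]) :: nat"
  show "?k < 2 ^ n" using horner_sum_of_bool_2_less[of "map P [0..<n]", where ?'a = nat] by simp
  show "bit ?k q = P q" if "q < n" for q using that by (simp add: bit_horner_sum_bit_iff)
qed

text \<open>Only one intermediate index survives: \<open>A\<close> forces it to agree with
  \<open>i\<close> off \<open>S\<close>, and \<open>B\<close> forces it to agree with
  \<open>j\<close> off \<open>T\<close>, in particular on \<open>S\<close>.\<close>

lemma local_on_mult_entry:
  assumes A: "local_on n S A" and B: "local_on n T B" and disj: "S \<inter> T = {}"
    and i: "i < 2 ^ n" and j: "j < 2 ^ n" and k: "k < 2 ^ n"
    and bits: "\<And>q. q < n \<Longrightarrow> bit k q = (if q \<in> S then bit j q else bit i q)"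
  shows "(A * B) $$ (i, j) = A $$ (i, k) * B $$ (k, j)"
proof -
  have "(A * B) $$ (i, j) = (\<Sum>m<2^n. A $$ (i, m) * B $$ (m, j))"
    by (rule mat_mult_entry[OF local_onD(1)[OF A] local_onD(1)[OF B] i j])
  also have "\<dots> = (\<Sum>m<2^n. if m = k then A $$ (i, k) * B $$ (k, j) else 0)"
  proof (rule sum.cong[OF refl])
    fix m assume "m \<in> {..<(2::nat)^n}"
    then have m: "m < 2 ^ n" by simp
    show "A $$ (i, m) * B $$ (m, j) = (if m = k then A $$ (i, k) * B $$ (k, j) else 0)"
    proof (cases "agree n (- S) i m \<and> agree n (- T) m j")
      case True
      then have "\<forall>q<n. bit m q = bit k q" using disj bits unfolding agree_def by auto
      then have "m = k" using bits_eq_iff[OF m k] by blast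
      then show ?thesis by simp
    next
      case False
      then have 0: "A $$ (i, m) * B $$ (m, j) = 0" using local_onD(2)[OF A i m] local_onD(2)[OF B m j] by auto
      then show ?thesis by auto
    qed
  qed
  also have "\<dots> = A $$ (i, k) * B $$ (k, j)" using k by simp
  finally show ?thesis .
qed

lemma local_on_commute:
  assumes A: "local_on n S A" and B: "local_on n T B" and disj: "S \<inter> T = {}"
  shows "A * B = B * A"
proof (rule eq_matI)
  note cA = local_onD(1)[OF A] and cB = local_onD(1)[OF B]
  fix i j assume "i < dim_row (B * A)" "j < dim_col (B * A)"
  then have i: "i < 2 ^ n" and j: "j < 2 ^ n" using carrier_matD[OF cA] carrier_matD[OF cB] by simp_all
  obtain k :: nat where k: "k < 2 ^ n" "\<And>q. q < n \<Longrightarrow> bit k q = (if q \<in> S then bit j q else bit i q)"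
    using obtain_bits[of n "\<lambda>q. if q \<in> S then bit j q else bit i q"] by blast
  obtain m :: nat where m: "m < 2 ^ n" "\<And>q. q < n \<Longrightarrow> bit m q = (if q \<in> T then bit j q else bit i q)"
    using obtain_bits[of n "\<lambda>q. if q \<in> T then bit j q else bit i q"] by blast
  have AB: "(A * B) $$ (i, j) = A $$ (i, k) * B $$ (k, j)" by (rule local_on_mult_entry[OF A B disj i j k])
  have BA: "(B * A) $$ (i, j) = B $$ (i, m) * A $$ (m, j)"
    by (rule local_on_mult_entry[OF B A _ i j m]) (use disj in blast)
  show "(A * B) $$ (i, j) = (B * A) $$ (i, j)"
  \<comment> \<open>If the indices agree off both supports, the two single-term products have the
    same factors in exchanged order; otherwise both vanish.\<close>
  proof (cases "agree n (- (S \<union> T)) i j")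
    case True
    have "A $$ (i, k) = A $$ (m, j)"
      by (rule local_onD(3)[OF A i k(1) m(1) j]; rule agreeI) (use agreeD[OF True] disj in \<open>auto simp: k(2) m(2)\<close>)
    moreover have "B $$ (k, j) = B $$ (i, m)"
      by (rule local_onD(3)[OF B k(1) j i m(1)]; rule agreeI) (use agreeD[OF True] disj in \<open>auto simp: k(2) m(2)\<close>)
    ultimately show ?thesis unfolding AB BA by (simp only: mult.commute)
  next
    case False
    then obtain q where q: "q < n" "q \<notin> S" "q \<notin> T" "bit i q \<noteq> bit j q" unfolding agree_def by blast
    have "\<not> agree n (- T) k j" "\<not> agree n (- S) m j"
      using agreeD[of n "- T" k j q] agreeD[of n "- S" m j q] q by (auto simp: k(2) m(2))
    then have "B $$ (k, j) = 0" "A $$ (m, j) = 0"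
      using local_onD(2)[OF B k(1) j] local_onD(2)[OF A m(1) j] by blast+
    then show ?thesis unfolding AB BA by simp
  qed
qed (use carrier_matD[OF local_onD(1)[OF A]] carrier_matD[OF local_onD(1)[OF B]] in simp_all)

text \<open>The new case is a disagreement on \<open>T - S\<close>: the primed indices then disagree
  at the same qubit, so both entries vanish.\<close>

lemma local_on_mono:
  assumes A: "local_on n S A" and "S \<subseteq> T" shows "local_on n T A"
proof -
  note d = local_onD[OF A]
  have "A $$ (i, j) = A $$ (i', j')"
    if b: "i < 2^n" "j < 2^n" "i' < 2^n" "j' < 2^n"
      and a: "agree n (- T) i j" "agree n (- T) i' j'" "agree n T i i'" "agree n T j j'" for i j i' j'
  proof (cases "agree n (- S) i j")
    case True
    moreover have "agree n (- S) i' j'"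
    proof (rule agreeI)
      fix q assume q: "q < n" "q \<in> - S"
      show "bit i' q = bit j' q"
      proof (cases "q \<in> T")
        case True
        then show ?thesis using agreeD[OF a(3) q(1)] agreeD[OF a(4) q(1)] agreeD[OF \<open>agree n (- S) i j\<close> q] by simp
      qed (use agreeD[OF a(2) q(1)] in simp)
    qed
    moreover have "agree n S i i'" "agree n S j j'"
      using agreeD[OF a(3)] agreeD[OF a(4)] assms(2) by (auto intro!: agreeI)
    ultimately show ?thesis by (rule d(3)[OF b])
  next
    case False
    then obtain q where q: "q < n" "q \<notin> S" "bit i q \<noteq> bit j q" unfolding agree_def by auto
    have "bit i' q \<noteq> bit j' q"
    proof (cases "q \<in> T")
      case True
      then show ?thesis using agreeD[OF a(3) q(1)] agreeD[OF a(4) q(1)] q(3) by simp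
    qed (use agreeD[OF a(1) q(1)] q(3) in simp)
    then have "\<not> agree n (- S) i' j'" using q agreeD[of n "- S" i' j' q] by auto
    then show ?thesis using False d(2) b by simp
  qed
  moreover have "A $$ (i, j) = 0" if "i < 2^n" "j < 2^n" "\<not> agree n (- T) i j" for i j
    using that(3) assms(2) by (intro d(2) that(1,2)) (auto simp: agree_def)
  ultimately show ?thesis by (intro local_onI d(1))
qed

lemma pauli_string_local:
  assumes "\<And>q. q < n \<Longrightarrow> q \<notin> S \<Longrightarrow> p q = PI" shows "local_on n S (pauli_string n p)"
proof -
  have "pauli_string n p $$ (i, j) = 0" if b: "i < 2^n" "j < 2^n" and differ: "\<not> agree n (- S) i j" for i j
  proof -
    obtain q where q: "q < n" "q \<notin> S" "bit i q \<noteq> bit j q" using differ unfolding agree_def by auto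
    then have "pauli_entry (p q) (bit i q) (bit j q) = 0" using assms by simp
    then show ?thesis unfolding pauli_string_entry[OF b] using q(1) by (intro prod_zero) auto
  qed
  moreover have "pauli_string n p $$ (i, j) = pauli_string n p $$ (i', j')"
    if b: "i < 2^n" "j < 2^n" "i' < 2^n" "j' < 2^n"
      and a: "agree n (- S) i j" "agree n (- S) i' j'" "agree n S i i'" "agree n S j j'" for i j i' j'
    unfolding pauli_string_entry[OF b(1,2)] pauli_string_entry[OF b(3,4)]
  proof (rule prod.cong[OF refl])
    fix q assume q: "q \<in> {..<n}"
    show "pauli_entry (p q) (bit i q) (bit j q) = pauli_entry (p q) (bit i' q) (bit j' q)"
      using a q assms[of q] unfolding agree_def by (cases "q \<in> S") auto
  qed
  ultimately show ?thesis by (intro local_onI pauli_string_carrier)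
qed

lemma gate_op_carrier: "gate_op n g \<in> carrier_mat (2 ^ n) (2 ^ n)"
  unfolding gate_op_def by simp

lemma gate_op_local:
  assumes "fst g \<subseteq> {..<n}" shows "local_on n (fst g) (gate_op n g)"
proof -
  have s: "sub_index (fst g) i = sub_index (fst g) i'" if "agree n (fst g) i i'" for i i'
    unfolding sub_index_def by (rule sum.cong) (use that assms in \<open>auto simp: agree_def\<close>)
  have e: "gate_op n g $$ (i, j) = (if agree n (- fst g) i j then snd g $$ (sub_index (fst g) i, sub_index (fst g) j) else 0)"
    if "i < 2^n" "j < 2^n" for i j
    unfolding gate_op_def agree_def using that by auto
  have "gate_op n g $$ (i, j) = gate_op n g $$ (i', j')"
    if b: "i < 2^n" "j < 2^n" "i' < 2^n" "j' < 2^n"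
      and a: "agree n (- fst g) i j" "agree n (- fst g) i' j'" "agree n (fst g) i i'" "agree n (fst g) j j'" for i j i' j'
    unfolding e[OF b(1,2)] e[OF b(3,4)] s[OF a(3)] s[OF a(4)] using a(1,2) by simp
  moreover have "gate_op n g $$ (i, j) = 0" if "i < 2^n" "j < 2^n" "\<not> agree n (- fst g) i j" for i j
    using that by (simp only: e if_False)
  ultimately show ?thesis by (intro local_onI gate_op_carrier)
qed

text \<open>Support in the Heisenberg picture, phrased as a commutant so that it is stable under products.\<close>

definition confined :: "nat \<Rightarrow> nat set \<Rightarrow> complex mat \<Rightarrow> bool" where
  "confined n S A \<longleftrightarrow> A \<in> carrier_mat (2 ^ n) (2 ^ n) \<and> (\<forall>B. local_on n (- S) B \<longrightarrow> A * B = B * A)"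

lemma confined_mono: "confined n S A \<Longrightarrow> S \<subseteq> T \<Longrightarrow> confined n T A"
  unfolding confined_def using local_on_mono[of n "- T" _ "- S"] by blast

lemma local_on_confined: "local_on n S A \<Longrightarrow> confined n S A"
  unfolding confined_def using local_on_commute[of n S A "- S"] local_onD(1) by auto

lemma invertible_of_det:
  assumes "A \<in> carrier_mat N N" "Determinant.det A \<noteq> (0 :: complex)"
  obtains B where "B \<in> carrier_mat N N" "A * B = 1\<^sub>m N" "B * A = 1\<^sub>m N"
  using det_non_zero_imp_unit[OF assms] unfolding Units_def ring_mat_def by auto

text \<open>If the gate lies off \<open>S\<close>, it commutes with \<open>A\<close>, and
  \<open>A\<close> itself serves. If it lies inside, its inverse also commutes with everything local
  off \<open>S\<close>, so the conjugate of \<open>A\<close> stays in the commutant. The form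
  \<open>A * g = g * A'\<close> chains through products, and invertibility is taken from
  determinants because they factor over a circuit.\<close>

lemma confined_conjugate:
  assumes A: "confined n S A" and g: "local_on n a g" and det: "Determinant.det g \<noteq> 0"
    and a: "a \<subseteq> S \<or> a \<inter> S = {}"
  obtains A' where "confined n S A'" "A * g = g * A'"
proof (cases "a \<subseteq> S")
  case False
  then have "local_on n (- S) g" using a by (intro local_on_mono[OF g]) blast
  then have "A * g = g * A" using A unfolding confined_def by blast
  then show thesis using that A by blast
next
  case True
  note gc = local_onD(1)[OF g]
  have Ac: "A \<in> carrier_mat (2 ^ n) (2 ^ n)" using A unfolding confined_def by blast
  obtain h where h: "h \<in> carrier_mat (2 ^ n) (2 ^ n)" "g * h = 1\<^sub>m (2 ^ n)" "h * g = 1\<^sub>m (2 ^ n)"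
    by (rule invertible_of_det[OF gc det])
  note hA = mult_carrier_mat[OF h(1) Ac]
  have 1: "g * (h * A * g) = A * g"
    unfolding assoc_mult_mat[OF gc hA gc, symmetric] assoc_mult_mat[OF gc h(1) Ac, symmetric] h(2)
      left_mult_one_mat[OF Ac] ..
  have "h * A * g * B = B * (h * A * g)" if B: "local_on n (- S) B" for B
  proof -
    note Bc = local_onD(1)[OF B]
    have gB: "g * B = B * g" by (rule local_on_commute[OF g B]) (use True in blast)
    have AB: "A * B = B * A" using A B unfolding confined_def by blast
    \<comment> \<open>Inserting \<open>g * h\<close> transfers the commutation from \<open>g\<close>
      to its inverse.\<close>
    have "h * B = h * (B * (g * h))" unfolding h(2) right_mult_one_mat[OF Bc] ..
    also have "\<dots> = h * (g * B * h)" unfolding gB assoc_mult_mat[OF Bc gc h(1)] ..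
    also have "\<dots> = (h * g) * (B * h)"
      unfolding assoc_mult_mat[OF gc Bc h(1)] assoc_mult_mat[OF h(1) gc mult_carrier_mat[OF Bc h(1)]] ..
    also have "\<dots> = B * h" unfolding h(3) by (rule left_mult_one_mat[OF mult_carrier_mat[OF Bc h(1)]])
    finally have hB: "h * B = B * h" .
    have "h * A * g * B = h * A * (B * g)" unfolding assoc_mult_mat[OF hA gc Bc] gB ..
    also have "\<dots> = h * (A * B) * g" by (rule mult_four_mat[OF h(1) Ac Bc gc])
    also have "\<dots> = (h * B) * A * g" unfolding AB assoc_mult_mat[OF h(1) Bc Ac] ..
    also have "\<dots> = B * (h * A * g)"
      unfolding hB assoc_mult_mat[OF Bc h(1) Ac] assoc_mult_mat[OF Bc hA gc] ..
    finally show ?thesis .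
  qed
  then have "confined n S (h * A * g)" unfolding confined_def using mult_carrier_mat[OF hA gc] by blast
  then show thesis using that 1 by metis
qed

lemma layer_op_carrier: "layer_op n l \<in> carrier_mat (2 ^ n) (2 ^ n)"
  by (induction l) (auto intro: mult_carrier_mat[OF _ gate_op_carrier])

lemma circuit_op_carrier: "circuit_op n C \<in> carrier_mat (2 ^ n) (2 ^ n)"
  by (induction C) (auto intro: mult_carrier_mat[OF _ layer_op_carrier])

lemma confined_layer:
  assumes "confined n S A" "Determinant.det (layer_op n l) \<noteq> 0"
    and "\<And>g. g \<in> set l \<Longrightarrow> fst g \<subseteq> {..<n} \<and> (fst g \<subseteq> S \<or> fst g \<inter> S = {})"
  shows "\<exists>A'. confined n S A' \<and> A * layer_op n l = layer_op n l * A'"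
  using assms
proof (induction l arbitrary: A)
  case Nil
  have "A \<in> carrier_mat (2 ^ n) (2 ^ n)" using Nil.prems(1) unfolding confined_def by blast
  then show ?case using Nil.prems(1) by (intro exI[of _ A]) simp
next
  case (Cons g l)
  let ?L = "layer_op n l" and ?g = "gate_op n g"
  have cA: "A \<in> carrier_mat (2 ^ n) (2 ^ n)" using Cons.prems(1) unfolding confined_def by blast
  have det: "Determinant.det ?L \<noteq> 0" "Determinant.det ?g \<noteq> 0"
    using Cons.prems(2) det_mult[OF layer_op_carrier gate_op_carrier, of n l g] by auto
  have "\<exists>A'. confined n S A' \<and> A * ?L = ?L * A'"
    by (rule Cons.IH[OF Cons.prems(1) det(1)]) (rule Cons.prems(3), simp)
  then obtain A' where A': "confined n S A'" "A * ?L = ?L * A'" by blast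
  have g: "fst g \<subseteq> {..<n}" "fst g \<subseteq> S \<or> fst g \<inter> S = {}" using Cons.prems(3)[of g] by simp_all
  obtain A'' where A'': "confined n S A''" "A' * ?g = ?g * A''"
    by (rule confined_conjugate[OF A'(1) gate_op_local[OF g(1)] det(2) g(2)])
  have c: "A' \<in> carrier_mat (2 ^ n) (2 ^ n)" "A'' \<in> carrier_mat (2 ^ n) (2 ^ n)"
    using A'(1) A''(1) unfolding confined_def by blast+
  have "A * (?L * ?g) = ?L * ?g * A''"
    unfolding assoc_mult_mat[OF cA layer_op_carrier gate_op_carrier, symmetric] A'(2)
      assoc_mult_mat[OF layer_op_carrier c(1) gate_op_carrier] A''(2)
      assoc_mult_mat[OF layer_op_carrier gate_op_carrier c(2)] ..
  then show ?case using A''(1) by auto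
qed

definition ball_around :: "(nat \<times> nat) set \<Rightarrow> nat set \<Rightarrow> nat \<Rightarrow> nat set" where
  "ball_around G X k = {y. \<exists>x\<in>X. \<exists>j\<le>k. (x, y) \<in> G ^^ j}"

lemma ball_around_0 [simp]: "ball_around G X 0 = X"
  unfolding ball_around_def by auto

text \<open>The origin of the constant \<open>r * r\<close>: a connection inside the support can be
  shortened to at most as many steps as there are edges in it, hence to at most the number of pairs
  of its qubits.\<close>

lemma local_support_diameter:
  assumes "local_support n G r a" "y \<in> a" "z \<in> a"
  shows "\<exists>j\<le>r*r. (y, z) \<in> G ^^ j"
proof -
  have a: "a \<subseteq> {..<n}" "card a \<le> r" "connected_in G a" using assms(1) unfolding local_support_def by auto
  have fin: "finite a" using a(1) by (rule finite_subset) simp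
  let ?R = "G \<inter> a \<times> a"
  have finR: "finite ?R" using fin by simp
  have "card ?R \<le> card (a \<times> a)" by (rule card_mono) (use fin in auto)
  also have "\<dots> \<le> r * r" unfolding card_cartesian_product using a(2) by (intro mult_le_mono)
  finally have cR: "card ?R \<le> r * r" .
  have "(y, z) \<in> ?R\<^sup>*" using a(3) assms(2,3) unfolding connected_in_def by blast
  then obtain j where j: "j \<le> card ?R" "(y, z) \<in> ?R ^^ j" unfolding rtrancl_finite_eq_relpow[OF finR] by auto
  have "?R ^^ j \<subseteq> G ^^ j" by (induction j) auto
  then show ?thesis using j cR by (intro exI[of _ j]) auto
qed

lemma ball_around_step:
  assumes "y \<in> ball_around G X k" "\<exists>j\<le>m. (y, z) \<in> G ^^ j"
  shows "z \<in> ball_around G X (k + m)"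
proof -
  obtain x j where x: "x \<in> X" "j \<le> k" "(x, y) \<in> G ^^ j" using assms(1) unfolding ball_around_def by blast
  obtain j' where j': "j' \<le> m" "(y, z) \<in> G ^^ j'" using assms(2) by blast
  have "(x, z) \<in> G ^^ (j + j')" unfolding relpow_add using x(3) j'(2) by blast
  then show ?thesis unfolding ball_around_def using x j' by (auto intro!: bexI[of _ x] exI[of _ "j + j'"])
qed

lemma ball_around_mono: "k \<le> k' \<Longrightarrow> ball_around G X k \<subseteq> ball_around G X k'"
  unfolding ball_around_def by (auto intro: order_trans)

text \<open>Pulling back meets the last layer first, which is why the tail of the list is handled by
  the induction hypothesis before its head \<open>l\<close>. Each layer widens the ball by
  \<open>r * r\<close>.\<close>

lemma confined_circuit:
  assumes "confined n (ball_around G X k) A" "Determinant.det (circuit_op n C) \<noteq> 0" "circuit n G r C"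
  shows "\<exists>A'. confined n (ball_around G X (k + length C * (r * r))) A' \<and> A * circuit_op n C = circuit_op n C * A'"
  using assms
proof (induction C)
  case Nil
  have "A \<in> carrier_mat (2 ^ n) (2 ^ n)" using Nil.prems(1) unfolding confined_def by blast
  then show ?case using Nil.prems(1) by (intro exI[of _ A]) simp
next
  case (Cons l C)
  let ?C = "circuit_op n C" and ?l = "layer_op n l"
  let ?S = "ball_around G X (k + length C * (r * r))"
  have cA: "A \<in> carrier_mat (2 ^ n) (2 ^ n)" using Cons.prems(1) unfolding confined_def by blast
  have det: "Determinant.det ?C \<noteq> 0" "Determinant.det ?l \<noteq> 0"
    using Cons.prems(2) det_mult[OF circuit_op_carrier layer_op_carrier, of n C l] by auto
  have lay: "layer n G r l" "circuit n G r C" using Cons.prems(3) unfolding circuit_def by simp_all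
  obtain A' where A': "confined n ?S A'" "A * ?C = ?C * A'"
    using Cons.IH[OF Cons.prems(1) det(1) lay(2)] by blast
  \<comment> \<open>All gates of the layer that meet the ball are added, so that no gate straddles
    the boundary of \<open>S\<close>.\<close>
  define S where "S = ?S \<union> \<Union>{a \<in> fst ` set l. a \<inter> ?S \<noteq> {}}"
  have sup: "local_support n G r (fst g)" if "g \<in> set l" for g
    using lay(1) that unfolding layer_def by auto
  have disj: "fst g = fst h \<or> fst g \<inter> fst h = {}" if gh: "g \<in> set l" "h \<in> set l" for g h
  proof -
    obtain i j where "i < length l" "g = l ! i" "j < length l" "h = l ! j" using gh by (auto simp: in_set_conv_nth)
    then show ?thesis using lay(1) unfolding layer_def sorted_wrt_iff_nth_less
      by (cases i j rule: linorder_cases) blast+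
  qed
  have gates: "fst g \<subseteq> {..<n} \<and> (fst g \<subseteq> S \<or> fst g \<inter> S = {})" if g: "g \<in> set l" for g
  proof (cases "fst g \<inter> ?S = {}")
    case True
    have "fst g \<inter> S = {}"
    proof (rule ccontr)
      assume "fst g \<inter> S \<noteq> {}"
      then obtain h where h: "h \<in> set l" "fst h \<inter> ?S \<noteq> {}" "fst g \<inter> fst h \<noteq> {}" using True unfolding S_def by blast
      then show False using disj[OF g h(1)] True by auto
    qed
    then show ?thesis using sup[OF g] unfolding local_support_def by blast
  next
    case False
    then have "fst g \<subseteq> S" unfolding S_def using g by blast
    then show ?thesis using sup[OF g] unfolding local_support_def by blast
  qed
  have SS: "S \<subseteq> ball_around G X (k + length (l # C) * (r * r))"
  proof
    fix z assume "z \<in> S"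
    then consider "z \<in> ?S" | g y where "g \<in> set l" "y \<in> fst g" "y \<in> ?S" "z \<in> fst g" unfolding S_def by blast
    then show "z \<in> ball_around G X (k + length (l # C) * (r * r))"
    proof cases
      case 1
      then show ?thesis using ball_around_mono[of "k + length C * (r * r)" "k + length (l # C) * (r * r)"] by auto
    next
      case 2
      have "z \<in> ball_around G X (k + length C * (r * r) + r * r)"
        by (rule ball_around_step[OF 2(3) local_support_diameter[OF sup[OF 2(1)] 2(2,4)]])
      then show ?thesis by (simp add: algebra_simps)
    qed
  qed
  have "confined n S A'" by (rule confined_mono[OF A'(1)]) (simp add: S_def)
  then obtain A'' where A'': "confined n S A''" "A' * ?l = ?l * A''"
    using confined_layer[OF _ det(2) gates] by blast
  have c: "A' \<in> carrier_mat (2 ^ n) (2 ^ n)" "A'' \<in> carrier_mat (2 ^ n) (2 ^ n)"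
    using A'(1) A''(1) unfolding confined_def by blast+
  have "A * (?C * ?l) = ?C * ?l * A''"
    unfolding assoc_mult_mat[OF cA circuit_op_carrier layer_op_carrier, symmetric] A'(2)
      assoc_mult_mat[OF circuit_op_carrier c(1) layer_op_carrier] A''(2)
      assoc_mult_mat[OF circuit_op_carrier layer_op_carrier c(2)] ..
  then show ?case using confined_mono[OF A''(1) SS] by auto
qed

text \<open>A nontrivial letter at \<open>q\<close> would anticommute with some Pauli on qubit
  \<open>q\<close> alone, whereas the pulled-back operator, confined to the light cone, commutes
  with everything local outside it.\<close>

lemma pullback_support:
  assumes U: "circuit_op n C \<in> clifford n" and C: "circuit n G r C"
    and p: "\<And>q. q < n \<Longrightarrow> q \<notin> X \<Longrightarrow> p q = PI"
    and q: "q < n" "q \<notin> ball_around G X (length C * (r * r))"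
  shows "pullback n (circuit_op n C) p q = PI"
proof (rule ccontr)
  let ?U = "circuit_op n C" and ?r = "pullback n (circuit_op n C) p"
  note u = unitary_opD[OF cliffordD[OF U]]
  assume "?r q \<noteq> PI"
  then obtain a where a: "pauli_sign (?r q) a = -1" using pauli_common_anticommuting by blast
  have "Determinant.det ?U * Determinant.det (mat_adjoint ?U) = 1"
    using det_mult[OF u(1,2)] unfolding u(3) by simp
  then have det: "Determinant.det ?U \<noteq> 0" by auto
  have "confined n (ball_around G X 0) (pauli_string n p)"
    unfolding ball_around_0 by (intro local_on_confined pauli_string_local p)
  then obtain A where A: "confined n (ball_around G X (length C * (r * r))) A" "pauli_string n p * ?U = ?U * A"
    using confined_circuit[OF _ det C, of X 0] by auto
  have cA: "A \<in> carrier_mat (2 ^ n) (2 ^ n)" using A(1) unfolding confined_def by blast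
  have "conjugate_by ?U (pauli_string n p) = (mat_adjoint ?U * ?U) * A"
    unfolding conjugate_by_def assoc_mult_mat[OF u(2) pauli_string_carrier u(1)] A(2) assoc_mult_mat[OF u(2,1) cA] ..
  then have conj: "conjugate_by ?U (pauli_string n p) = A" unfolding u(4) left_mult_one_mat[OF cA] .
  obtain c where c: "c ^ 4 = 1" "conjugate_by ?U (pauli_string n p) = c \<cdot>\<^sub>m pauli_string n ?r"
    by (rule pullback[OF U])
  let ?R = "pauli_string n ?r" and ?B = "pauli_string n (single_string n q a)"
  have "local_on n (- ball_around G X (length C * (r * r))) ?B"
    by (rule pauli_string_local) (use q in \<open>auto simp: single_string_def\<close>)
  then have "A * ?B = ?B * A" using A(1) unfolding confined_def by blast
  then have "c \<cdot>\<^sub>m (?R * ?B) = c \<cdot>\<^sub>m (?B * ?R)"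
    unfolding conj[symmetric] c(2) mult_smult_assoc_mat[OF pauli_string_carrier pauli_string_carrier]
      mult_smult_distrib[OF pauli_string_carrier pauli_string_carrier] .
  then have "(c * (-1)) \<cdot>\<^sub>m (?B * ?R) = c \<cdot>\<^sub>m (?B * ?R)"
    unfolding pauli_string_commute[of n ?r] string_sign_single[OF q(1)] a smult_smult_mat .
  then have "c * (-1) = c"
    by (rule smult_cancel_invertible[OF _ pauli_string_pair_inverse]) (auto intro: mult_carrier_mat)
  then show False using power4_nonzero[OF c(1)] by simp
qed

text \<open>With disjoint supports, every letter of one pulled-back string appears unchanged in the
  product, so a diagonal product has diagonal factors.\<close>

lemma stabilized_disjoint_product:
  assumes U: "U \<in> clifford n"
    and disj: "\<And>q. q < n \<Longrightarrow> pullback n U p q = PI \<or> pullback n U p' q = PI"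
    and s: "stabilized n U (string_prod n p p')"
  shows "stabilized n U p" "stabilized n U p'"
proof -
  have "z_type n (string_prod n (pullback n U p) (pullback n U p'))"
    using s unfolding stabilized_clifford(1)[OF U] pullback_string_prod[OF U] .
  then have z: "pauli_prod (pullback n U p q) (pullback n U p' q) \<in> {PI, PZ}" if "q < n" for q
    using that unfolding z_type_def string_prod_def by simp
  have "pullback n U p q \<in> {PI, PZ} \<and> pullback n U p' q \<in> {PI, PZ}" if "q < n" for q
    using z[OF that] disj[OF that] by auto
  then show "stabilized n U p" "stabilized n U p'" unfolding stabilized_clifford(1)[OF U] z_type_def by blast+
qed

text \<open>Stabilizing strings pull back to diagonal ones, which commute, and pulling back
  preserves commutation signs.\<close>

lemma stabilized_anticommuting:
  assumes U: "U \<in> clifford n" and s: "string_sign n p p' = -1"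
  shows "\<not> (stabilized n U p \<and> stabilized n U p')"
proof
  assume "stabilized n U p \<and> stabilized n U p'"
  then have z: "z_type n (pullback n U p)" "z_type n (pullback n U p')" unfolding stabilized_clifford(1)[OF U] by blast+
  have "string_sign n (pullback n U p) (pullback n U p') = 1"
    unfolding string_sign_def
  proof (rule prod.neutral, rule ballI)
    fix q assume "q \<in> {..<n}"
    then have "pullback n U p q = PI \<or> pullback n U p q = PZ" "pullback n U p' q = PI \<or> pullback n U p' q = PZ"
      using z unfolding z_type_def by simp_all
    then show "pauli_sign (pullback n U p q) (pullback n U p' q) = 1" unfolding pauli_sign_def by metis
  qed
  then show False using s unfolding pullback_string_sign[OF U] by simp
qed

section \<open>Ensembles of circuits\<close>

lemma ensemble_expectation_measurable:
  assumes "clifford_circuit_ensemble n G r d E"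
  shows "(\<lambda>C. pauli_expectation n (circuit_op n C) p) \<in> borel_measurable E"
proof -
  have m: "(\<lambda>C. circuit_op n C $$ (i, j)) \<in> borel_measurable E" if "i < 2 ^ n" "j < 2 ^ n" for i j
    using assms that unfolding clifford_circuit_ensemble_def by blast
  have c: "(\<lambda>C. cnj (circuit_op n C $$ (i, j))) \<in> borel_measurable E" if "i < 2 ^ n" "j < 2 ^ n" for i j
    by (rule borel_measurable_continuous_on[OF _ m[OF that]]) (intro continuous_intros)
  show ?thesis unfolding pauli_expectation_def
    by (intro borel_measurable_sum borel_measurable_times borel_measurable_const m c) simp_all
qed

lemma ensemble_stabilized_sets:
  assumes "clifford_circuit_ensemble n G r d E"
  shows "{C \<in> space E. stabilized n (circuit_op n C) p} \<in> sets E"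
proof -
  have "(\<lambda>C. pauli_expectation n (circuit_op n C) p) -` (- {0}) \<inter> space E \<in> sets E"
    by (rule measurable_sets[OF ensemble_expectation_measurable[OF assms]]) simp
  also have "(\<lambda>C. pauli_expectation n (circuit_op n C) p) -` (- {0}) \<inter> space E =
      {C \<in> space E. stabilized n (circuit_op n C) p}"
    unfolding stabilized_def by auto
  finally show ?thesis .
qed

lemma ensemble_bounds:
  assumes E: "clifford_circuit_ensemble n G r d E"
    and design: "clifford_state_design \<epsilon> 4 n E (\<lambda>C. circuit_op n C *\<^sub>v ket0 n)"
    and p: "\<exists>q<n. p q \<noteq> PI"
  shows "(1 - \<epsilon>) / (2 ^ n + 1) \<le> measure E {C \<in> space E. stabilized n (circuit_op n C) p}"
    "measure E {C \<in> space E. stabilized n (circuit_op n C) p} \<le> (1 + \<epsilon>) / (2 ^ n + 1)"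
proof -
  have m: "(\<lambda>C. circuit_op n C $$ (i, j)) \<in> borel_measurable E" if "i < 2 ^ n" "j < 2 ^ n" for i j
    using E that unfolding clifford_circuit_ensemble_def by blast
  have c: "(\<lambda>C. cnj (circuit_op n C $$ (i, j))) \<in> borel_measurable E" if "i < 2 ^ n" "j < 2 ^ n" for i j
    by (rule borel_measurable_continuous_on[OF _ m[OF that]]) (intro continuous_intros)
  have K: "(\<lambda>C. kron_pow (ket_bra (circuit_op n C *\<^sub>v ket0 n)) 4 $$ (k, l)) \<in> borel_measurable E"
    if "k < (2 ^ n) ^ 4" "l < (2 ^ n) ^ 4" for k l
  proof (rule kron_pow_measurable[OF ket_bra_state(1)[OF circuit_op_carrier] _ that])
    fix i j :: nat assume ij: "i < 2 ^ n" "j < 2 ^ n"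
    show "(\<lambda>C. ket_bra (circuit_op n C *\<^sub>v ket0 n) $$ (i, j)) \<in> borel_measurable E"
      unfolding ket_bra_state(2)[OF circuit_op_carrier ij]
      by (intro borel_measurable_times m c ij) simp_all
  qed
  have P: "prob_space E" and AE: "AE C in E. circuit_op n C \<in> clifford n"
    using E unfolding clifford_circuit_ensemble_def by auto
  show "(1 - \<epsilon>) / (2 ^ n + 1) \<le> measure E {C \<in> space E. stabilized n (circuit_op n C) p}"
    "measure E {C \<in> space E. stabilized n (circuit_op n C) p} \<le> (1 + \<epsilon>) / (2 ^ n + 1)"
    using design_stabilized_bounds[OF P K ensemble_stabilized_sets[OF E] AE design p] by blast+
qed

lemma stabilized_of_commute:
  assumes U: "U \<in> clifford n" and comm: "pauli_string n p * U = U * pauli_string n p"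
  shows "stabilized n U p \<longleftrightarrow> z_type n p"
proof -
  note u = unitary_opD[OF cliffordD[OF U]]
  have "conjugate_by U (pauli_string n p) = mat_adjoint U * U * pauli_string n p"
    unfolding conjugate_by_def assoc_mult_mat[OF u(2) pauli_string_carrier u(1)] comm
      assoc_mult_mat[OF u(2,1) pauli_string_carrier] ..
  also have "\<dots> = pauli_string n p" unfolding u(4) by simp
  finally show ?thesis
    unfolding stabilized_def pauli_expectation_eq[OF cliffordD[OF U]] by (simp add: pauli_string_entry_0)
qed

lemma single_nonidentity: "x < n \<Longrightarrow> a \<noteq> PI \<Longrightarrow> \<exists>q<n. single_string n x a q \<noteq> PI"
  unfolding single_string_def by auto

text \<open>At depth 0 the state is always the all-zero state, which X on a qubit never stabilizes,
  against the positive lower bound on that probability. Positive depth later absorbs the additive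
  constants of both bounds.\<close>

lemma design_depth_pos:
  assumes "\<epsilon> < 1" "n \<ge> 1" and E: "clifford_circuit_ensemble n G r d E"
    and design: "clifford_state_design \<epsilon> 4 n E (\<lambda>C. circuit_op n C *\<^sub>v ket0 n)"
  shows "d \<ge> 1"
proof (rule ccontr)
  assume "\<not> d \<ge> 1"
  then have d: "d = 0" by simp
  have "AE C in E. circuit n G r C \<and> length C \<le> d \<and> circuit_op n C \<in> clifford n"
    using E unfolding clifford_circuit_ensemble_def by blast
  then have AE: "AE C in E. length C \<le> 0" unfolding d by eventually_elim blast
  interpret prob_space E using E unfolding clifford_circuit_ensemble_def by blast
  let ?p = "single_string n 0 PX"
  let ?S = "{C \<in> space E. stabilized n (circuit_op n C) ?p}"
  have "\<not> z_type n ?p" unfolding z_type_def single_string_def using assms(2) by (auto intro!: exI[of _ 0])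
  then have ns: "\<not> stabilized n (1\<^sub>m (2 ^ n)) ?p"
    using stabilized_of_commute[OF one_clifford, of n ?p]
    by (simp add: left_mult_one_mat[OF pauli_string_carrier] right_mult_one_mat[OF pauli_string_carrier])
  have "AE C in E. C \<notin> ?S" using AE by eventually_elim (use ns in auto)
  then have "measure E ?S = 0"
    using ensemble_stabilized_sets[OF E] by (simp add: prob_eq_0)
  moreover have "(1 - \<epsilon>) / (2 ^ n + 1) > 0" using assms(1) by (simp add: add_pos_pos)
  ultimately show False
    using ensemble_bounds(1)[OF E design single_nonidentity, of 0 PX] assms(2) by simp
qed

section \<open>The diameter bound\<close>

lemma relpow_sym:
  assumes "sym G" "(a, b) \<in> G ^^ k" shows "(b, a) \<in> G ^^ k"
  using assms(2)
proof (induction k arbitrary: b)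
  case (Suc k)
  then obtain c where "(a, c) \<in> G ^^ k" "(c, b) \<in> G" by auto
  then have "(b, c) \<in> G" "(c, a) \<in> G ^^ k" using Suc.IH assms(1) by (auto dest: symD)
  then show ?case by (rule relpow_Suc_I2)
qed simp

definition jordan_wigner :: "nat \<Rightarrow> (nat \<Rightarrow> nat) \<Rightarrow> nat \<Rightarrow> nat \<Rightarrow> pauli" where
  "jordan_wigner n y j = (\<lambda>q\<in>{..<n}. if q = y j then PX else if \<exists>i<j. q = y i then PZ else PI)"

text \<open>The sign comes from site \<open>y j\<close> alone, where X meets Z. At earlier sites
  both strings carry Z, and elsewhere the string with the smaller index is trivial.\<close>

lemma jordan_wigner_sign:
  assumes "inj_on y {..<m}" "\<And>j. j < m \<Longrightarrow> y j < n" "j < k" "k < m"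
  shows "string_sign n (jordan_wigner n y j) (jordan_wigner n y k) = -1"
proof -
  have ne: "y i \<noteq> y i'" if "i < m" "i' < m" "i \<noteq> i'" for i i'
    using that assms(1) by (auto dest: inj_onD)
  have jm: "j < m" using assms(3,4) by simp
  have kj: "y k \<noteq> y j" using ne[of k j] jm assms(3,4) by simp
  have kn: "\<not> (\<exists>i<j. y k = y i)"
    using ne[OF assms(4)] jm assms(3) by (metis less_trans less_irrefl)
  have "string_sign n (jordan_wigner n y j) (jordan_wigner n y k) = (\<Prod>q<n. if q = y j then -1 else 1)"
    unfolding string_sign_def
  proof (rule prod.cong[OF refl])
    fix q assume "q \<in> {..<n}"
    then have q: "q < n" by simp
    show "pauli_sign (jordan_wigner n y j q) (jordan_wigner n y k q) = (if q = y j then - 1 else 1)"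
    proof (cases "q = y j")
      case True
      then have "jordan_wigner n y j q = PX" "jordan_wigner n y k q = PZ"
        using q kj assms(3) unfolding jordan_wigner_def by auto
      then show ?thesis using True by (simp add: pauli_sign_def)
    next
      case False
      have "jordan_wigner n y j q = PI \<or> jordan_wigner n y k q = jordan_wigner n y j q"
      proof (cases "\<exists>i<j. q = y i")
        case True
        then have "\<exists>i<k. q = y i" "q \<noteq> y k" using assms(3) kn by (auto intro: less_trans)
        then show ?thesis using True False q unfolding jordan_wigner_def by simp
      next
        case none: False
        have "jordan_wigner n y j q = PI" using False none q unfolding jordan_wigner_def by simp
        then show ?thesis by (rule disjI1)
      qed
      then show ?thesis using False by auto
    qed
  qed
  also have "\<dots> = -1" using assms(2)[OF jm] by simp
  finally show ?thesis .
qed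

lemma diameter_bound:
  assumes \<epsilon>: "\<epsilon> < 1" and m: "real m * (1 - \<epsilon>) \<ge> 2" and n: "n \<ge> 1" and G: "architecture n G" "connected_in G {..<n}"
    and E: "clifford_circuit_ensemble n G r d E"
    and design: "clifford_state_design \<epsilon> 4 n E (\<lambda>C. circuit_op n C *\<^sub>v ket0 n)"
  shows "graph_diam n G \<le> m + 2 * (d * (r * r))"
proof (rule ccontr)
  let ?D = "graph_diam n G" and ?R = "d * (r * r)"
  assume "\<not> ?D \<le> m + 2 * ?R"
  then have D: "m + 2 * ?R < ?D" by simp
  have GG: "G \<subseteq> {..<n} \<times> {..<n}" "sym G" using G(1) unfolding architecture_def by auto
  let ?dists = "{graph_dist G x y | x y. x < n \<and> y < n}"
  have eq: "?dists = (\<lambda>(x, y). graph_dist G x y) ` ({..<n} \<times> {..<n})" by auto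
  have "graph_diam n G \<in> ?dists" unfolding graph_diam_def
    by (rule Max_in) (use n in \<open>simp_all add: eq lessThan_empty_iff\<close>)
  then obtain x z where xz: "x < n" "z < n" "graph_dist G x z = ?D" by auto
  have "(x, z) \<in> (G \<inter> {..<n} \<times> {..<n})\<^sup>*" using G(2) xz(1,2) unfolding connected_in_def by blast
  then have "(x, z) \<in> G\<^sup>*" using rtrancl_mono[of "G \<inter> {..<n} \<times> {..<n}" G] by blast
  then obtain k where "(x, z) \<in> G ^^ k" using rtrancl_imp_relpow by blast
  then have "(x, z) \<in> G ^^ graph_dist G x z" unfolding graph_dist_def by (rule LeastI)
  then have path: "(x, z) \<in> G ^^ ?D" unfolding xz(3) .
  have short: "?D \<le> k" if "(x, z) \<in> G ^^ k" for k
    using that unfolding xz(3)[symmetric] graph_dist_def by (rule Least_le)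
  obtain f where f: "f 0 = x" "f ?D = z" "\<And>i. i < ?D \<Longrightarrow> (f i, f (Suc i)) \<in> G"
    using path unfolding relpow_fun_conv by blast
  have f_path: "(f i, f j) \<in> G ^^ (j - i)" if "i \<le> j" "j \<le> ?D" for i j
    unfolding relpow_fun_conv
    by (rule exI[of _ "\<lambda>k. f (i + k)"]) (use that f(3) in auto)
  \<comment> \<open>The sites are counted backwards from the far end \<open>z\<close> of the
    shortest path, so the first \<open>m\<close> of them lie within distance less than
    \<open>m\<close> of \<open>z\<close>.\<close>
  define y where "y j = f (?D - j)" for j
  have yz: "(y j, z) \<in> G ^^ j" if "j < m" for j
    using f_path[of "?D - j" ?D] that D f(2) unfolding y_def by simp
  have y_less: "y j < n" if "j < m" for j
  proof -
    \<comment> \<open>An edge of \<open>G\<close> has its endpoints below \<open>n\<close>, and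
      \<open>y j\<close> is the endpoint of one because the path is longer than
      \<open>j\<close>.\<close>
    have "(f (?D - j - 1), f (Suc (?D - j - 1))) \<in> G" by (rule f(3)) (use D in simp)
    moreover have "Suc (?D - j - 1) = ?D - j" using that D by simp
    ultimately show ?thesis using GG(1) unfolding y_def by auto
  qed
  have y_inj: "inj_on y {..<m}"
  proof (rule linorder_inj_onI')
    fix i j assume ij: "i \<in> {..<m}" "j \<in> {..<m}" "i < j"
    show "y i \<noteq> y j"
    proof
      assume e: "y i = y j"
      have "(x, y j) \<in> G ^^ (?D - j)" using f_path[of 0 "?D - j"] f(1) unfolding y_def by simp
      moreover have "(y j, z) \<in> G ^^ i" using yz[of i] ij e by simp
      ultimately have "(x, z) \<in> G ^^ (?D - j + i)" unfolding relpow_add by blast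
      then show False using short[of "?D - j + i"] ij D by simp
    qed
  qed
  have x_ne: "x \<noteq> y j" if "j < m" for j
    using short[of j] yz[OF that] that D by auto
  \<comment> \<open>A common point would give a walk from \<open>x\<close> through it and some
    \<open>y j\<close> to \<open>z\<close>, of length at most \<open>?R + ?R + j\<close> with
    \<open>j < m\<close>, which is shorter than the distance.\<close>
  have far: "ball_around G {x} ?R \<inter> ball_around G (y ` {..<m}) ?R = {}"
  proof (rule ccontr)
    assume "ball_around G {x} ?R \<inter> ball_around G (y ` {..<m}) ?R \<noteq> {}"
    then obtain w where w: "w \<in> ball_around G {x} ?R" "w \<in> ball_around G (y ` {..<m}) ?R" by blast
    obtain i where i: "i \<le> ?R" "(x, w) \<in> G ^^ i" using w(1) unfolding ball_around_def by auto
    obtain j i' where j: "j < m" "i' \<le> ?R" "(y j, w) \<in> G ^^ i'" using w(2) unfolding ball_around_def by auto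
    have "(w, y j) \<in> G ^^ i'" by (rule relpow_sym[OF GG(2) j(3)])
    then have "(w, z) \<in> G ^^ (i' + j)" unfolding relpow_add using yz[OF j(1)] by blast
    then have "(x, z) \<in> G ^^ (i + (i' + j))" unfolding relpow_add[of i] using i(2) by blast
    then show False using short[of "i + (i' + j)"] i(1) j(1,2) D by simp
  qed
  let ?p = "single_string n x PX" and ?q = "jordan_wigner n y"
  let ?s = "\<lambda>C. stabilized n (circuit_op n C)"
  have p_supp: "?p q = PI" if "q < n" "q \<notin> {x}" for q using that unfolding single_string_def by simp
  have q_supp: "?q j q = PI" if "j < m" "q < n" "q \<notin> y ` {..<m}" for j q
    using that unfolding jordan_wigner_def by auto
  have q_sign: "string_sign n (?q j) (?q k) = -1" if "j < m" "k < m" "j \<noteq> k" for j k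
  proof (cases "j < k")
    case True
    show ?thesis by (rule jordan_wigner_sign[OF y_inj y_less True that(2)])
  next
    case False
    then have "k < j" using that(3) by simp
    have "string_sign n (?q k) (?q j) = -1" by (rule jordan_wigner_sign[OF y_inj y_less \<open>k < j\<close> that(1)])
    then show ?thesis by (subst string_sign_commute)
  qed
  \<comment> \<open>The letter X at \<open>x\<close> survives, since the far string is trivial
    there; hence the design's lower bound applies to the product.\<close>
  have pq: "\<exists>q<n. string_prod n ?p (?q j) q \<noteq> PI" if "j < m" for j
  proof -
    have "x \<noteq> y i" if "i \<le> j" for i using x_ne that \<open>j < m\<close> by simp
    then have "?q j x = PI" unfolding jordan_wigner_def using xz(1) by auto
    then have "string_prod n ?p (?q j) x \<noteq> PI" using xz(1) unfolding string_prod_def single_string_def by simp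
    then show ?thesis using xz(1) by blast
  qed
  have AE: "AE C in E. circuit n G r C \<and> length C \<le> d \<and> circuit_op n C \<in> clifford n"
    using E unfolding clifford_circuit_ensemble_def by blast
  interpret prob_space E using E unfolding clifford_circuit_ensemble_def by blast
  have cone: "?s C ?p \<and> ?s C (?q j)"
    if C: "circuit n G r C" "length C \<le> d" "circuit_op n C \<in> clifford n" and j: "j < m"
      and s: "?s C (string_prod n ?p (?q j))" for C j
  proof -
    have R: "length C * (r * r) \<le> ?R" using C(2) by (rule mult_le_mono1)
    have "pullback n (circuit_op n C) ?p q = PI \<or> pullback n (circuit_op n C) (?q j) q = PI" if q: "q < n" for q
    proof (cases "q \<in> ball_around G {x} (length C * (r * r))")
      case True
      then have "q \<notin> ball_around G (y ` {..<m}) (length C * (r * r))"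
        using far ball_around_mono[OF R, of G] by blast
      from pullback_support[OF C(3,1) q_supp[OF j] q this] show ?thesis by (rule disjI2)
    next
      case False
      from pullback_support[OF C(3,1) p_supp q this] show ?thesis by (rule disjI1)
    qed
    from stabilized_disjoint_product[OF C(3) this s] show ?thesis by (rule conjI)
  qed
  let ?S = "\<lambda>p. {C \<in> space E. ?s C p}"
  have int: "integrable E (indicator (?S p) :: circuit \<Rightarrow> real)" for p
    using ensemble_stabilized_sets[OF E, of p] by (simp add: emeasure_eq_measure)
  have val: "(\<integral>C. indicator (?S p) C \<partial>E) = measure E (?S p)" for p
    using ensemble_stabilized_sets[OF E, of p] by (simp add: Int_absorb2 sets.sets_into_space)
  have "(\<Sum>j<m. measure E (?S (string_prod n ?p (?q j)))) = (\<integral>C. (\<Sum>j<m. indicator (?S (string_prod n ?p (?q j))) C) \<partial>E)"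
    by (simp only: Bochner_Integration.integral_sum[OF int] val)
  \<comment> \<open>Almost surely at most one event on the left occurs, because two would make
    anticommuting strings stabilize, and any of them entails the event for
    \<open>?p\<close>.\<close>
  also have "\<dots> \<le> (\<integral>C. indicator (?S ?p) C \<partial>E)"
  proof (rule integral_mono_AE[OF Bochner_Integration.integrable_sum[OF int] int])
    show "AE C in E. (\<Sum>j<m. indicator (?S (string_prod n ?p (?q j))) C) \<le> (indicator (?S ?p) C :: real)"
      using AE
    proof eventually_elim
      case (elim C)
      then have C: "circuit n G r C" "length C \<le> d" "circuit_op n C \<in> clifford n" by blast+
      show ?case
      proof (cases "\<exists>j<m. C \<in> ?S (string_prod n ?p (?q j))")
        case True
        then obtain j where j: "j < m" "C \<in> ?S (string_prod n ?p (?q j))" by blast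
        have sj: "?s C ?p" "?s C (?q j)" using cone[OF C j(1)] j(2) by auto
        have "indicator (?S (string_prod n ?p (?q k))) C = (0::real)" if k: "k < m" "k \<noteq> j" for k
        proof -
          have "\<not> ?s C (?q k)" using stabilized_anticommuting[OF C(3) q_sign[OF j(1) k(1)]] k(2) sj(2) by auto
          then have "C \<notin> ?S (string_prod n ?p (?q k))" using cone[OF C k(1)] by auto
          then show ?thesis by simp
        qed
        moreover have "indicator (?S (string_prod n ?p (?q j))) C = (1::real)" by (rule indicator_simps(1)[OF j(2)])
        ultimately have "indicator (?S (string_prod n ?p (?q k))) C = (if k = j then 1 else (0::real))" if "k < m" for k
          using that by (cases "k = j") simp_all
        then have "(\<Sum>k<m. indicator (?S (string_prod n ?p (?q k))) C) = (\<Sum>k<m. if k = j then 1 else (0::real))"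
          by (intro sum.cong refl) (simp only: lessThan_iff)
        also have "\<dots> = 1" using j(1) by simp
        also have "\<dots> = indicator (?S ?p) C" using sj(1) j(2) by simp
        finally show ?thesis by simp
      next
        case False
        then have "(\<Sum>j<m. indicator (?S (string_prod n ?p (?q j))) C) = (\<Sum>j<m. 0::real)"
          by (intro sum.cong refl indicator_simps(2)) (simp only: lessThan_iff, blast)
        then show ?thesis by simp
      qed
    qed
  qed
  also have "\<dots> = measure E (?S ?p)" by (rule val)
  also have "\<dots> \<le> (1 + \<epsilon>) / (2 ^ n + 1)"
    by (rule ensemble_bounds(2)[OF E design single_nonidentity[OF xz(1)]]) simp
  finally have "(\<Sum>j<m. measure E (?S (string_prod n ?p (?q j)))) \<le> (1 + \<epsilon>) / (2 ^ n + 1)" .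
  moreover have "(\<Sum>j<m. (1 - \<epsilon>) / (2 ^ n + 1)) \<le> (\<Sum>j<m. measure E (?S (string_prod n ?p (?q j))))"
    by (rule sum_mono) (use ensemble_bounds(1)[OF E design pq] in simp)
  ultimately have "(real m * (1 - \<epsilon>)) / (2 ^ n + 1) \<le> (1 + \<epsilon>) / (2 ^ n + 1)" by simp
  moreover have "(0::real) < 2 ^ n + 1" by (simp add: add_pos_pos)
  \<comment> \<open>The exponentially small factor is the same on both sides and cancels; what
    remains contradicts \<open>m\<close>, as the right side is below 2.\<close>
  ultimately have "real m * (1 - \<epsilon>) \<le> 1 + \<epsilon>" by (simp add: divide_le_cancel)
  then show False using m \<epsilon> by simp
qed

section \<open>The brickwork bound\<close>

text \<open>A new largest qubit becomes the most significant bit and leaves the ranks of the others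
  unchanged, which suits induction on the maximum.\<close>

lemma sub_index_insert:
  assumes "finite A" "\<And>x. x \<in> A \<Longrightarrow> x < b"
  shows "sub_index (insert b A) i = sub_index A i + of_bool (bit i b) * 2 ^ card A"
proof -
  have b: "b \<notin> A" using assms(2) by blast
  have "{p \<in> insert b A. p < b} = A" using assms(2) by auto
  moreover have "{p \<in> insert b A. p < q} = {p \<in> A. p < q}" if "q \<in> A" for q
    using assms(2)[OF that] by auto
  ultimately show ?thesis unfolding sub_index_def using assms(1) b by (simp add: add.commute)
qed

lemma sub_index_less: "finite a \<Longrightarrow> sub_index a i < 2 ^ card a"
proof (induction a rule: finite_linorder_max_induct)
  case (insert b A)
  then have "b \<notin> A" by blast
  then show ?case using insert by (simp add: sub_index_insert)
qed (simp add: sub_index_def)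

lemma sub_index_inject:
  assumes "finite a" "sub_index a i = sub_index a j" "q \<in> a"
  shows "bit i q = bit j q"
  using assms
proof (induction a arbitrary: q rule: finite_linorder_max_induct)
  case (insert b A)
  have A: "finite A" "\<And>x. x \<in> A \<Longrightarrow> x < b" using insert.hyps by blast+
  have e: "sub_index A i + of_bool (bit i b) * 2 ^ card A = sub_index A j + of_bool (bit j b) * 2 ^ card A"
    using insert.prems(1) sub_index_insert[of A b] A by simp
  have less: "sub_index A i < 2 ^ card A" "sub_index A j < 2 ^ card A" by (rule sub_index_less[OF A(1)])+
  have b: "bit i b = bit j b" using e less by (cases "bit i b"; cases "bit j b") simp_all
  then have "sub_index A i = sub_index A j" using e by simp
  then show ?case using insert.IH insert.prems(2) b by blast
qed simp

lemma gate_op_scalar: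
  assumes a: "a \<subseteq> {..<n}"
  shows "gate_op n (a, c \<cdot>\<^sub>m 1\<^sub>m (2 ^ card a)) = c \<cdot>\<^sub>m 1\<^sub>m (2 ^ n)"
proof (rule eq_matI)
  have fin: "finite a" using a by (rule finite_subset) simp
  fix i j assume "i < dim_row (c \<cdot>\<^sub>m 1\<^sub>m (2 ^ n))" "j < dim_col (c \<cdot>\<^sub>m 1\<^sub>m (2 ^ n))"
  then have ij: "i < 2 ^ n" "j < 2 ^ n" by simp_all
  have s: "sub_index a i < 2 ^ card a" "sub_index a j < 2 ^ card a" by (rule sub_index_less[OF fin])+
  have "(\<forall>q<n. q \<notin> a \<longrightarrow> bit i q = bit j q) \<and> sub_index a i = sub_index a j \<longleftrightarrow> i = j"
  proof
    assume h: "(\<forall>q<n. q \<notin> a \<longrightarrow> bit i q = bit j q) \<and> sub_index a i = sub_index a j"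
    have "\<forall>q<n. bit i q = bit j q"
    proof (intro allI impI)
      fix q assume "q < n"
      then show "bit i q = bit j q" using h sub_index_inject[OF fin, of i j q] by (cases "q \<in> a") simp_all
    qed
    then show "i = j" using bits_eq_iff[OF ij] by blast
  qed simp
  then show "gate_op n (a, c \<cdot>\<^sub>m 1\<^sub>m (2 ^ card a)) $$ (i, j) = (c \<cdot>\<^sub>m 1\<^sub>m (2 ^ n)) $$ (i, j)"
    using ij s unfolding gate_op_def by auto
qed (simp_all add: gate_op_def)

text \<open>Scalars instead of the identity alone: the representative drawn for the identity class
  may be any phase multiple of it.\<close>

definition scalar_at_0 :: "gate set" where
  "scalar_at_0 = {(a, V). 0 \<in> a \<longrightarrow> (\<exists>c. V = c \<cdot>\<^sub>m 1\<^sub>m (2 ^ card a))}"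

lemma mult_commute_step:
  assumes "A \<in> carrier_mat N N" "B \<in> carrier_mat N N" "Z \<in> carrier_mat N N"
    and "Z * A = A * Z" "Z * B = B * (Z :: complex mat)"
  shows "Z * (A * B) = (A * B) * Z"
  unfolding assoc_mult_mat[OF assms(3,1,2), symmetric] assms(4)
    assoc_mult_mat[OF assms(1,3,2)] assms(5) assoc_mult_mat[OF assms(1,2,3)] ..

text \<open>Each gate is a scalar or avoids qubit 0, so it commutes with Z on that qubit; hence so
  does the circuit, and Z stabilizes the all-zero state.\<close>

lemma stabilized_Z0:
  assumes C: "circuit n G r C" and U: "circuit_op n C \<in> clifford n"
    and sc: "\<And>l. l \<in> set C \<Longrightarrow> set l \<subseteq> scalar_at_0"
  shows "stabilized n (circuit_op n C) (single_string n 0 PZ)"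
proof -
  let ?Z = "pauli_string n (single_string n 0 PZ)"
  have Z: "local_on n {0} ?Z" by (rule pauli_string_local) (simp add: single_string_def)
  have gate: "?Z * gate_op n g = gate_op n g * ?Z" if g: "g \<in> scalar_at_0" "fst g \<subseteq> {..<n}" for g
  proof (cases "0 \<in> fst g")
    case True
    then obtain c where "g = (fst g, c \<cdot>\<^sub>m 1\<^sub>m (2 ^ card (fst g)))"
      using g(1) unfolding scalar_at_0_def by (cases g) auto
    then have e: "gate_op n g = c \<cdot>\<^sub>m 1\<^sub>m (2 ^ n)" using gate_op_scalar[OF g(2)] by metis
    show ?thesis
      unfolding e mult_smult_distrib[OF pauli_string_carrier one_carrier_mat]
        mult_smult_assoc_mat[OF one_carrier_mat pauli_string_carrier] by simp
  next
    case False
    then show ?thesis by (intro local_on_commute[OF Z gate_op_local[OF g(2)]]) simp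
  qed
  have lay: "?Z * layer_op n l = layer_op n l * ?Z" if "set l \<subseteq> scalar_at_0" "\<forall>g\<in>set l. fst g \<subseteq> {..<n}" for l
    using that
  proof (induction l)
    case (Cons g l)
    then show ?case
      by (simp, intro mult_commute_step[OF layer_op_carrier gate_op_carrier pauli_string_carrier]) (simp_all add: gate)
  qed (simp add: left_mult_one_mat[OF pauli_string_carrier] right_mult_one_mat[OF pauli_string_carrier])
  have sub: "\<forall>g\<in>set l. fst g \<subseteq> {..<n}" if "l \<in> set C" for l
    using C that unfolding circuit_def layer_def local_support_def by fastforce
  \<comment> \<open>Generalised to lists of layers of \<open>C\<close>, so that the induction keeps
    the facts about its layers.\<close>
  have "?Z * circuit_op n C' = circuit_op n C' * ?Z" if "set C' \<subseteq> set C" for C'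
    using that
  proof (induction C')
    case (Cons l C')
    then have "?Z * layer_op n l = layer_op n l * ?Z" by (intro lay sc sub) simp_all
    with Cons show ?case
      by (simp, intro mult_commute_step[OF circuit_op_carrier layer_op_carrier pauli_string_carrier]) simp_all
  qed (simp add: left_mult_one_mat[OF pauli_string_carrier] right_mult_one_mat[OF pauli_string_carrier])
  then have "?Z * circuit_op n C = circuit_op n C * ?Z" by simp
  moreover have "z_type n (single_string n 0 PZ)" unfolding z_type_def single_string_def by simp
  ultimately show ?thesis using stabilized_of_commute[OF U] by blast
qed

section \<open>Probability that a brickwork acts trivially on one qubit\<close>

lemma measure_clifford_pmf_scalar:
  "measure (measure_pmf (clifford_pmf k)) {V. \<exists>c. V = c \<cdot>\<^sub>m 1\<^sub>m (2 ^ k)} \<ge> 1 / card (clifford k // phase_rel k)"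
proof -
  let ?Q = "clifford k // phase_rel k" and ?A = "{V. \<exists>c. V = c \<cdot>\<^sub>m (1\<^sub>m (2 ^ k) :: complex mat)}"
  let ?c = "phase_rel k `` {1\<^sub>m (2 ^ k)}"
  have c: "?c \<in> ?Q" by (rule quotientI[OF one_clifford])
  have "representative ?c \<in> ?A" using representative(1)[OF c] unfolding phase_rel_def by auto
  then have "{?c} \<subseteq> {c \<in> ?Q. representative c \<in> ?A}" using c by blast
  then have "card {?c} \<le> card {c \<in> ?Q. representative c \<in> ?A}"
    by (rule card_mono[rotated]) (use finite_clifford_classes in simp)
  then have "1 \<le> real (card {c \<in> ?Q. representative c \<in> ?A})" by simp
  then show ?thesis unfolding measure_clifford_pmf by (rule divide_right_mono) simp
qed

text \<open>A single crude bound for all gate sizes up to \<open>r\<close>; its reciprocal bounds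
  from below the probability of drawing the identity class.\<close>

definition class_bound :: "nat \<Rightarrow> nat" where
  "class_bound r = (\<Sum>k\<le>r. card (clifford k // phase_rel k))"

lemma class_bound_ge: "k \<le> r \<Longrightarrow> card (clifford k // phase_rel k) \<le> class_bound r"
  unfolding class_bound_def by (rule member_le_sum) auto

lemma card_classes_pos: "0 < card (clifford k // phase_rel k)"
  using finite_clifford_classes clifford_classes_nonempty by (simp add: card_gt_0_iff)

lemma class_bound_pos: "1 \<le> class_bound r"
  using class_bound_ge[of 0 r] card_classes_pos[of 0] by simp

lemma measure_brick_scalar:
  assumes "card a \<le> r"
  shows "measure (measure_pmf (brick_pmf (a, b))) scalar_at_0 \<ge> (if 0 \<in> a then 1 / class_bound r else 1)"
proof -
  have B: "0 < real (class_bound r)" "1 / real (class_bound r) \<le> 1" using class_bound_pos[of r] by simp_all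
  let ?p = "if b then clifford_pmf (card a) else return_pmf (1\<^sub>m (2 ^ card a))"
  let ?A = "{V. \<exists>c. V = c \<cdot>\<^sub>m (1\<^sub>m (2 ^ card a) :: complex mat)}"
  have m: "measure (measure_pmf (brick_pmf (a, b))) scalar_at_0 = measure (measure_pmf ?p) (Pair a -` scalar_at_0)"
    unfolding brick_pmf_def by (simp only: prod.case measure_map_pmf)
  show ?thesis
  proof (cases "0 \<in> a")
    case False
    then have "Pair a -` scalar_at_0 = UNIV" unfolding scalar_at_0_def by auto
    then show ?thesis unfolding m using False by simp
  next
    case True
    then have v: "Pair a -` scalar_at_0 = ?A" unfolding scalar_at_0_def by auto
    have "1 / class_bound r \<le> measure (measure_pmf ?p) ?A"
    proof (cases b)
      case True
      have "1 / real (class_bound r) \<le> 1 / card (clifford (card a) // phase_rel (card a))"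
        using class_bound_ge[OF assms] card_classes_pos[of "card a"] by (intro divide_left_mono) simp_all
      also have "\<dots> \<le> measure (measure_pmf (clifford_pmf (card a))) ?A" by (rule measure_clifford_pmf_scalar)
      finally show ?thesis using True by simp
    next
      case False
      have "1\<^sub>m (2 ^ card a) \<in> ?A" by (auto intro!: exI[of _ 1])
      then have "measure (measure_pmf (return_pmf (1\<^sub>m (2 ^ card a)))) ?A = 1"
        by (simp only: measure_return_pmf indicator_simps)
      then show ?thesis using False B(2) by (simp only: if_False)
    qed
    then show ?thesis unfolding m v using True by simp
  qed
qed

lemma measure_independent_list:
  "measure (measure_pmf (independent_list_pmf ps)) {xs. set xs \<subseteq> A} = (\<Prod>p\<leftarrow>ps. measure (measure_pmf p) A)"
proof (induction ps)
  case (Cons p ps)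
  let ?I = "independent_list_pmf ps"
  have "emeasure (measure_pmf (independent_list_pmf (p # ps))) {xs. set xs \<subseteq> A} =
      (\<integral>\<^sup>+x. emeasure (measure_pmf ?I) {xs. set xs \<subseteq> A} * indicator A x \<partial>measure_pmf p)"
    unfolding independent_list_pmf.simps emeasure_bind_pmf emeasure_map_pmf
  proof (rule nn_integral_cong)
    fix x
    have "((#) x) -` {xs. set xs \<subseteq> A} = (if x \<in> A then {xs. set xs \<subseteq> A} else {})" by auto
    then show "emeasure (measure_pmf ?I) ((#) x -` {xs. set xs \<subseteq> A}) =
        emeasure (measure_pmf ?I) {xs. set xs \<subseteq> A} * indicator A x" by simp
  qed
  also have "\<dots> = emeasure (measure_pmf ?I) {xs. set xs \<subseteq> A} * emeasure (measure_pmf p) A"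
    by (rule nn_integral_cmult_indicator) simp
  finally have "measure (measure_pmf (independent_list_pmf (p # ps))) {xs. set xs \<subseteq> A} =
      measure (measure_pmf ?I) {xs. set xs \<subseteq> A} * measure (measure_pmf p) A"
    unfolding measure_pmf.emeasure_eq_measure
    by (simp add: ennreal_mult[symmetric] measure_nonneg)
  then show ?case unfolding Cons.IH by (simp add: mult.commute)
qed simp

lemma length_independent_list: "xs \<in> set_pmf (independent_list_pmf ps) \<Longrightarrow> length xs = length ps"
  by (induction ps arbitrary: xs) auto

text \<open>The parts of a layer are disjoint, so at most one brick contains qubit 0 and costs a
  factor; all others lie in \<open>scalar_at_0\<close> with probability 1. This keeps the bound per
  layer independent of \<open>n\<close>.\<close>

lemma measure_layer_scalar:
  assumes "distinct (map fst l)" "\<And>b b'. b \<in> set l \<Longrightarrow> b' \<in> set l \<Longrightarrow> fst b \<noteq> fst b' \<Longrightarrow> fst b \<inter> fst b' = {}"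
    and "\<And>b. b \<in> set l \<Longrightarrow> card (fst b) \<le> r"
  shows "(\<Prod>b\<leftarrow>l. measure (measure_pmf (brick_pmf b)) scalar_at_0) \<ge>
    (if \<exists>b\<in>set l. 0 \<in> fst b then 1 / class_bound r else 1)"
  using assms
proof (induction l)
  case (Cons b l)
  let ?P = "\<Prod>b\<leftarrow>l. measure (measure_pmf (brick_pmf b)) scalar_at_0"
  let ?m = "measure (measure_pmf (brick_pmf b)) scalar_at_0"
  have IH: "?P \<ge> (if \<exists>b\<in>set l. 0 \<in> fst b then 1 / class_bound r else 1)"
    by (rule Cons.IH) (use Cons.prems in simp_all)
  have m: "?m \<ge> (if 0 \<in> fst b then 1 / class_bound r else 1)"
    using measure_brick_scalar[of "fst b" r "snd b"] Cons.prems(3)[of b] by simp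
  have B: "1 / real (class_bound r) \<ge> 0" by simp
  show ?case
  proof (cases "0 \<in> fst b")
    case True
    have "\<not> (\<exists>b'\<in>set l. 0 \<in> fst b')"
    proof
      assume "\<exists>b'\<in>set l. 0 \<in> fst b'"
      then obtain b' where b': "b' \<in> set l" "0 \<in> fst b'" by blast
      have "fst b \<noteq> fst b'" using Cons.prems(1) b'(1) by auto
      then show False using Cons.prems(2)[of b b'] b' True by auto
    qed
    then have "?P \<ge> 1" using IH by simp
    then have "1 / class_bound r * 1 \<le> ?m * ?P" using m True B by (intro mult_mono) simp_all
    then show ?thesis using True by simp
  next
    case False
    have "1 * (if \<exists>b\<in>set l. 0 \<in> fst b then 1 / class_bound r else 1) \<le> ?m * ?P"
      using m False IH B by (intro mult_mono) simp_all
    then show ?thesis using False by simp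
  qed
qed simp

text \<open>Independence is used twice, for the bricks within a layer and for the layers.\<close>

lemma measure_fixed_brickwork_scalar:
  assumes "brickwork_layout n G r s"
  shows "measure (measure_pmf (fixed_brickwork_pmf s)) {C. set C \<subseteq> {l. set l \<subseteq> scalar_at_0}} \<ge>
    (1 / class_bound r) ^ length s"
proof -
  have B: "1 / real (class_bound r) \<ge> 0" "1 / real (class_bound r) \<le> 1" using class_bound_pos[of r] by simp_all
  have "(1 / class_bound r) ^ length s \<le>
      (\<Prod>l\<leftarrow>s. measure (measure_pmf (independent_list_pmf (map brick_pmf l))) {l. set l \<subseteq> scalar_at_0})"
    using assms
  proof (induction s)
    case (Cons l s)
    have l: "distinct (map fst l)" "partition_on {..<n} (fst ` set l)" "\<forall>a\<in>fst ` set l. local_support n G r a"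
      and s: "brickwork_layout n G r s" using Cons.prems unfolding brickwork_layout_def by simp_all
    have "(if \<exists>b\<in>set l. 0 \<in> fst b then 1 / class_bound r else 1) \<le> (\<Prod>b\<leftarrow>l. measure (measure_pmf (brick_pmf b)) scalar_at_0)"
    proof (rule measure_layer_scalar[OF l(1)])
      show "fst b \<inter> fst b' = {}" if "b \<in> set l" "b' \<in> set l" "fst b \<noteq> fst b'" for b b'
        using l(2) that unfolding partition_on_def disjoint_def by blast
      show "card (fst b) \<le> r" if "b \<in> set l" for b
        using l(3) that unfolding local_support_def by blast
    qed
    then have "1 / class_bound r \<le> (\<Prod>b\<leftarrow>l. measure (measure_pmf (brick_pmf b)) scalar_at_0)"
      using B(2) by (auto split: if_splits)
    also have "\<dots> = measure (measure_pmf (independent_list_pmf (map brick_pmf l))) {l. set l \<subseteq> scalar_at_0}"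
      unfolding measure_independent_list by (simp add: o_def)
    finally have 1: "1 / class_bound r \<le> \<dots>" .
    show ?case using mult_mono[OF 1 Cons.IH[OF s]] B(1) by simp
  qed simp
  moreover have "measure (measure_pmf (fixed_brickwork_pmf s)) {C. set C \<subseteq> {l. set l \<subseteq> scalar_at_0}} =
      (\<Prod>p\<leftarrow>map (\<lambda>l. independent_list_pmf (map brick_pmf l)) s. measure (measure_pmf p) {l. set l \<subseteq> scalar_at_0})"
    unfolding fixed_brickwork_pmf_def by (rule measure_independent_list)
  ultimately show ?thesis by (simp add: o_def)
qed

lemma brickwork_bound:
  assumes \<epsilon>: "\<epsilon> < 1" and n: "n \<ge> 1" and E: "clifford_circuit_ensemble n G r d E"
    and design: "clifford_state_design \<epsilon> 4 n E (\<lambda>C. circuit_op n C *\<^sub>v ket0 n)"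
    and brick: "generalized_random_brickwork n G r E"
  shows "(2::real) ^ n \<le> 2 * real (class_bound r) ^ d"
proof -
  obtain W where W: "\<And>s. s \<in> set_pmf W \<Longrightarrow> brickwork_layout n G r s" "E = measure_pmf (bind_pmf W fixed_brickwork_pmf)"
    using brick unfolding generalized_random_brickwork_def by blast
  let ?B = "real (class_bound r)" and ?E = "bind_pmf W fixed_brickwork_pmf"
  have B: "0 < ?B" "1 \<le> ?B" "0 \<le> 1 / ?B" "1 / ?B \<le> 1" using class_bound_pos[of r] by simp_all
  have "AE C in E. circuit n G r C \<and> length C \<le> d \<and> circuit_op n C \<in> clifford n"
    using E unfolding clifford_circuit_ensemble_def by blast
  then have supp: "circuit n G r C \<and> length C \<le> d \<and> circuit_op n C \<in> clifford n" if "C \<in> set_pmf ?E" for C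
    unfolding W(2) AE_measure_pmf_iff using that by blast
  let ?A = "{C. set C \<subseteq> {l. set l \<subseteq> scalar_at_0}}"
  \<comment> \<open>The depth bound concerns circuits; it carries over to a layout in the support of
    \<open>W\<close> because every circuit drawn from the layout has as many layers as the
    layout.\<close>
  have fixed: "(1 / ?B) ^ d \<le> measure (measure_pmf (fixed_brickwork_pmf s)) ?A" if s: "s \<in> set_pmf W" for s
  proof -
    obtain C where C: "C \<in> set_pmf (fixed_brickwork_pmf s)" using set_pmf_not_empty[of "fixed_brickwork_pmf s"] by blast
    then have "C \<in> set_pmf ?E" using s by auto
    then have "length C \<le> d" using supp by blast
    moreover have "length C = length s" using length_independent_list[OF C[unfolded fixed_brickwork_pmf_def]] by simp
    ultimately have "(1 / ?B) ^ d \<le> (1 / ?B) ^ length s" using B by (intro power_decreasing) simp_all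
    also have "\<dots> \<le> measure (measure_pmf (fixed_brickwork_pmf s)) ?A" by (rule measure_fixed_brickwork_scalar[OF W(1)[OF s]])
    finally show ?thesis .
  qed
  have "ennreal ((1 / ?B) ^ d) = (\<integral>\<^sup>+s. ennreal ((1 / ?B) ^ d) \<partial>measure_pmf W)" by simp
  also have "\<dots> \<le> (\<integral>\<^sup>+s. emeasure (measure_pmf (fixed_brickwork_pmf s)) ?A \<partial>measure_pmf W)"
    by (rule nn_integral_mono_AE)
       (simp add: AE_measure_pmf_iff measure_pmf.emeasure_eq_measure ennreal_leI fixed)
  also have "\<dots> = emeasure (measure_pmf ?E) ?A" by (rule emeasure_bind_pmf[symmetric])
  finally have "(1 / ?B) ^ d \<le> measure (measure_pmf ?E) ?A"
    unfolding measure_pmf.emeasure_eq_measure by (simp add: ennreal_le_iff)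
  \<comment> \<open>Only circuits in the support are known to be well formed and Clifford, as
    \<open>stabilized_Z0\<close> requires.\<close>
  also have "\<dots> = measure (measure_pmf ?E) (?A \<inter> set_pmf ?E)" by (rule measure_Int_set_pmf[symmetric])
  also have "\<dots> \<le> measure (measure_pmf ?E) {C. stabilized n (circuit_op n C) (single_string n 0 PZ)}"
  proof (rule measure_pmf.finite_measure_mono)
    show "?A \<inter> set_pmf ?E \<subseteq> {C. stabilized n (circuit_op n C) (single_string n 0 PZ)}"
    proof
      fix C assume C: "C \<in> ?A \<inter> set_pmf ?E"
      have "stabilized n (circuit_op n C) (single_string n 0 PZ)"
        by (rule stabilized_Z0) (use C supp[of C] in auto)
      then show "C \<in> {C. stabilized n (circuit_op n C) (single_string n 0 PZ)}" by simp
    qed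
  qed simp
  also have "\<dots> \<le> (1 + \<epsilon>) / (2 ^ n + 1)"
    using ensemble_bounds(2)[OF E design single_nonidentity, of 0 PZ] n unfolding W(2) by simp
  also have "\<dots> \<le> 2 / 2 ^ n" using \<epsilon> by (intro frac_le) simp_all
  finally have "(1 / ?B) ^ d \<le> 2 / 2 ^ n" .
  then show ?thesis using B(1) by (simp add: power_divide field_simps)
qed

text \<open>Both bounds are affine in \<open>d\<close>; positive depth absorbs their constant terms,
  and the smaller of the two resulting slopes serves both claims.\<close>

theorem theoremS13:
  fixes \<epsilon> :: real and r :: nat
  assumes "\<epsilon> < 1"
  shows "\<exists>c::real. c > 0 \<and>
    (\<forall>(n::nat) (G :: (nat \<times> nat) set) (d::nat) (E :: circuit measure).
       n \<ge> 1 \<longrightarrow> architecture n G \<longrightarrow>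
       clifford_circuit_ensemble n G r d E \<longrightarrow>
       clifford_state_design \<epsilon> 4 n E (\<lambda>C. circuit_op n C *\<^sub>v ket0 n) \<longrightarrow>
         (connected_in G {..<n} \<and> locally_independent n G E \<longrightarrow> real d \<ge> c * real (graph_diam n G)) \<and>
         (generalized_random_brickwork n G r E \<longrightarrow> real d \<ge> c * real n))"
proof -
  obtain m :: nat where m: "2 / (1 - \<epsilon>) \<le> real m" using real_arch_simple by blast
  then have m2: "real m * (1 - \<epsilon>) \<ge> 2" using assms by (simp add: field_simps)
  \<comment> \<open>With \<open>d >= 1\<close>, the bound \<open>m + 2 * (d * (r * r))\<close> is at
    most \<open>d\<close> times this number.\<close>
  define a where "a = real (m + 2 * (r * r))"
  \<comment> \<open>The logarithm of the brickwork bound reads n <= 1 + d log B with B the class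
    bound, which is at most \<open>d * b\<close> for \<open>d >= 1\<close>.\<close>
  define b where "b = 1 + log 2 (real (class_bound r))"
  have "m > 0" using m2 by (cases m) simp_all
  then have a: "a > 0" unfolding a_def by (simp add: add_pos_nonneg)
  have b: "b > 0" unfolding b_def using class_bound_pos[of r] by (intro add_pos_nonneg) simp_all
  show ?thesis
  proof (intro exI[of _ "min (1 / a) (1 / b)"] conjI allI impI)
    show "min (1 / a) (1 / b) > 0" using a b by simp
    fix n G d and E :: "circuit measure"
    assume n: "n \<ge> 1" and G: "architecture n G" and E: "clifford_circuit_ensemble n G r d E"
      and design: "clifford_state_design \<epsilon> 4 n E (\<lambda>C. circuit_op n C *\<^sub>v ket0 n)"
    have d: "d \<ge> 1" by (rule design_depth_pos[OF assms n E design])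
    { assume "connected_in G {..<n} \<and> locally_independent n G E"
      then have "graph_diam n G \<le> m + 2 * (d * (r * r))"
        using diameter_bound[OF assms m2 n G _ E design] by blast
      also have "\<dots> \<le> d * (m + 2 * (r * r))" using d by (cases d) (simp_all add: algebra_simps)
      finally have "real (graph_diam n G) \<le> real (d * (m + 2 * (r * r)))" by (simp only: of_nat_le_iff)
      then have "real (graph_diam n G) \<le> real d * a" unfolding a_def by (simp only: of_nat_mult)
      then have "1 / a * real (graph_diam n G) \<le> real d" using a by (simp add: field_simps)
      moreover have "min (1 / a) (1 / b) * real (graph_diam n G) \<le> 1 / a * real (graph_diam n G)"
        by (rule mult_right_mono) simp_all
      ultimately show "real d \<ge> min (1 / a) (1 / b) * real (graph_diam n G)" by linarith }
    { assume "generalized_random_brickwork n G r E"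
      from brickwork_bound[OF assms n E design this]
      have "log 2 (2 ^ n) \<le> log 2 (2 * real (class_bound r) ^ d)"
        using class_bound_pos[of r] by (subst log_le_cancel_iff) simp_all
      also have "\<dots> = 1 + real d * log 2 (real (class_bound r))"
        using class_bound_pos[of r] by (simp add: log_mult log_nat_power)
      also have "\<dots> \<le> real d * b" unfolding b_def using d by (simp add: algebra_simps)
      finally have "real n \<le> real d * b" by (simp add: log_nat_power)
      then have "1 / b * real n \<le> real d" using b by (simp add: field_simps)
      moreover have "min (1 / a) (1 / b) * real n \<le> 1 / b * real n"
        by (rule mult_right_mono) simp_all
      ultimately show "real d \<ge> min (1 / a) (1 / b) * real n" by linarith }
  qed
qed

end
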